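(* Let $n\geq 3$ and let $R$ be the Kazhdan-Lusztig semiring of the dihedral group $D_{2\cdot n}$, i.e. the $\mathbb{Z}_{\geq 0}$-subsemiring of $\mathbb{Z}[D_{2\cdot n}]$ generated by the Kazhdan-Lusztig basis elements $\underline{w}$, $w\in D_{2\cdot n}$. Then, up to isomorphism, the $R$-semimodules $C_{\{\underline{e}\}}$, $C_{\{\underline{w_0}\}}$, $K$, $K_1$, $K_2$ and $K_3$ (defined in the context) are the only elementary proper $R$-semimodules.
   Context: A semiring is a tuple $(R,+,\cdot,0,1)$ where $(R,+,0)$ is a commutative monoid, $(R,\cdot,1)$ is a monoid, multiplication distributes over addition on both sides, and $0a=a0=0$ for all $a\in R$. A (left) $R$-semimodule is a commutative monoid $(M,+,0_M)$ with a map $R\times M\to M$, $(r,m)\mapsto r(m)$, such that $r(m+n)=r(m)+r(n)$, $r(0_M)=0_M$, $(r+s)(m)=r(m)+s(m)$, $(rs)(m)=r(s(m))$, $0(m)=0_M$, $1(m)=m$. It is called an $R$-module if $M$ is an abelian group, and a proper semimodule if it is not a module. A subsemimodule is a submonoid closed under the action of $R$. An $R$-congruence on $M$ is an equivalence relation $\sim$ such that $m\sim n$ implies $m+k\sim n+k$ for all $k\in M$ and $r(m)\sim r(n)$ for all $r\in R$. A non-zero $R$-semimodule $M$ is called elementary if its only $R$-congruences are the equality relation and the full relation $M\times M$. $D_{2\cdot n}=\langle s,t: s^2=t^2=(st)^n=(ts)^n=e\rangle$ is the dihedral group with $2n$ elements, with longest element $w_0=stst\cdots=tsts\cdots$ ($n$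 factors). Every $w\neq w_0$ has a unique reduced expression. Bruhat order: $x\preceq w$ iff $x=w$ or $x$ has strictly smaller length than $w$. The Kazhdan-Lusztig basis elements of $\mathbb{Z}[D_{2\cdot n}]$ are $\underline{w}:=\sum_{x\preceq w}x$; they form a $\mathbb{Z}_{\geq 0}$-basis of $R$. Let $\mathcal{L}_s$ (resp. $\mathcal{L}_t$) be the set of all $\underline{w}$ with $w\neq e,w_0$ whose reduced expression has $s$ (resp. $t$) as the rightmost letter. The semimodules (each $\underline{w}$ acts as described, extended additively to $R$): - $C_{\{\underline{e}\}}$: underlying monoid $\{0,1\}$ with $1+1=1$; $\underline{e}$ acts as the identity and $\underline{w}$ acts as zero for $w\neq e$. - $C_{\{\underline{w_0}\}}$: underlying monoid $\{0,1\}$ with $1+1=1$; every $\underline{w}$ acts as the identity. - $K$: underlying monoid the set $2^{\{x,y\}}=\{0,x,y,x+y\}$ of subsets of $\{x,y\}$ under union (all elements idempotent, $0=\varnothing$); $\underline{e}$ acts as the identity; $\underline{w_0}$ acts as zero; each $\underline{w}\in\mathcal{L}_s$ annihilates $y$ and maps both $x$ and $x+y$ to $x+y$; each $\underline{w}\in\mathcal{L}_t$ annihilates $x$ and maps both $y$ and $x+y$ to $x+y$. - $K_1=\{0,x,x+y\}$, $K_2=\{0,y,x+y\}$, $K_3=\{0,x+y\}$, viewed as subsemimodules of $K$. *)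

theory Defs
  imports "HOL-Algebra.Algebra"
begin

text \<open>
  Semimodules use the record type \<open>module\<close> of HOL-Algebra; as for modules there, its
  fields \<open>mult\<close> and \<open>one\<close> play no role. The locale \<open>semiring\<close> of HOL-Algebra is the
  notion needed here: unital, with absorbing zero, and not assumed commutative.
\<close>

locale semimodule = R?: semiring R + M?: abelian_monoid M
  for R :: "('r, 'x) ring_scheme" (structure)
    and M :: "('r, 'm, 'y) module_scheme" (structure) +
  assumes smult_closed: "\<lbrakk>r \<in> carrier R; m \<in> carrier M\<rbrakk> \<Longrightarrow> r \<odot>\<^bsub>M\<^esub> m \<in> carrier M"
    and smult_add_right: "\<lbrakk>r \<in> carrier R; m \<in> carrier M; k \<in> carrier M\<rbrakk>
      \<Longrightarrow> r \<odot>\<^bsub>M\<^esub> (m \<oplus>\<^bsub>M\<^esub> k) = r \<odot>\<^bsub>M\<^esub> m \<oplus>\<^bsub>M\<^esub> r \<odot>\<^bsub>M\<^esub> k"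
    and smult_zero_right: "r \<in> carrier R \<Longrightarrow> r \<odot>\<^bsub>M\<^esub> \<zero>\<^bsub>M\<^esub> = \<zero>\<^bsub>M\<^esub>"
    and smult_add_left: "\<lbrakk>r \<in> carrier R; q \<in> carrier R; m \<in> carrier M\<rbrakk>
      \<Longrightarrow> (r \<oplus>\<^bsub>R\<^esub> q) \<odot>\<^bsub>M\<^esub> m = r \<odot>\<^bsub>M\<^esub> m \<oplus>\<^bsub>M\<^esub> q \<odot>\<^bsub>M\<^esub> m"
    and smult_assoc: "\<lbrakk>r \<in> carrier R; q \<in> carrier R; m \<in> carrier M\<rbrakk>
      \<Longrightarrow> (r \<otimes>\<^bsub>R\<^esub> q) \<odot>\<^bsub>M\<^esub> m = r \<odot>\<^bsub>M\<^esub> (q \<odot>\<^bsub>M\<^esub> m)"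
    and smult_zero_left: "m \<in> carrier M \<Longrightarrow> \<zero>\<^bsub>R\<^esub> \<odot>\<^bsub>M\<^esub> m = \<zero>\<^bsub>M\<^esub>"
    and smult_one: "m \<in> carrier M \<Longrightarrow> \<one>\<^bsub>R\<^esub> \<odot>\<^bsub>M\<^esub> m = m"

definition proper_semimodule ::
  "('r, 'x) ring_scheme \<Rightarrow> ('r, 'm, 'y) module_scheme \<Rightarrow> bool" where
  "proper_semimodule R M \<longleftrightarrow> semimodule R M \<and> \<not> abelian_group M"

definition semimodule_congruence ::
  "('r, 'x) ring_scheme \<Rightarrow> ('r, 'm, 'y) module_scheme \<Rightarrow> ('m \<times> 'm) set \<Rightarrow> bool" where
  "semimodule_congruence R M E \<longleftrightarrow>
     equiv (carrier M) E \<and>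
     (\<forall>m m'. (m, m') \<in> E \<longrightarrow>
        (\<forall>k\<in>carrier M. (m \<oplus>\<^bsub>M\<^esub> k, m' \<oplus>\<^bsub>M\<^esub> k) \<in> E) \<and>
        (\<forall>r\<in>carrier R. (r \<odot>\<^bsub>M\<^esub> m, r \<odot>\<^bsub>M\<^esub> m') \<in> E))"

definition elementary_semimodule ::
  "('r, 'x) ring_scheme \<Rightarrow> ('r, 'm, 'y) module_scheme \<Rightarrow> bool" where
  "elementary_semimodule R M \<longleftrightarrow>
     semimodule R M \<and> carrier M \<noteq> {\<zero>\<^bsub>M\<^esub>} \<and>
     (\<forall>E. semimodule_congruence R M E \<longrightarrow>
        E = Id_on (carrier M) \<or> E = carrier M \<times> carrier M)"

definition semimodule_isomorphic ::
  "('r, 'x) ring_scheme \<Rightarrow> ('r, 'm, 'y) module_scheme \<Rightarrow> ('r, 'k, 'z) module_scheme \<Rightarrow> bool" where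
  "semimodule_isomorphic R M N \<longleftrightarrow>
     (\<exists>f. bij_betw f (carrier M) (carrier N) \<and>
          f \<zero>\<^bsub>M\<^esub> = \<zero>\<^bsub>N\<^esub> \<and>
          (\<forall>m\<in>carrier M. \<forall>k\<in>carrier M. f (m \<oplus>\<^bsub>M\<^esub> k) = f m \<oplus>\<^bsub>N\<^esub> f k) \<and>
          (\<forall>r\<in>carrier R. \<forall>m\<in>carrier M. f (r \<odot>\<^bsub>M\<^esub> m) = r \<odot>\<^bsub>N\<^esub> f m))"

datatype letter = gen_s | gen_t

text \<open>
  The congruence on words generated by the relations of the presentation
  $\langle s,t : s^2 = t^2 = (st)^n = (ts)^n = e\rangle$. As both generators are made
  self-inverse, words in \<open>s\<close> and \<open>t\<close> alone (no formal inverses) present the group.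
\<close>

inductive_set dihedral_rel :: "nat \<Rightarrow> (letter list \<times> letter list) set" for n :: nat where
  ss: "([gen_s, gen_s], []) \<in> dihedral_rel n"
| tt: "([gen_t, gen_t], []) \<in> dihedral_rel n"
| st: "(concat (replicate n [gen_s, gen_t]), []) \<in> dihedral_rel n"
| ts: "(concat (replicate n [gen_t, gen_s]), []) \<in> dihedral_rel n"
| refl: "(u, u) \<in> dihedral_rel n"
| sym: "(u, v) \<in> dihedral_rel n \<Longrightarrow> (v, u) \<in> dihedral_rel n"
| trans: "(u, v) \<in> dihedral_rel n \<Longrightarrow> (v, w) \<in> dihedral_rel n \<Longrightarrow> (u, w) \<in> dihedral_rel n"
| app: "(u, v) \<in> dihedral_rel n \<Longrightarrow> (u', v') \<in> dihedral_rel n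
    \<Longrightarrow> (u @ u', v @ v') \<in> dihedral_rel n"

text \<open>A group element is the set of all words representing it.\<close>

type_synonym dih = "letter list set"

definition dih_class :: "nat \<Rightarrow> letter list \<Rightarrow> dih" where
  "dih_class n u = dihedral_rel n `` {u}"

definition dihedral :: "nat \<Rightarrow> dih monoid" where
  "dihedral n =
     \<lparr>carrier = UNIV // dihedral_rel n,
      monoid.mult = (\<lambda>g h. \<Union>u\<in>g. \<Union>v\<in>h. dih_class n (u @ v)),
      monoid.one = dih_class n []\<rparr>"

definition dih_length :: "dih \<Rightarrow> nat" where
  "dih_length g = (LEAST k. \<exists>u\<in>g. length u = k)"

definition reduced_expression :: "dih \<Rightarrow> letter list \<Rightarrow> bool" where
  "reduced_expression g u \<longleftrightarrow> u \<in> g \<and> length u = dih_length g"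

definition dih_w0 :: "nat \<Rightarrow> dih" where
  "dih_w0 n = dih_class n (map (\<lambda>i. if even i then gen_s else gen_t) [0..<n])"

definition bruhat_le :: "dih \<Rightarrow> dih \<Rightarrow> bool" where
  "bruhat_le x w \<longleftrightarrow> x = w \<or> dih_length x < dih_length w"

text \<open>
  The index sets of \<open>\<L>\<^sub>s\<close> and \<open>\<L>\<^sub>t\<close>: elements other than \<open>e\<close> and \<open>w\<^sub>0\<close> whose (unique)
  reduced expression has the given rightmost letter.
\<close>

definition left_cell :: "nat \<Rightarrow> letter \<Rightarrow> dih set" where
  "left_cell n a =
     {w \<in> carrier (dihedral n). w \<noteq> \<one>\<^bsub>dihedral n\<^esub> \<and> w \<noteq> dih_w0 n \<and>
        (\<exists>u. reduced_expression w u \<and> u \<noteq> [] \<and> last u = a)}"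

text \<open>
  The integral group ring of a finite group: functions vanishing off the carrier, with
  convolution as product.
\<close>

definition int_group_ring :: "('g, 'x) monoid_scheme \<Rightarrow> ('g \<Rightarrow> int) ring" where
  "int_group_ring G =
     \<lparr>carrier = {a. \<forall>g. g \<notin> carrier G \<longrightarrow> a g = 0},
      monoid.mult = (\<lambda>a b g. \<Sum>(x, y) | x \<in> carrier G \<and> y \<in> carrier G \<and> x \<otimes>\<^bsub>G\<^esub> y = g. a x * b y),
      monoid.one = (\<lambda>g. if g = \<one>\<^bsub>G\<^esub> then 1 else 0),
      ring.zero = (\<lambda>g. 0),
      ring.add = (\<lambda>a b g. a g + b g)\<rparr>"

inductive_set generated_subsemiring :: "('r, 'x) ring_scheme \<Rightarrow> 'r set \<Rightarrow> 'r set"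
  for A :: "('r, 'x) ring_scheme" and B :: "'r set" where
  zero: "\<zero>\<^bsub>A\<^esub> \<in> generated_subsemiring A B"
| one: "\<one>\<^bsub>A\<^esub> \<in> generated_subsemiring A B"
| incl: "a \<in> B \<Longrightarrow> a \<in> generated_subsemiring A B"
| add: "a \<in> generated_subsemiring A B \<Longrightarrow> b \<in> generated_subsemiring A B
    \<Longrightarrow> a \<oplus>\<^bsub>A\<^esub> b \<in> generated_subsemiring A B"
| mult: "a \<in> generated_subsemiring A B \<Longrightarrow> b \<in> generated_subsemiring A B
    \<Longrightarrow> a \<otimes>\<^bsub>A\<^esub> b \<in> generated_subsemiring A B"

definition kl_basis :: "nat \<Rightarrow> dih \<Rightarrow> (dih \<Rightarrow> int)" where
  "kl_basis n w = (\<lambda>x. if x \<in> carrier (dihedral n) \<and> bruhat_le x w then 1 else 0)"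

definition kl_semiring :: "nat \<Rightarrow> (dih \<Rightarrow> int) ring" where
  "kl_semiring n =
     (int_group_ring (dihedral n))
       \<lparr>carrier := generated_subsemiring (int_group_ring (dihedral n))
                    (kl_basis n ` carrier (dihedral n))\<rparr>"

text \<open>
  The coefficients of an element of the semiring in its basis \<open>kl_basis\<close>; they exist and are
  unique for every element of the semiring.
\<close>

definition kl_coeff :: "nat \<Rightarrow> (dih \<Rightarrow> int) \<Rightarrow> (dih \<Rightarrow> nat)" where
  "kl_coeff n a =
     (THE c. (\<forall>w. w \<notin> carrier (dihedral n) \<longrightarrow> c w = 0) \<and>
             a = (\<lambda>x. \<Sum>w\<in>carrier (dihedral n). int (c w) * kl_basis n w x))"

text \<open>
  The semimodule on the commutative monoid \<open>(C, f, z)\<close> on which the basis element \<open>kl_basis n w\<close>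
  acts by \<open>act w\<close>, extended additively to the whole semiring.
\<close>

definition kl_semimodule ::
  "nat \<Rightarrow> 'm set \<Rightarrow> ('m \<Rightarrow> 'm \<Rightarrow> 'm) \<Rightarrow> 'm \<Rightarrow> (dih \<Rightarrow> 'm \<Rightarrow> 'm)
     \<Rightarrow> (dih \<Rightarrow> int, 'm) module" where
  "kl_semimodule n C f z act =
     (let A = \<lparr>carrier = C, monoid.mult = undefined, monoid.one = undefined,
               ring.zero = z, ring.add = f\<rparr>
      in \<lparr>carrier = C, monoid.mult = undefined, monoid.one = undefined,
          ring.zero = z, ring.add = f,
          module.smult = (\<lambda>a m. \<Oplus>\<^bsub>A\<^esub>w\<in>carrier (dihedral n). [kl_coeff n a w] \<cdot>\<^bsub>A\<^esub> act w m)\<rparr>)"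

text \<open>
  The monoid \<open>{0, 1}\<close> with \<open>1 + 1 = 1\<close> is \<open>bool\<close> with disjunction.
\<close>

definition C_e :: "nat \<Rightarrow> (dih \<Rightarrow> int, bool) module" where
  "C_e n = kl_semimodule n UNIV (\<or>) False
     (\<lambda>w m. if w = \<one>\<^bsub>dihedral n\<^esub> then m else False)"

definition C_w0 :: "nat \<Rightarrow> (dih \<Rightarrow> int, bool) module" where
  "C_w0 n = kl_semimodule n UNIV (\<or>) False (\<lambda>w m. m)"

datatype pt = pt_x | pt_y

text \<open>
  In \<open>K\<close> the elements \<open>0, x, y, x + y\<close> are the subsets of \<open>{x, y}\<close>, so the condition
  \<open>pt_x \<in> m\<close> below singles out \<open>x\<close> and \<open>x + y\<close>.
\<close>

definition K_action :: "nat \<Rightarrow> dih \<Rightarrow> pt set \<Rightarrow> pt set" where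
  "K_action n w m =
     (if w = \<one>\<^bsub>dihedral n\<^esub> then m
      else if w = dih_w0 n then {}
      else if w \<in> left_cell n gen_s then (if pt_x \<in> m then {pt_x, pt_y} else {})
      else if w \<in> left_cell n gen_t then (if pt_y \<in> m then {pt_x, pt_y} else {})
      else undefined)"

definition K :: "nat \<Rightarrow> (dih \<Rightarrow> int, pt set) module" where
  "K n = kl_semimodule n (Pow {pt_x, pt_y}) (\<union>) {} (K_action n)"

definition K1 :: "nat \<Rightarrow> (dih \<Rightarrow> int, pt set) module" where
  "K1 n = (K n)\<lparr>carrier := {{}, {pt_x}, {pt_x, pt_y}}\<rparr>"

definition K2 :: "nat \<Rightarrow> (dih \<Rightarrow> int, pt set) module" where
  "K2 n = (K n)\<lparr>carrier := {{}, {pt_y}, {pt_x, pt_y}}\<rparr>"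

definition K3 :: "nat \<Rightarrow> (dih \<Rightarrow> int, pt set) module" where
  "K3 n = (K n)\<lparr>carrier := {{}, {pt_x, pt_y}}\<rparr>"

end

theory Submission
  imports Defs "HOL-Number_Theory.Cong"
begin

text \<open>
  Let the generators act on the integers by the reflections \<open>s: z \<mapsto> 1 - z\<close> and
  \<open>t: z \<mapsto> - 1 - z\<close>. The image of \<open>0\<close> under a word, taken modulo \<open>2n\<close>, determines the group
  element (\<open>rel_iff_code\<close>). This turns the dihedral group into a cycle of length \<open>2n\<close> on which
  left multiplication by a generator is a reflection and the length is the distance to \<open>0\<close>.
  The basis element of \<open>w \<noteq> e\<close> becomes the indicator function of an interval, whose closed form
  \<open>kl_fun\<close> in terms of the first letter \<open>\<sigma>\<close> (as a sign) and the length \<open>k\<close> makes sense for all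
  integers \<open>k\<close>, is odd in \<open>k\<close>, and grows by \<open>2\<close> when \<open>k\<close> grows by \<open>2n\<close>.

  Multiplying the element \<open>(- \<sigma>, k)\<close> on the left by the basis element of the generator \<open>\<sigma>\<close>
  gives the sum of \<open>(\<sigma>, k + 1)\<close> and \<open>(\<sigma>, k - 1)\<close>. By this Chebyshev recursion all products of basis elements are
  sums of \<open>kl_fun\<close> over arithmetic progressions of step \<open>2\<close> (\<open>kl_product\<close>). The symmetries in \<open>k\<close>
  fold such a progression into the range \<open>1..n\<close>, where it has non-negative coefficients
  (\<open>cone_product_sum\<close>). Hence the semiring is the span of its basis over the natural numbers
  (\<open>carrier_R\<close>), and the product of two elements of \<open>\<L>\<^sub>s \<union> \<L>\<^sub>t\<close> involves an element of the left cell
  of the right factor (\<open>product_support_cell\<close>).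

  On an idempotent monoid only the set of basis elements that occur in a ring element matters for
  its action. The six candidates are therefore semimodules because of what is known about
  supports of products (\<open>kl_lattice_module\<close>). They are elementary because any two distinct elements
  are separated by a ring element that sends one to the top and the other to the bottom.

  Conversely, let \<open>M\<close> be elementary and proper. Call two elements equivalent if each of them,
  added to some other element, yields a multiple of the other. If this congruence were the full
  relation, every element would be invertible. So it is equality, and since \<open>m\<close> is equivalent to
  \<open>m + m\<close>, addition is idempotent (\<open>elementary_proper_idempotent\<close>). The kernel of a homomorphism
  from \<open>M\<close> to one of the candidates is a congruence, so the homomorphism is zero or injective.
  The map \<open>m \<mapsto> (w\<^sub>0 m \<noteq> 0)\<close> goes to \<open>C_w0\<close>. If it is zero, then sending \<open>m\<close> to the set of
  generators that do not annihilate it is a homomorphism to \<open>K\<close>: vanishing spreads along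
  left cells by the recursion above (\<open>theta_cell_smult_eq_zero_iff\<close>). Its image contains the top
  and the bottom, and the only such subsets are the carriers of \<open>K\<close>, \<open>K1\<close>, \<open>K2\<close> and \<open>K3\<close>. If this
  map is zero too, every basis element except \<open>e\<close> annihilates \<open>M\<close>, and \<open>m \<mapsto> (m \<noteq> 0)\<close> is a
  non-zero homomorphism to \<open>C_e\<close>.
\<close>

section \<open>The dihedral group as a cycle of length 2n\<close>

primrec sgn_letter :: "letter \<Rightarrow> int" where
  "sgn_letter gen_s = 1"
| "sgn_letter gen_t = -1"

text \<open>
  The point to which the word moves \<open>0\<close> when the letters act by the reflections
  \<open>z \<mapsto> sgn_letter a - z\<close>.
\<close>

primrec code :: "letter list \<Rightarrow> int" where
  "code [] = 0"
| "code (a # u) = sgn_letter a - code u"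

text \<open>
  The group law on codes: a word of even length acts as a translation, one of odd length as a
  reflection, and the parity of the length is that of the code.
\<close>

definition twist :: "int \<Rightarrow> int \<Rightarrow> int" where
  "twist z y = (if even z then z + y else z - y)"

primrec flip :: "letter \<Rightarrow> letter" where
  "flip gen_s = gen_t"
| "flip gen_t = gen_s"

primrec alt :: "letter \<Rightarrow> nat \<Rightarrow> letter list" where
  "alt a 0 = []"
| "alt a (Suc k) = a # alt (flip a) k"

definition normal_word :: "int \<Rightarrow> letter list" where
  "normal_word z = (if 0 \<le> z then alt gen_s (nat z) else alt gen_t (nat (- z)))"

lemma flip_flip [simp]: "flip (flip a) = a"
  by (cases a) auto

lemma sgn_letter_flip [simp]: "sgn_letter (flip a) = - sgn_letter a"
  by (cases a) auto

lemma odd_sgn_letter [simp]: "odd (sgn_letter a)"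
  by (cases a) auto

lemma code_append: "code (u @ v) = twist (code u) (code v)"
  by (induction u) (auto simp: twist_def)

lemma code_alt [simp]: "code (alt a k) = sgn_letter a * int k"
  by (induction k arbitrary: a) (auto simp: algebra_simps)

lemma length_alt [simp]: "length (alt a k) = k"
  by (induction k arbitrary: a) auto

lemma alt_eq_Nil_iff [simp]: "alt a k = [] \<longleftrightarrow> k = 0"
  by (cases k) auto

lemma last_alt: "0 < k \<Longrightarrow> last (alt a k) = (if odd k then a else flip a)"
proof (induction k arbitrary: a)
  case (Suc k) then show ?case by (cases "k = 0") auto
qed simp

lemma code_normal_word [simp]: "code (normal_word z) = z"
  by (auto simp: normal_word_def)

lemma length_normal_word [simp]: "length (normal_word z) = nat \<bar>z\<bar>"
  by (auto simp: normal_word_def)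

lemma abs_code_le_length: "\<bar>code u\<bar> \<le> int (length u)"
proof (induction u)
  case (Cons a u)
  then show ?case by (cases a) auto
qed simp

text \<open>
  A further letter either extends an alternating word or cancels its first letter, according to
  the side of \<open>0\<close> on which \<open>z\<close> lies.
\<close>

lemma Cons_normal_word:
  "a # normal_word z = normal_word (sgn_letter a - z) \<or>
   normal_word z = a # normal_word (sgn_letter a - z)"
proof (cases "sgn_letter a * z \<le> 0")
  case True
  show ?thesis
  proof (cases a)
    case gen_s
    with True have "nat (1 - z) = Suc (nat (- z))" "z \<le> 0" by auto
    with gen_s show ?thesis by (cases "z = 0") (auto simp: normal_word_def)
  next
    case gen_t
    with True have "nat (1 + z) = Suc (nat z)" "0 \<le> z" by auto
    moreover from this have "- (- 1 - z) = 1 + z" "\<not> 0 \<le> - 1 - z" by auto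
    ultimately have "normal_word (- 1 - z) = gen_t # normal_word z"
      by (simp only: normal_word_def) simp
    with gen_t show ?thesis by simp
  qed
next
  case False
  show ?thesis
  proof (cases a)
    case gen_s
    with False have "nat z = Suc (nat (z - 1))" "0 < z" by auto
    with gen_s show ?thesis by (cases "z = 1") (auto simp: normal_word_def)
  next
    case gen_t
    with False have "nat (- z) = Suc (nat (- 1 - z))" "z < 0" by auto
    with gen_t show ?thesis by (auto simp: normal_word_def)
  qed
qed

text \<open>
  Each letter moves the code by at most one step away from \<open>0\<close>, so a word that gets as far
  as its length allows has to alternate. This gives the uniqueness of reduced expressions.
\<close>

lemma word_eq_normal_word_if_short:
  "\<bar>code u\<bar> = int (length u) \<Longrightarrow> u = normal_word (code u)"
proof (induction u)
  case (Cons a u)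
  then have *: "\<bar>code u\<bar> = int (length u)"
    using abs_code_le_length[of u] by (cases a) auto
  then have u: "u = normal_word (code u)" by (rule Cons.IH)
  have "length (a # u) = nat \<bar>sgn_letter a - code u\<bar>" using Cons.prems by simp
  moreover from Cons_normal_word[of a "code u"] u have
    "a # u = normal_word (code (a # u)) \<or> length u = Suc (nat \<bar>sgn_letter a - code u\<bar>)"
    by (metis code.simps(2) length_Cons length_normal_word)
  ultimately show ?case by auto
qed (simp add: normal_word_def)

lemma code_concat_replicate: "code (concat (replicate k [a, flip a])) = 2 * sgn_letter a * int k"
  by (induction k) (auto simp: algebra_simps)

locale kl_dihedral =
  fixes n :: nat
  assumes n_ge_3: "3 \<le> n"
begin

abbreviation period :: int where "period \<equiv> 2 * int n"

lemma rel_code: "(u, v) \<in> dihedral_rel n \<Longrightarrow> [code u = code v] (mod period)"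
proof (induction rule: dihedral_rel.induct)
  case st
  then show ?case using code_concat_replicate[of n gen_s] by (simp add: cong_def)
next
  case ts
  then show ?case using code_concat_replicate[of n gen_t] by (simp add: cong_def mod_minus_eq)
next
  case (app u v u' v')
  have "even (code u) \<longleftrightarrow> even (code v)"
    using app.IH(1) by (metis cong_dvd_iff cong_dvd_modulus dvd_triv_left)
  then show ?case using app.IH
    by (auto simp: code_append twist_def intro: cong_add cong_diff)
qed (auto simp: cong_sym elim: cong_trans)

lemma rel_Cons: "(u, v) \<in> dihedral_rel n \<Longrightarrow> (a # u, a # v) \<in> dihedral_rel n"
  using dihedral_rel.app[OF dihedral_rel.refl[of "[a]"]] by fastforce

lemma rel_cancel: "(a # a # u, u) \<in> dihedral_rel n"
  using dihedral_rel.app[OF _ dihedral_rel.refl, of "[a, a]" "[]" n u] dihedral_rel.ss dihedral_rel.tt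
  by (cases a) auto

lemma rel_normal_word: "(u, normal_word (code u)) \<in> dihedral_rel n"
proof (induction u)
  case (Cons a u)
  have 1: "(a # u, a # normal_word (code u)) \<in> dihedral_rel n"
    using Cons by (rule rel_Cons)
  have "(a # normal_word (code u), normal_word (code (a # u))) \<in> dihedral_rel n"
    using Cons_normal_word[of a "code u"] rel_cancel dihedral_rel.refl by (metis code.simps(2))
  with 1 show ?case by (rule dihedral_rel.trans)
qed (simp add: normal_word_def dihedral_rel.refl)

text \<open>
  The code of \<open>(st)\<^sup>n\<close> is \<open>2n\<close>, so putting this trivial word in front of an alternating one shifts
  the code by the period.
\<close>

lemma rel_normal_word_period:
  "(normal_word (z + period), normal_word z) \<in> dihedral_rel n"
proof -
  let ?r = "concat (replicate n [gen_s, gen_t])"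
  have c: "code (?r @ normal_word z) = z + period"
    using code_concat_replicate[of n gen_s] by (simp add: code_append twist_def)
  have "(?r @ normal_word z, normal_word z) \<in> dihedral_rel n"
    using dihedral_rel.app[OF dihedral_rel.st dihedral_rel.refl] by fastforce
  moreover have "(normal_word (z + period), ?r @ normal_word z) \<in> dihedral_rel n"
    using dihedral_rel.sym[OF rel_normal_word[of "?r @ normal_word z"]] unfolding c .
  ultimately show ?thesis by (metis dihedral_rel.trans)
qed

lemma rel_normal_word_cong:
  assumes "[z = z'] (mod period)"
  shows "(normal_word z, normal_word z') \<in> dihedral_rel n"
proof -
  have "(normal_word (z + period * int k), normal_word z) \<in> dihedral_rel n" for z k
  proof (induction k)
    case (Suc k)
    have "z + period * int (Suc k) = (z + period * int k) + period" by (simp add: algebra_simps)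
    with rel_normal_word_period[of "z + period * int k"] Suc show ?case
      by (metis dihedral_rel.trans)
  qed (simp add: dihedral_rel.refl)
  note up = this
  from assms obtain k where k: "z' = z + period * k"
    using cong_iff_lin by blast
  show ?thesis
  proof (cases "0 \<le> k")
    case True
    then have "z + period * int (nat k) = z'" using k by simp
    then show ?thesis using up[of z "nat k"] dihedral_rel.sym by metis
  next
    case False
    then have "z' + period * int (nat (- k)) = z" using k by simp
    then show ?thesis using up[of z' "nat (- k)"] by metis
  qed
qed

theorem rel_iff_code: "(u, v) \<in> dihedral_rel n \<longleftrightarrow> [code u = code v] (mod period)"
proof
  assume "[code u = code v] (mod period)"
  then have "(u, normal_word (code v)) \<in> dihedral_rel n"
    by (rule dihedral_rel.trans[OF rel_normal_word rel_normal_word_cong])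
  moreover have "(normal_word (code v), v) \<in> dihedral_rel n"
    by (rule dihedral_rel.sym[OF rel_normal_word])
  ultimately show "(u, v) \<in> dihedral_rel n" by (rule dihedral_rel.trans)
qed (rule rel_code)

definition cls :: "int \<Rightarrow> dih" where
  "cls z = {u. [code u = z] (mod period)}"

lemma dih_class_eq: "dih_class n u = cls (code u)"
  by (auto simp: dih_class_def cls_def rel_iff_code cong_sym_eq)

lemma normal_word_in_cls: "normal_word z \<in> cls z"
  by (simp add: cls_def)

lemma cls_eq_iff: "cls z = cls z' \<longleftrightarrow> [z = z'] (mod period)"
proof
  assume "cls z = cls z'"
  then show "[z = z'] (mod period)" using normal_word_in_cls[of z] by (simp add: cls_def)
qed (auto simp: cls_def cong_def)

lemma cls_mod: "cls (z mod period) = cls z"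
  by (simp add: cls_eq_iff)

lemma carrier_dihedral: "carrier (dihedral n) = range cls"
proof -
  have "carrier (dihedral n) = range (dih_class n)"
    unfolding dihedral_def quotient_def dih_class_def by auto
  also have "\<dots> = range (\<lambda>u. cls (code u))" by (simp add: dih_class_eq)
  also have "\<dots> = range cls"
  proof -
    have "range code = UNIV" by (rule surjI) (rule code_normal_word)
    then show ?thesis by (metis image_image)
  qed
  finally show ?thesis .
qed

lemma twist_cong:
  assumes "[z = z'] (mod period)" "[y = y'] (mod period)"
  shows "[twist z y = twist z' y'] (mod period)"
proof -
  have "even z \<longleftrightarrow> even z'"
    using assms(1) by (metis cong_dvd_iff cong_dvd_modulus dvd_triv_left)
  then show ?thesis using assms by (auto simp: twist_def intro: cong_add cong_diff)
qed

lemma mult_cls: "cls z \<otimes>\<^bsub>dihedral n\<^esub> cls y = cls (twist z y)"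
proof -
  have "cls (twist (code u) (code v)) = cls (twist z y)" if "u \<in> cls z" "v \<in> cls y" for u v
  proof -
    have "[code u = z] (mod period)" "[code v = y] (mod period)"
      using that by (simp_all add: cls_def)
    then show ?thesis unfolding cls_eq_iff by (rule twist_cong)
  qed
  then have "cls z \<otimes>\<^bsub>dihedral n\<^esub> cls y = (\<Union>u\<in>cls z. \<Union>v\<in>cls y. cls (twist z y))"
    by (simp add: dihedral_def dih_class_eq code_append)
  then show ?thesis using normal_word_in_cls by blast
qed

lemma one_dihedral: "\<one>\<^bsub>dihedral n\<^esub> = cls 0"
  by (simp add: dihedral_def dih_class_eq)

lemma twist_assoc: "twist (twist x y) z = twist x (twist y z)"
  by (auto simp: twist_def)

lemma twist_0: "twist 0 z = z" and twist_0': "twist z 0 = z"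
  by (simp_all add: twist_def)

lemma monoid_dihedral: "Group.monoid (dihedral n)"
  by (rule monoidI)
    (auto simp: carrier_dihedral mult_cls one_dihedral twist_assoc twist_0 twist_0')

lemma finite_dihedral: "finite (carrier (dihedral n))"
proof -
  have "cls z \<in> cls ` {0..<period}" for z
    using n_ge_3 by (intro image_eqI[of _ _ "z mod period"]) (simp_all add: cls_mod)
  then have "range cls \<subseteq> cls ` {0..<period}" by blast
  then show ?thesis unfolding carrier_dihedral by (rule finite_subset) simp
qed

lemma cls_representative: obtains y where "- int n < y" "y \<le> int n" "cls z = cls y"
proof
  let ?y = "(z + int n - 1) mod period - int n + 1"
  have "0 \<le> (z + int n - 1) mod period" "(z + int n - 1) mod period < period"
    using n_ge_3 by auto
  then show "- int n < ?y" "?y \<le> int n" by auto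
  have "[(z + int n - 1) mod period - int n + 1 = (z + int n - 1) - int n + 1] (mod period)"
    by (intro cong_add cong_diff) auto
  then show "cls z = cls ?y" by (simp add: cls_eq_iff cong_sym_eq)
qed

lemma cls_eqD:
  assumes "cls z = cls y" "\<bar>z\<bar> \<le> int n" "\<bar>y\<bar> < int n"
  shows "z = y"
proof -
  obtain k where k: "y = z + period * k"
    using assms(1) unfolding cls_eq_iff cong_iff_lin by blast
  have "\<bar>period * k\<bar> < period" using k assms(2,3) by linarith
  then have "k = 0" using n_ge_3 by (auto simp: abs_mult)
  with k show ?thesis by simp
qed

lemma length_ge_if_in_cls:
  assumes "u \<in> cls z" "\<bar>z\<bar> \<le> int n"
  shows "\<bar>z\<bar> \<le> int (length u)"
proof (rule ccontr)
  assume "\<not> ?thesis"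
  then have "\<bar>code u\<bar> < \<bar>z\<bar>" using abs_code_le_length[of u] by linarith
  moreover have "cls z = cls (code u)"
    unfolding cls_eq_iff using assms(1) by (simp add: cls_def cong_sym_eq)
  ultimately show False using cls_eqD[of z "code u"] assms(2) by auto
qed

text \<open>
  The alternating word attains the length, and no word in the class can be shorter because \<open>z\<close>
  has the smallest absolute value in its residue class.
\<close>

lemma dih_length_cls: "\<bar>z\<bar> \<le> int n \<Longrightarrow> dih_length (cls z) = nat \<bar>z\<bar>"
  unfolding dih_length_def
  by (rule Least_equality)
    (use normal_word_in_cls length_normal_word length_ge_if_in_cls in \<open>fastforce+\<close>)

lemma dih_w0_eq: "dih_w0 n = cls (int n)"
proof -
  have "map (\<lambda>i. if even i then gen_s else gen_t) [0..<k] = alt gen_s k \<and>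
        map (\<lambda>i. if even i then gen_t else gen_s) [0..<k] = alt gen_t k" for k
  proof (induction k)
    case (Suc k)
    have odd: "(\<lambda>i. if odd i then a else b) = (\<lambda>i. if even i then b else a)" for a b :: letter
      by auto
    from Suc show ?case
      by (simp add: upt_conv_Cons map_Suc_upt[symmetric] comp_def odd del: upt_Suc)
  qed simp
  then show ?thesis by (simp add: dih_w0_def dih_class_eq)
qed

text \<open>
  The reduced expression of \<open>cls (\<sigma> * k)\<close> starts with the letter of sign \<open>\<sigma>\<close> and alternates, so its
  last letter has the sign \<open>\<sigma>\<close> exactly if \<open>k\<close> is odd.
\<close>

lemma left_cell_eq:
  "left_cell n a =
     {cls (\<sigma> * int k) | \<sigma> k. \<bar>\<sigma>\<bar> = 1 \<and> 0 < k \<and> k < n \<and> sgn_letter a = (if odd k then \<sigma> else - \<sigma>)}"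
  (is "_ = ?R")
proof -
  have iff: "(\<exists>u. reduced_expression (cls (\<sigma> * int k)) u \<and> u \<noteq> [] \<and> last u = a)
      \<longleftrightarrow> sgn_letter a = (if odd k then \<sigma> else - \<sigma>)"
    if "\<bar>\<sigma>\<bar> = 1" "0 < k" "k < n" for \<sigma> k
  proof -
    let ?z = "\<sigma> * int k"
    have abs: "\<bar>?z\<bar> = int k" using that by (simp add: abs_mult)
    have red: "reduced_expression (cls ?z) u \<longleftrightarrow> u = normal_word ?z" for u
    proof
      assume r: "reduced_expression (cls ?z) u"
      then have len: "length u = k" and u: "u \<in> cls ?z"
        using that abs by (auto simp: reduced_expression_def dih_length_cls)
      from u have "cls (code u) = cls ?z" unfolding cls_eq_iff by (simp add: cls_def)
      then have "code u = ?z"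
        using abs_code_le_length[of u] abs that len by (intro cls_eqD) auto
      with word_eq_normal_word_if_short[of u] abs len show "u = normal_word ?z" by simp
    next
      assume "u = normal_word ?z"
      with that abs show "reduced_expression (cls ?z) u"
        using normal_word_in_cls by (auto simp: reduced_expression_def dih_length_cls)
    qed
    have sg: "\<sigma> = 1 \<or> \<sigma> = -1" using that(1) by linarith
    then have "normal_word ?z = alt (if \<sigma> = 1 then gen_s else gen_t) k"
      using that by (auto simp: normal_word_def)
    with that have "normal_word ?z \<noteq> []"
      and last: "last (normal_word ?z) =
        (if odd k then if \<sigma> = 1 then gen_s else gen_t else if \<sigma> = 1 then gen_t else gen_s)"
      by (simp_all add: last_alt)
    then have "(\<exists>u. reduced_expression (cls ?z) u \<and> u \<noteq> [] \<and> last u = a)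
        \<longleftrightarrow> last (normal_word ?z) = a"
      unfolding red by blast
    with sg show ?thesis unfolding last by (cases a) auto
  qed
  show ?thesis
  proof (intro equalityI subsetI)
    fix w assume w: "w \<in> left_cell n a"
    then obtain x where "w = cls x" unfolding left_cell_def carrier_dihedral by blast
    then obtain z where z: "- int n < z" "z \<le> int n" "w = cls z"
      using cls_representative[of x] by metis
    with w have nz: "z \<noteq> 0" "z \<noteq> int n"
      by (auto simp: left_cell_def one_dihedral dih_w0_eq)
    have s: "\<bar>sgn z\<bar> = 1" "0 < nat \<bar>z\<bar>" "nat \<bar>z\<bar> < n" "sgn z * int (nat \<bar>z\<bar>) = z"
      using nz z by (auto simp: abs_sgn_eq sgn_mult_abs)
    with iff[OF s(1-3)] w z(3) have "sgn_letter a = (if odd (nat \<bar>z\<bar>) then sgn z else - sgn z)"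
      by (simp add: left_cell_def)
    then show "w \<in> ?R"
      unfolding mem_Collect_eq
      using s z(3) by (intro exI[of _ "sgn z"] exI[of _ "nat \<bar>z\<bar>"] conjI) simp_all
  next
    fix w assume "w \<in> ?R"
    then obtain \<sigma> k where k: "w = cls (\<sigma> * int k)" "\<bar>\<sigma>\<bar> = 1" "0 < k" "k < n"
      "sgn_letter a = (if odd k then \<sigma> else - \<sigma>)" by blast
    have abs: "\<bar>\<sigma> * int k\<bar> = int k" using k by (simp add: abs_mult)
    have "w \<noteq> \<one>\<^bsub>dihedral n\<^esub>"
    proof
      assume "w = \<one>\<^bsub>dihedral n\<^esub>"
      then have "cls (\<sigma> * int k) = cls 0" using k(1) one_dihedral by simp
      then have "\<sigma> * int k = 0" using abs k(4) n_ge_3 by (intro cls_eqD) auto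
      with abs k(3) show False by simp
    qed
    moreover have "w \<noteq> dih_w0 n"
    proof
      assume "w = dih_w0 n"
      then have "cls (int n) = cls (\<sigma> * int k)" using k(1) dih_w0_eq by simp
      then have "int n = \<sigma> * int k" using abs k(4) by (intro cls_eqD) auto
      then show False using abs k(4) by linarith
    qed
    moreover have "\<exists>u. reduced_expression w u \<and> u \<noteq> [] \<and> last u = a"
      unfolding k(1) iff[OF k(2-4)] by (rule k(5))
    ultimately show "w \<in> left_cell n a"
      unfolding left_cell_def carrier_dihedral k(1) by blast
  qed
qed

end

section \<open>Kazhdan-Lusztig basis elements as functions on the integers\<close>

lemma neg_div_int:
  fixes a b :: int
  assumes "0 < b"
  shows "(- a - 1) div b = - (a div b) - 1"
proof (rule int_div_pos_eq[of _ _ _ "b - 1 - a mod b"])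
  have "a = b * (a div b) + a mod b" by simp
  then show "- a - 1 = b * (- (a div b) - 1) + (b - 1 - a mod b)" by (simp add: algebra_simps)
  have "0 \<le> a mod b" "a mod b < b" using assms by simp_all
  then show "0 \<le> b - 1 - a mod b" "b - 1 - a mod b < b" by simp_all
qed

context kl_dihedral
begin

text \<open>
  The number of integers \<open>y\<close> with \<open>- k < y \<le> k\<close> and \<open>\<sigma> * y \<equiv> x\<close> modulo \<open>2n\<close>, for \<open>k \<ge> 0\<close>. For
  \<open>0 < k \<le> n\<close> this is the Kazhdan-Lusztig basis element of \<open>cls (\<sigma> * k)\<close>, see \<open>kl_basis_cls\<close>
  below. Written with quotients it extends to all integers \<open>k\<close>, so that the recursions need no
  boundary cases.
\<close>

definition kl_fun :: "int \<Rightarrow> int \<Rightarrow> int \<Rightarrow> int" where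
  "kl_fun \<sigma> k x = (k - \<sigma> * x) div period - (- k - \<sigma> * x) div period"

lemma period_pos: "0 < period"
  using n_ge_3 by simp

lemma kl_fun_uminus [simp]: "kl_fun \<sigma> (- k) x = - kl_fun \<sigma> k x"
  by (simp add: kl_fun_def)

lemma kl_fun_0 [simp]: "kl_fun \<sigma> 0 x = 0"
  by (simp add: kl_fun_def)

lemma kl_fun_add_period: "kl_fun \<sigma> (k + period) x = kl_fun \<sigma> k x + 2"
proof -
  have "(k + period - \<sigma> * x) div period = (k - \<sigma> * x) div period + 1"
    using div_add_self2[of period "k - \<sigma> * x"] period_pos by (simp add: algebra_simps)
  moreover have "(- k - \<sigma> * x) div period = (- (k + period) - \<sigma> * x) div period + 1"
    using div_add_self2[of period "- (k + period) - \<sigma> * x"] period_pos by (simp add: algebra_simps)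
  ultimately show ?thesis by (simp add: kl_fun_def)
qed

lemma kl_fun_n: "kl_fun \<sigma> (int n) x = 1"
proof -
  have "(int n - \<sigma> * x) div period = (- int n - \<sigma> * x) div period + 1"
    using div_add_self2[of period "- int n - \<sigma> * x"] period_pos by (simp add: algebra_simps)
  then show ?thesis by (simp add: kl_fun_def)
qed

lemma kl_fun_cong:
  assumes "[x = y] (mod period)"
  shows "kl_fun \<sigma> k x = kl_fun \<sigma> k y"
proof -
  obtain m where m: "y = x + period * m" using assms unfolding cong_iff_lin by blast
  have "(c - \<sigma> * y) div period = (c - \<sigma> * x) div period - \<sigma> * m" for c
  proof -
    have "c - \<sigma> * y = (c - \<sigma> * x) + period * (- \<sigma> * m)" by (simp add: m algebra_simps)
    also have "\<dots> div period = (c - \<sigma> * x) div period - \<sigma> * m"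
      using period_pos by (subst div_mult_self2) auto
    finally show ?thesis .
  qed
  then show ?thesis by (simp add: kl_fun_def)
qed

text \<open>
  Adding the value at \<open>\<sigma> - x\<close> is left multiplication by the basis element of the generator of
  sign \<open>\<sigma>\<close>. The interval that belongs to \<open>(\<sigma>, k)\<close> is symmetric under the reflection
  \<open>x \<mapsto> \<sigma> - x\<close>.
\<close>

lemma kl_fun_add_reflect_same:
  assumes "\<bar>\<sigma>\<bar> = 1"
  shows "kl_fun \<sigma> k x + kl_fun \<sigma> k (\<sigma> - x) = 2 * kl_fun \<sigma> k x"
proof -
  have \<sigma>: "\<sigma> * \<sigma> = 1" using assms by (auto simp: abs_if split: if_splits)
  define z where "z = \<sigma> * x"
  have "\<sigma> * (\<sigma> - x) = 1 - z" by (simp add: z_def algebra_simps \<sigma>)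
  moreover have "(k - (1 - z)) div period = - ((- k - z) div period) - 1"
    using neg_div_int[OF period_pos, of "- k - z"] by (simp add: algebra_simps)
  moreover have "(- k - (1 - z)) div period = - ((k - z) div period) - 1"
    using neg_div_int[OF period_pos, of "k - z"] by (simp add: algebra_simps)
  ultimately show ?thesis by (simp add: kl_fun_def z_def)
qed

text \<open>
  The interval that belongs to \<open>(- \<sigma>, k)\<close> and its mirror image are shifted against each other by
  two steps; their union is the next larger interval for \<open>\<sigma>\<close> and their intersection the next
  smaller one.
\<close>

lemma kl_fun_add_reflect_opposite:
  assumes "\<bar>\<sigma>\<bar> = 1"
  shows "kl_fun (- \<sigma>) k x + kl_fun (- \<sigma>) k (\<sigma> - x) = kl_fun \<sigma> (k + 1) x + kl_fun \<sigma> (k - 1) x"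
proof -
  have \<sigma>: "\<sigma> * \<sigma> = 1" using assms by (auto simp: abs_if split: if_splits)
  define z where "z = \<sigma> * x"
  have "c - - \<sigma> * (\<sigma> - x) = c + 1 - z" "c - - \<sigma> * x = c + z" for c
    by (simp_all add: z_def algebra_simps \<sigma>)
  then have "kl_fun (- \<sigma>) k x + kl_fun (- \<sigma>) k (\<sigma> - x) =
      (k + z) div period - (- k + z) div period + ((k + 1 - z) div period - (- k + 1 - z) div period)"
    by (simp only: kl_fun_def)
  moreover have "(k + z) div period = - ((- k - 1 - z) div period) - 1"
    using neg_div_int[OF period_pos, of "- k - 1 - z"] by (simp add: algebra_simps)
  moreover have "(- k + z) div period = - ((k - 1 - z) div period) - 1"
    using neg_div_int[OF period_pos, of "k - 1 - z"] by (simp add: algebra_simps)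
  moreover have "kl_fun \<sigma> (k + 1) x + kl_fun \<sigma> (k - 1) x =
      (k + 1 - z) div period - (- k - 1 - z) div period
      + ((k - 1 - z) div period - (- k + 1 - z) div period)"
    by (simp add: kl_fun_def z_def)
  ultimately show ?thesis by linarith
qed

definition step_sum :: "int \<Rightarrow> int \<Rightarrow> nat \<Rightarrow> int \<Rightarrow> int" where
  "step_sum \<sigma> c m x = (\<Sum>l<m. kl_fun \<sigma> (c + 2 * int l) x)"

lemma step_sum_0 [simp]: "step_sum \<sigma> c 0 x = 0"
  by (simp add: step_sum_def)

lemma step_sum_add: "step_sum \<sigma> c (m + m') x = step_sum \<sigma> c m x + step_sum \<sigma> (c + 2 * int m) m' x"
  by (induction m') (auto simp: step_sum_def algebra_simps)

lemma step_sum_Suc: "step_sum \<sigma> c (Suc m) x = step_sum \<sigma> c m x + kl_fun \<sigma> (c + 2 * int m) x"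
  by (simp add: step_sum_def)

lemma step_sum_Suc': "step_sum \<sigma> c (Suc m) x = kl_fun \<sigma> c x + step_sum \<sigma> (c + 2) m x"
  using step_sum_add[of \<sigma> c 1 m x] by (simp add: step_sum_def)

lemma step_sum_reverse: "step_sum \<sigma> (2 - c - 2 * int m) m x = - step_sum \<sigma> c m x"
proof (induction m arbitrary: c)
  case (Suc m)
  have "step_sum \<sigma> (2 - c - 2 * int (Suc m)) (Suc m) x
      = kl_fun \<sigma> (- (c + 2 * int m)) x + step_sum \<sigma> (2 - c - 2 * int m) m x"
    unfolding step_sum_Suc' by (simp add: algebra_simps)
  also have "\<dots> = - kl_fun \<sigma> (c + 2 * int m) x - step_sum \<sigma> c m x" by (simp only: kl_fun_uminus Suc.IH)
  finally show ?case by (simp add: step_sum_Suc)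
qed simp

text \<open>
  The indices \<open>1 - m, 3 - m, \<dots>, m - 1\<close> cancel in pairs because \<open>kl_fun\<close> is odd in the index.
\<close>

lemma step_sum_symmetric: "step_sum \<sigma> (1 - int m) m x = 0"
  using step_sum_reverse[of \<sigma> "1 - int m" m x] by simp

text \<open>
  Shifting the first index by \<open>2\<close> replaces \<open>kl_fun \<sigma> c\<close> by \<open>kl_fun \<sigma> (c + 2n)\<close>, which is larger
  by \<open>2\<close>. This reduces the claim to the two symmetric cases \<open>k = 0\<close> and \<open>k = 1\<close>.
\<close>

lemma step_sum_full_period: "step_sum \<sigma> (int k - int n) n x = int k - 1"
proof (induction k rule: induct_nat_012)
  case 0
  define m where "m = n - 1"
  have m: "Suc m = n" "2 - int n = 1 - int m" using n_ge_3 by (auto simp: m_def)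
  have "step_sum \<sigma> (- int n) n x = kl_fun \<sigma> (- int n) x + step_sum \<sigma> (2 - int n) m x"
    using step_sum_Suc'[of \<sigma> "- int n" m x] by (simp add: m(1))
  then show ?case unfolding m(2) step_sum_symmetric by (simp add: kl_fun_n)
next
  case 1
  then show ?case using step_sum_symmetric[of \<sigma> n x] by simp
next
  case (ge2 k)
  have "step_sum \<sigma> (int k - int n) (Suc n) x = step_sum \<sigma> (int k - int n) n x + kl_fun \<sigma> (int k - int n + period) x"
    by (simp add: step_sum_Suc)
  moreover have "step_sum \<sigma> (int k - int n) (Suc n) x
      = kl_fun \<sigma> (int k - int n) x + step_sum \<sigma> (int k - int n + 2) n x"
    by (rule step_sum_Suc')
  moreover have "kl_fun \<sigma> (int k - int n + period) x = kl_fun \<sigma> (int k - int n) x + 2"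
    by (rule kl_fun_add_period)
  moreover have "int k - int n + 2 = int (Suc (Suc k)) - int n" by simp
  ultimately show ?case using ge2 by (simp only:)
qed

text \<open>
  For \<open>j \<le> i\<close> the indices run through \<open>i - j + 1, i - j + 3, \<dots>, i + j - 1\<close>, as in the Clebsch-Gordan
  rule. Up to the factor \<open>2\<close> this is the product of basis elements of lengths \<open>j\<close> and \<open>i\<close> if the
  last letter of the first one is the first letter of the second one.
\<close>

definition product_sum :: "int \<Rightarrow> nat \<Rightarrow> nat \<Rightarrow> int \<Rightarrow> int" where
  "product_sum \<sigma> j i = step_sum \<sigma> (int i - int j + 1) j"

lemma product_sum_swap:
  assumes "i \<le> j"
  shows "product_sum \<sigma> j i x = product_sum \<sigma> i j x"
proof -
  have "product_sum \<sigma> j i x = step_sum \<sigma> (1 - int (j - i)) ((j - i) + i) x"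
    using assms by (simp add: product_sum_def of_nat_diff algebra_simps)
  also have "\<dots> = product_sum \<sigma> i j x"
    unfolding step_sum_add step_sum_symmetric using assms by (simp add: product_sum_def of_nat_diff algebra_simps)
  finally show ?thesis .
qed

text \<open>
  For \<open>i + j > n\<close> the last index is at least \<open>n\<close>. The \<open>n - j\<close> indices that complete them to a
  full period make up, by oddness, minus the sum for the complementary lengths.
\<close>

lemma product_sum_complement:
  assumes "i \<le> n" "j \<le> n" "n \<le> i + j"
  shows "product_sum \<sigma> j i x = product_sum \<sigma> (n - j) (n - i) x + int (i + j - n)"
proof -
  \<comment> \<open>The first index of the full period that ends with the last index \<open>i + j - 1\<close>.\<close>
  let ?c = "int (i + j + 1 - n) - int n"
  have "step_sum \<sigma> ?c ((n - j) + j) x = int (i + j + 1 - n) - 1"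
    using step_sum_full_period[of \<sigma> "i + j + 1 - n" x] assms by simp
  moreover have "step_sum \<sigma> ?c ((n - j) + j) x = step_sum \<sigma> ?c (n - j) x + product_sum \<sigma> j i x"
    unfolding step_sum_add using assms by (simp add: product_sum_def of_nat_diff algebra_simps)
  moreover have "step_sum \<sigma> ?c (n - j) x = - product_sum \<sigma> (n - j) (n - i) x"
    using step_sum_reverse[of \<sigma> "int j - int i + 1" "n - j" x] assms
    by (simp add: product_sum_def of_nat_diff algebra_simps)
  ultimately show ?thesis using assms by (simp add: of_nat_diff)
qed

lemma product_sum_add_reflect:
  assumes "\<bar>\<sigma>\<bar> = 1" "0 < j"
  shows "product_sum (- \<sigma>) j i x + product_sum (- \<sigma>) j i (\<sigma> - x) = product_sum \<sigma> (j + 1) i x + product_sum \<sigma> (j - 1) i x"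
proof -
  obtain m where m: "j = Suc m" using assms(2) by (cases j) auto
  let ?c = "int i - int j + 1"
  have "product_sum (- \<sigma>) j i x + product_sum (- \<sigma>) j i (\<sigma> - x) = step_sum \<sigma> (?c + 1) j x + step_sum \<sigma> (?c - 1) j x"
    unfolding product_sum_def step_sum_def sum.distrib[symmetric] kl_fun_add_reflect_opposite[OF assms(1)]
    by (simp add: algebra_simps)
  also have "step_sum \<sigma> (?c + 1) j x = step_sum \<sigma> (?c + 1) m x + kl_fun \<sigma> (?c - 1 + 2 * int j) x"
    unfolding m step_sum_Suc by (simp add: algebra_simps)
  also have "step_sum \<sigma> (?c + 1) m x = product_sum \<sigma> (j - 1) i x" by (simp add: product_sum_def m algebra_simps)
  finally show ?thesis by (simp add: product_sum_def step_sum_Suc algebra_simps)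
qed

text \<open>
  Functions that are sums of constants (multiples of the basis element of the longest element)
  and basis elements of first letter \<open>\<sigma>\<close> and length \<open>k < n\<close> with \<open>odd k = p\<close>. Fixing the first
  letter and the parity of the length fixes the last letter, that is, the left cell. The Boolean
  index records whether an element of the cell occurs at all.
\<close>

inductive cone :: "int \<Rightarrow> bool \<Rightarrow> bool \<Rightarrow> (int \<Rightarrow> int) \<Rightarrow> bool" for \<sigma> p where
  zero: "cone \<sigma> p False (\<lambda>x. 0)"
| longest: "cone \<sigma> p b f \<Longrightarrow> cone \<sigma> p b (\<lambda>x. f x + 1)"
| cell: "cone \<sigma> p b f \<Longrightarrow> 0 < k \<Longrightarrow> k < n \<Longrightarrow> odd k = p
    \<Longrightarrow> cone \<sigma> p True (\<lambda>x. f x + kl_fun \<sigma> (int k) x)"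

lemma cone_add:
  assumes "cone \<sigma> p b f" "cone \<sigma> p c g"
  shows "cone \<sigma> p (b \<or> c) (\<lambda>x. f x + g x)"
  using assms(2)
proof induction
  case (longest c g)
  then show ?case using cone.longest[of \<sigma> p "b \<or> c" "\<lambda>x. f x + g x"] by (simp add: add.assoc)
next
  case (cell c g k)
  then show ?case using cone.cell[of \<sigma> p "b \<or> c" "\<lambda>x. f x + g x" k] by (simp add: add.assoc)
qed (use assms in simp)

lemma cone_const: "cone \<sigma> p False (\<lambda>x. int m)"
proof (induction m)
  case (Suc m)
  then show ?case using cone.longest[OF Suc] by (simp add: add.commute)
qed (simp add: cone.zero)

lemma cone_step_sum:
  assumes "odd c = p" "0 < c" "c + 2 * m < n + 2"
  shows "cone \<sigma> p (0 < m) (step_sum \<sigma> (int c) m)"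
  using assms(3)
proof (induction m)
  case 0
  have "step_sum \<sigma> (int c) 0 = (\<lambda>x. 0)" by auto
  then show ?case by (simp add: cone.zero)
next
  case (Suc m)
  then have "cone \<sigma> p (0 < m) (step_sum \<sigma> (int c) m)" by simp
  from cone.cell[OF this, of "c + 2 * m"] Suc.prems assms
  have "cone \<sigma> p True (\<lambda>x. step_sum \<sigma> (int c) m x + kl_fun \<sigma> (int c + 2 * int m) x)" by simp
  moreover have "step_sum \<sigma> (int c) (Suc m) = (\<lambda>x. step_sum \<sigma> (int c) m x + kl_fun \<sigma> (int c + 2 * int m) x)"
    by (rule ext) (rule step_sum_Suc)
  ultimately show ?case by simp
qed

text \<open>
  As \<open>product_sum\<close> is symmetric, the shorter factor may be taken as the one that counts the summands.
  Then all indices lie strictly between \<open>0\<close> and \<open>n\<close>.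
\<close>

lemma cone_product_sum_small:
  assumes "i + j \<le> n"
  shows "cone \<sigma> (even (i + j)) (0 < i \<and> 0 < j) (product_sum \<sigma> j i)"
proof -
  have *: "cone \<sigma> (even (i + j)) (0 < j) (product_sum \<sigma> j i)" if "j \<le> i" "i + j \<le> n" for i j
  proof -
    have "odd (i - j + 1) = even (i + j)" using that by simp
    from cone_step_sum[OF this] that show ?thesis by (simp add: product_sum_def of_nat_diff algebra_simps)
  qed
  show ?thesis
  proof (cases "j \<le> i")
    case True
    then have "(0 < i \<and> 0 < j) = (0 < j)" by auto
    with *[OF True assms] show ?thesis by simp
  next
    case False
    then have "product_sum \<sigma> j i = product_sum \<sigma> i j" by (intro ext product_sum_swap) simp
    moreover have "(0 < i \<and> 0 < j) = (0 < i)" using False by auto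
    ultimately show ?thesis using *[of i j] False assms by (simp add: add.commute)
  qed
qed

lemma cone_product_sum:
  assumes "i \<le> n" "j \<le> n"
  shows "cone \<sigma> (even (i + j)) (0 < i \<and> i < n \<and> 0 < j \<and> j < n) (product_sum \<sigma> j i)"
proof (cases "i + j \<le> n")
  case True
  have "(0 < i \<and> i < n \<and> 0 < j \<and> j < n) = (0 < i \<and> 0 < j)" using True by auto
  with cone_product_sum_small[OF True] show ?thesis by simp
next
  case False
  have "product_sum \<sigma> j i = (\<lambda>x. product_sum \<sigma> (n - j) (n - i) x + int (i + j - n))"
    using product_sum_complement assms False by auto
  moreover have "(0 < n - i \<and> 0 < n - j \<or> False) = (0 < i \<and> i < n \<and> 0 < j \<and> j < n)"
    using False by auto
  moreover have "even ((n - i) + (n - j)) = even (i + j)" using assms by simp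
  moreover have "(n - i) + (n - j) \<le> n" using False assms by simp
  ultimately show ?thesis
    using cone_add[OF cone_product_sum_small[of "n - i" "n - j" \<sigma>] cone_const[of _ _ "i + j - n"]] by simp
qed

end

section \<open>Products in the integral group ring\<close>

lemma int_group_ring_mult:
  assumes "finite (carrier G)"
  shows "(a \<otimes>\<^bsub>int_group_ring G\<^esub> b) g =
    (\<Sum>x\<in>carrier G. \<Sum>y\<in>carrier G. if x \<otimes>\<^bsub>G\<^esub> y = g then a x * b y else 0)"
proof -
  let ?C = "carrier G \<times> carrier G"
  have "(a \<otimes>\<^bsub>int_group_ring G\<^esub> b) g =
      (\<Sum>(x, y) | (x, y) \<in> ?C \<and> x \<otimes>\<^bsub>G\<^esub> y = g. a x * b y)"
    by (simp add: int_group_ring_def)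
  also have "\<dots> = (\<Sum>p \<in> {p \<in> ?C. fst p \<otimes>\<^bsub>G\<^esub> snd p = g}. a (fst p) * b (snd p))"
    by (rule sum.cong) auto
  also have "\<dots> = (\<Sum>p\<in>?C. if fst p \<otimes>\<^bsub>G\<^esub> snd p = g then a (fst p) * b (snd p) else 0)"
    using assms by (intro sum.inter_filter) simp
  also have "\<dots> = (\<Sum>x\<in>carrier G. \<Sum>y\<in>carrier G. if x \<otimes>\<^bsub>G\<^esub> y = g then a x * b y else 0)"
    unfolding sum.cartesian_product by (rule sum.cong) auto
  finally show ?thesis .
qed

lemma int_group_ring_simps:
  "carrier (int_group_ring G) = {a. \<forall>g. g \<notin> carrier G \<longrightarrow> a g = 0}"
  "\<one>\<^bsub>int_group_ring G\<^esub> = (\<lambda>g. if g = \<one>\<^bsub>G\<^esub> then 1 else 0)"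
  "\<zero>\<^bsub>int_group_ring G\<^esub> = (\<lambda>g. 0)"
  "a \<oplus>\<^bsub>int_group_ring G\<^esub> b = (\<lambda>g. a g + b g)"
  by (simp_all add: int_group_ring_def)

context
  fixes G :: "('g, 'x) monoid_scheme" (structure)
  assumes mon: "Group.monoid G" and fin: "finite (carrier G)"
begin

interpretation Group.monoid G by (rule mon)

lemma int_group_ring_assoc:
  "(a \<otimes>\<^bsub>int_group_ring G\<^esub> b) \<otimes>\<^bsub>int_group_ring G\<^esub> c
     = a \<otimes>\<^bsub>int_group_ring G\<^esub> (b \<otimes>\<^bsub>int_group_ring G\<^esub> c)"
proof
  fix g
  let ?C = "carrier G"
  let ?t = "\<lambda>x y z. if x \<otimes> y \<otimes> z = g then a x * b y * c z else 0"
  have "((a \<otimes>\<^bsub>int_group_ring G\<^esub> b) \<otimes>\<^bsub>int_group_ring G\<^esub> c) g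
      = (\<Sum>u\<in>?C. \<Sum>z\<in>?C. \<Sum>x\<in>?C. \<Sum>y\<in>?C. if u = x \<otimes> y then ?t x y z else 0)"
    unfolding int_group_ring_mult[OF fin]
    by (intro sum.cong HOL.refl) (auto simp: sum_distrib_right intro!: sum.cong sum.neutral)
  also have "\<dots> = (\<Sum>u\<in>?C. \<Sum>x\<in>?C. \<Sum>z\<in>?C. \<Sum>y\<in>?C. if u = x \<otimes> y then ?t x y z else 0)"
    by (rule sum.cong[OF HOL.refl], rule sum.swap)
  also have "\<dots> = (\<Sum>x\<in>?C. \<Sum>u\<in>?C. \<Sum>z\<in>?C. \<Sum>y\<in>?C. if u = x \<otimes> y then ?t x y z else 0)"
    by (rule sum.swap)
  also have "\<dots> = (\<Sum>x\<in>?C. \<Sum>u\<in>?C. \<Sum>y\<in>?C. \<Sum>z\<in>?C. if u = x \<otimes> y then ?t x y z else 0)"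
    by (rule sum.cong[OF HOL.refl], rule sum.cong[OF HOL.refl], rule sum.swap)
  also have "\<dots> = (\<Sum>x\<in>?C. \<Sum>y\<in>?C. \<Sum>u\<in>?C. \<Sum>z\<in>?C. if u = x \<otimes> y then ?t x y z else 0)"
    by (rule sum.cong[OF HOL.refl], rule sum.swap)
  also have "\<dots> = (\<Sum>x\<in>?C. \<Sum>y\<in>?C. \<Sum>z\<in>?C. \<Sum>u\<in>?C. if u = x \<otimes> y then ?t x y z else 0)"
    by (rule sum.cong[OF HOL.refl], rule sum.cong[OF HOL.refl], rule sum.swap)
  also have "\<dots> = (\<Sum>x\<in>?C. \<Sum>y\<in>?C. \<Sum>z\<in>?C. ?t x y z)"
    using fin by (intro sum.cong HOL.refl) simp
  finally have 1: "((a \<otimes>\<^bsub>int_group_ring G\<^esub> b) \<otimes>\<^bsub>int_group_ring G\<^esub> c) g =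
      (\<Sum>x\<in>?C. \<Sum>y\<in>?C. \<Sum>z\<in>?C. ?t x y z)" .
  have "(a \<otimes>\<^bsub>int_group_ring G\<^esub> (b \<otimes>\<^bsub>int_group_ring G\<^esub> c)) g
      = (\<Sum>x\<in>?C. \<Sum>u\<in>?C. \<Sum>y\<in>?C. \<Sum>z\<in>?C. if u = y \<otimes> z then ?t x y z else 0)"
    unfolding int_group_ring_mult[OF fin]
    by (intro sum.cong HOL.refl)
      (auto simp: sum_distrib_left m_assoc intro!: sum.cong sum.neutral)
  also have "\<dots> = (\<Sum>x\<in>?C. \<Sum>y\<in>?C. \<Sum>z\<in>?C. \<Sum>u\<in>?C. if u = y \<otimes> z then ?t x y z else 0)"
    by (rule sum.cong[OF HOL.refl], subst sum.swap[of _ ?C ?C], rule sum.cong[OF HOL.refl], rule sum.swap)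
  also have "\<dots> = (\<Sum>x\<in>?C. \<Sum>y\<in>?C. \<Sum>z\<in>?C. ?t x y z)"
    using fin by (intro sum.cong HOL.refl) simp
  finally show "((a \<otimes>\<^bsub>int_group_ring G\<^esub> b) \<otimes>\<^bsub>int_group_ring G\<^esub> c) g
      = (a \<otimes>\<^bsub>int_group_ring G\<^esub> (b \<otimes>\<^bsub>int_group_ring G\<^esub> c)) g"
    using 1 by simp
qed

lemma int_group_ring_one:
  assumes "a \<in> carrier (int_group_ring G)"
  shows "\<one>\<^bsub>int_group_ring G\<^esub> \<otimes>\<^bsub>int_group_ring G\<^esub> a = a"
    and "a \<otimes>\<^bsub>int_group_ring G\<^esub> \<one>\<^bsub>int_group_ring G\<^esub> = a"
proof -
  have "(\<one>\<^bsub>int_group_ring G\<^esub> \<otimes>\<^bsub>int_group_ring G\<^esub> a) g = a g" for g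
  proof -
    have "(\<one>\<^bsub>int_group_ring G\<^esub> \<otimes>\<^bsub>int_group_ring G\<^esub> a) g
        = (\<Sum>x\<in>carrier G. if x = \<one> then (\<Sum>y\<in>carrier G. if y = g then a y else 0) else 0)"
      unfolding int_group_ring_mult[OF fin] int_group_ring_simps
      by (intro sum.cong HOL.refl) (auto intro!: sum.cong sum.neutral)
    with fin assms show ?thesis by (auto simp: int_group_ring_simps)
  qed
  moreover have "(a \<otimes>\<^bsub>int_group_ring G\<^esub> \<one>\<^bsub>int_group_ring G\<^esub>) g = a g" for g
  proof -
    have "(a \<otimes>\<^bsub>int_group_ring G\<^esub> \<one>\<^bsub>int_group_ring G\<^esub>) g
        = (\<Sum>x\<in>carrier G. \<Sum>y\<in>carrier G. if y = \<one> then (if x = g then a x else 0) else 0)"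
      unfolding int_group_ring_mult[OF fin] int_group_ring_simps
      by (intro sum.cong HOL.refl) auto
    with fin assms show ?thesis by (auto simp: int_group_ring_simps)
  qed
  ultimately show "\<one>\<^bsub>int_group_ring G\<^esub> \<otimes>\<^bsub>int_group_ring G\<^esub> a = a"
    "a \<otimes>\<^bsub>int_group_ring G\<^esub> \<one>\<^bsub>int_group_ring G\<^esub> = a" by auto
qed

lemma semiring_int_group_ring: "semiring (int_group_ring G)"
proof (intro semiring.intro abelian_monoidI monoidI semiring_axioms.intro)
  fix a b c
  note ring = int_group_ring_simps int_group_ring_mult[OF fin]
  show "a \<otimes>\<^bsub>int_group_ring G\<^esub> b \<in> carrier (int_group_ring G)"
    unfolding ring mem_Collect_eq by (intro allI impI sum.neutral ballI) (metis m_closed)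
  show "(a \<oplus>\<^bsub>int_group_ring G\<^esub> b) \<otimes>\<^bsub>int_group_ring G\<^esub> c
      = a \<otimes>\<^bsub>int_group_ring G\<^esub> c \<oplus>\<^bsub>int_group_ring G\<^esub> b \<otimes>\<^bsub>int_group_ring G\<^esub> c"
    unfolding ring sum.distrib[symmetric]
    by (intro ext sum.cong HOL.refl) (simp add: algebra_simps)
  show "c \<otimes>\<^bsub>int_group_ring G\<^esub> (a \<oplus>\<^bsub>int_group_ring G\<^esub> b)
      = c \<otimes>\<^bsub>int_group_ring G\<^esub> a \<oplus>\<^bsub>int_group_ring G\<^esub> c \<otimes>\<^bsub>int_group_ring G\<^esub> b"
    unfolding ring sum.distrib[symmetric]
    by (intro ext sum.cong HOL.refl) (simp add: algebra_simps)
  show "\<zero>\<^bsub>int_group_ring G\<^esub> \<otimes>\<^bsub>int_group_ring G\<^esub> a = \<zero>\<^bsub>int_group_ring G\<^esub>"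
    "a \<otimes>\<^bsub>int_group_ring G\<^esub> \<zero>\<^bsub>int_group_ring G\<^esub> = \<zero>\<^bsub>int_group_ring G\<^esub>"
    unfolding ring by (intro ext sum.neutral ballI, simp)+
  show "a \<in> carrier (int_group_ring G) \<Longrightarrow> \<one>\<^bsub>int_group_ring G\<^esub> \<otimes>\<^bsub>int_group_ring G\<^esub> a = a"
    "a \<in> carrier (int_group_ring G) \<Longrightarrow> a \<otimes>\<^bsub>int_group_ring G\<^esub> \<one>\<^bsub>int_group_ring G\<^esub> = a"
    by (simp_all add: int_group_ring_one)
qed (simp_all add: int_group_ring_simps int_group_ring_assoc add_ac)

end

lemma semiring_generated_subsemiring:
  assumes "semiring A" "B \<subseteq> carrier A"
  shows "semiring (A\<lparr>carrier := generated_subsemiring A B\<rparr>)"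
proof -
  interpret semiring A by (rule assms(1))
  have sub: "a \<in> carrier A" if "a \<in> generated_subsemiring A B" for a
    using that by induction (use assms(2) in auto)
  let ?R = "A\<lparr>carrier := generated_subsemiring A B\<rparr>"
  show ?thesis
  proof (intro semiring.intro abelian_monoidI monoidI semiring_axioms.intro)
    fix a b c
    assume "a \<in> carrier ?R" "b \<in> carrier ?R" "c \<in> carrier ?R"
    then have "a \<in> carrier A" "b \<in> carrier A" "c \<in> carrier A" using sub by simp_all
    then show "a \<oplus>\<^bsub>?R\<^esub> b \<oplus>\<^bsub>?R\<^esub> c = a \<oplus>\<^bsub>?R\<^esub> (b \<oplus>\<^bsub>?R\<^esub> c)"
      "a \<otimes>\<^bsub>?R\<^esub> b \<otimes>\<^bsub>?R\<^esub> c = a \<otimes>\<^bsub>?R\<^esub> (b \<otimes>\<^bsub>?R\<^esub> c)"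
      "(a \<oplus>\<^bsub>?R\<^esub> b) \<otimes>\<^bsub>?R\<^esub> c = a \<otimes>\<^bsub>?R\<^esub> c \<oplus>\<^bsub>?R\<^esub> b \<otimes>\<^bsub>?R\<^esub> c"
      "c \<otimes>\<^bsub>?R\<^esub> (a \<oplus>\<^bsub>?R\<^esub> b) = c \<otimes>\<^bsub>?R\<^esub> a \<oplus>\<^bsub>?R\<^esub> c \<otimes>\<^bsub>?R\<^esub> b"
      by (simp_all add: a_assoc m_assoc l_distr r_distr)
  next
    fix a b
    assume "a \<in> carrier ?R" "b \<in> carrier ?R"
    then have "a \<in> carrier A" "b \<in> carrier A" using sub by simp_all
    then show "a \<oplus>\<^bsub>?R\<^esub> b = b \<oplus>\<^bsub>?R\<^esub> a" by (simp add: a_comm)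
  qed (simp_all add: sub generated_subsemiring.zero generated_subsemiring.one generated_subsemiring.add generated_subsemiring.mult)
qed

context kl_dihedral
begin

abbreviation Z_D :: "(dih \<Rightarrow> int) ring" where "Z_D \<equiv> int_group_ring (dihedral n)"

lemma left_mult_eq_iff:
  "v \<in> carrier (dihedral n) \<Longrightarrow>
    cls z \<otimes>\<^bsub>dihedral n\<^esub> v = cls x \<longleftrightarrow> v = cls (if even z then x - z else z - x)"
proof -
  assume "v \<in> carrier (dihedral n)"
  then obtain y where y: "v = cls y" by (auto simp: carrier_dihedral)
  have "[z - y = x] (mod period) \<longleftrightarrow> [y = z - x] (mod period)"
    by (metis add_diff_cancel_left' cong_diff cong_refl diff_diff_eq2)
  moreover have "[z + y = x] (mod period) \<longleftrightarrow> [y = x - z] (mod period)"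
    by (metis add_diff_cancel_left' cong_add_lcancel diff_add_cancel add.commute)
  ultimately show ?thesis by (auto simp: y mult_cls twist_def cls_eq_iff)
qed

lemma finite_D [simp]: "finite (carrier (dihedral n))"
  by (rule finite_dihedral)

lemma cls_in_D [simp]: "cls z \<in> carrier (dihedral n)"
  by (simp add: carrier_dihedral)

lemma convolution_cls:
  "(a \<otimes>\<^bsub>Z_D\<^esub> b) (cls x) = (\<Sum>u\<in>carrier (dihedral n). \<Sum>v\<in>carrier (dihedral n).
     if u \<otimes>\<^bsub>dihedral n\<^esub> v = cls x then a u * b v else 0)"
  by (rule int_group_ring_mult) simp

lemma semiring_Z_D: "semiring Z_D"
  by (rule semiring_int_group_ring[OF monoid_dihedral finite_D])

lemma bruhat_le_generator:
  assumes "\<bar>\<sigma>\<bar> = 1" "u \<in> carrier (dihedral n)"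
  shows "bruhat_le u (cls \<sigma>) \<longleftrightarrow> u = cls 0 \<or> u = cls \<sigma>"
proof -
  obtain x where "u = cls x" using assms(2) by (auto simp: carrier_dihedral)
  then obtain y where y: "- int n < y" "y \<le> int n" "u = cls y"
    using cls_representative[of x] by metis
  have "dih_length (cls \<sigma>) = 1" using dih_length_cls[of \<sigma>] assms(1) n_ge_3 by simp
  moreover have "dih_length u = nat \<bar>y\<bar>" using dih_length_cls[of y] y by simp
  moreover have "u = cls 0 \<longleftrightarrow> y = 0"
  proof
    assume "u = cls 0"
    then have "cls y = cls 0" using y(3) by simp
    then show "y = 0" using y n_ge_3 by (intro cls_eqD) auto
  qed (simp add: y(3))
  ultimately show ?thesis by (auto simp: bruhat_le_def)
qed

text \<open>
  The support of the basis element of a generator \<open>a\<close> is \<open>{e, a}\<close>, and \<open>a\<close> is its own inverse.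
\<close>

lemma generator_mult:
  assumes "\<bar>\<sigma>\<bar> = 1"
  shows "(kl_basis n (cls \<sigma>) \<otimes>\<^bsub>Z_D\<^esub> b) (cls x) = b (cls x) + b (cls (\<sigma> - x))"
proof -
  let ?D = "carrier (dihedral n)"
  have odd: "odd \<sigma>" using assms by presburger
  have ne: "cls 0 \<noteq> cls \<sigma>"
  proof
    assume "cls 0 = cls \<sigma>"
    then have "0 = \<sigma>" using assms n_ge_3 by (intro cls_eqD) auto
    with assms show False by simp
  qed
  have "(kl_basis n (cls \<sigma>) \<otimes>\<^bsub>Z_D\<^esub> b) (cls x) =
      (\<Sum>u\<in>?D. if u \<in> {cls 0, cls \<sigma>} then
        (\<Sum>v\<in>?D. if u \<otimes>\<^bsub>dihedral n\<^esub> v = cls x then b v else 0) else 0)"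
    unfolding convolution_cls
    by (intro sum.cong HOL.refl)
      (auto simp: kl_basis_def bruhat_le_generator[OF assms] intro!: sum.neutral sum.cong)
  also have "\<dots> = (\<Sum>u\<in>?D \<inter> {cls 0, cls \<sigma>}. \<Sum>v\<in>?D. if u \<otimes>\<^bsub>dihedral n\<^esub> v = cls x then b v else 0)"
    by (rule sum.inter_restrict[symmetric]) simp
  also have "?D \<inter> {cls 0, cls \<sigma>} = {cls 0, cls \<sigma>}" by auto
  also have "(\<Sum>u\<in>{cls 0, cls \<sigma>}. \<Sum>v\<in>?D. if u \<otimes>\<^bsub>dihedral n\<^esub> v = cls x then b v else 0)
      = (\<Sum>v\<in>?D. if v = cls x then b v else 0) + (\<Sum>v\<in>?D. if v = cls (\<sigma> - x) then b v else 0)"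
    using ne odd by (simp add: left_mult_eq_iff cong: sum.cong_simp)
  finally show ?thesis by simp
qed

lemma div_period_values:
  "0 \<le> c \<Longrightarrow> c < period \<Longrightarrow> c div period = 0"
  "- period \<le> c \<Longrightarrow> c < 0 \<Longrightarrow> c div period = - 1"
  by (rule div_pos_pos_trivial) (auto intro: int_div_pos_eq[of _ _ _ "c + period"])

text \<open>
  For a representative \<open>y\<close> with \<open>- n < y \<le> n\<close> both sides say that \<open>y = k\<close> or \<open>\<bar>y\<bar> < k\<close>. The sign
  \<open>\<sigma>\<close> only reverses the orientation of the cycle.
\<close>

lemma kl_basis_cls:
  assumes "\<bar>\<sigma>\<bar> = 1" "0 < k" "k \<le> n"
  shows "kl_basis n (cls (\<sigma> * int k)) (cls x) = kl_fun \<sigma> (int k) x"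
proof -
  have \<sigma>: "\<sigma> * \<sigma> = 1" "\<sigma> = 1 \<or> \<sigma> = -1" using assms by (auto simp: abs_if split: if_splits)
  obtain y where y: "- int n < y" "y \<le> int n" "cls (\<sigma> * x) = cls y"
    using cls_representative[of "\<sigma> * x"] by metis
  then have "[\<sigma> * (\<sigma> * x) = \<sigma> * y] (mod period)" unfolding cls_eq_iff by (intro cong_mult) auto
  then have xy: "[x = \<sigma> * y] (mod period)" using \<sigma>(1) by (simp add: mult.assoc[symmetric])
  have len: "dih_length (cls (\<sigma> * y)) = nat \<bar>y\<bar>" "dih_length (cls (\<sigma> * int k)) = k"
    using dih_length_cls[of "\<sigma> * y"] dih_length_cls[of "\<sigma> * int k"] assms y by (auto simp: abs_mult)
  have eq: "cls (\<sigma> * y) = cls (\<sigma> * int k) \<longleftrightarrow> y = int k"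
  proof
    assume "cls (\<sigma> * y) = cls (\<sigma> * int k)"
    then have "[\<sigma> * (\<sigma> * y) = \<sigma> * (\<sigma> * int k)] (mod period)"
      unfolding cls_eq_iff by (rule cong_scalar_left)
    then have c: "cls y = cls (int k)" unfolding cls_eq_iff mult.assoc[symmetric] \<sigma>(1) by simp
    show "y = int k"
    proof (cases "k = n")
      case True
      show ?thesis
      proof (rule ccontr)
        assume "y \<noteq> int k"
        then have "int n = y" using c True y by (intro cls_eqD) auto
        with True \<open>y \<noteq> int k\<close> show False by simp
      qed
    next
      case False
      then show ?thesis using c assms y by (intro cls_eqD) auto
    qed
  qed simp
  have "kl_fun \<sigma> (int k) x = kl_fun \<sigma> (int k) (\<sigma> * y)" by (rule kl_fun_cong[OF xy])
  also have "\<dots> = (int k - y) div period - (- int k - y) div period"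
    by (simp add: kl_fun_def mult.assoc[symmetric] \<sigma>(1))
  also have "\<dots> = (if y = int k \<or> \<bar>y\<bar> < int k then 1 else 0)"
  proof -
    consider "y = int k" | "\<bar>y\<bar> < int k" | "int k < y" | "y \<le> - int k" by linarith
    then show ?thesis
    proof cases
      case 1
      then show ?thesis using assms div_period_values(2)[of "- int k - y"] by simp
    next
      case 2
      then show ?thesis
        using assms div_period_values(1)[of "int k - y"] div_period_values(2)[of "- int k - y"] by simp
    next
      case 3
      then show ?thesis
        using assms y div_period_values(2)[of "int k - y"] div_period_values(2)[of "- int k - y"] by simp
    next
      case 4
      then show ?thesis
        using assms y div_period_values(1)[of "int k - y"] div_period_values(1)[of "- int k - y"] by simp
    qed
  qed
  also have "\<dots> = kl_basis n (cls (\<sigma> * int k)) (cls (\<sigma> * y))"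
    by (auto simp: kl_basis_def bruhat_le_def len eq)
  also have "cls (\<sigma> * y) = cls x" using xy by (simp add: cls_eq_iff cong_sym_eq)
  finally show ?thesis by simp
qed

text \<open>
  The value \<open>0\<close> at \<open>k = 0\<close>, rather than the identity, is the one that continues the recursion.
\<close>

definition kl_elem :: "int \<Rightarrow> nat \<Rightarrow> dih \<Rightarrow> int" where
  "kl_elem \<sigma> k = (if k = 0 then (\<lambda>g. 0) else kl_basis n (cls (\<sigma> * int k)))"

lemma kl_elem_cls: "\<bar>\<sigma>\<bar> = 1 \<Longrightarrow> k \<le> n \<Longrightarrow> kl_elem \<sigma> k (cls x) = kl_fun \<sigma> (int k) x"
  by (simp add: kl_elem_def kl_basis_cls)

lemma kl_elem_in_carrier: "kl_elem \<sigma> k \<in> carrier Z_D"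
  by (simp add: kl_elem_def int_group_ring_simps kl_basis_def)

lemma function_eqI:
  assumes "a \<in> carrier Z_D" "b \<in> carrier Z_D" "\<And>x. a (cls x) = b (cls x)"
  shows "a = b"
proof
  fix g show "a g = b g"
    using assms by (cases "g \<in> carrier (dihedral n)") (auto simp: carrier_dihedral int_group_ring_simps)
qed

lemma generator_mult_opposite:
  assumes "\<bar>\<sigma>\<bar> = 1" "0 < k" "k < n"
  shows "kl_elem \<sigma> 1 \<otimes>\<^bsub>Z_D\<^esub> kl_elem (- \<sigma>) k
    = kl_elem \<sigma> (k + 1) \<oplus>\<^bsub>Z_D\<^esub> kl_elem \<sigma> (k - 1)"
proof -
  interpret semiring Z_D by (rule semiring_Z_D)
  show ?thesis
  proof (rule function_eqI)
    fix x
    have "(kl_elem \<sigma> 1 \<otimes>\<^bsub>Z_D\<^esub> kl_elem (- \<sigma>) k) (cls x) = kl_fun (- \<sigma>) (int k) x + kl_fun (- \<sigma>) (int k) (\<sigma> - x)"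
      using generator_mult[OF assms(1), of "kl_elem (- \<sigma>) k" x] kl_elem_cls[of "- \<sigma>" k] assms
      by (simp add: kl_elem_def)
    also have "\<dots> = kl_fun \<sigma> (int (k + 1)) x + kl_fun \<sigma> (int (k - 1)) x"
      using kl_fun_add_reflect_opposite[OF assms(1), of "int k" x] assms by (simp add: of_nat_diff add.commute)
    finally show "(kl_elem \<sigma> 1 \<otimes>\<^bsub>Z_D\<^esub> kl_elem (- \<sigma>) k) (cls x)
        = (kl_elem \<sigma> (k + 1) \<oplus>\<^bsub>Z_D\<^esub> kl_elem \<sigma> (k - 1)) (cls x)"
      using assms by (simp add: kl_elem_cls int_group_ring_simps)
  qed (auto intro: kl_elem_in_carrier)
qed

lemma generator_mult_same:
  assumes "\<bar>\<sigma>\<bar> = 1" "k \<le> n"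
  shows "kl_elem \<sigma> 1 \<otimes>\<^bsub>Z_D\<^esub> kl_elem \<sigma> k = kl_elem \<sigma> k \<oplus>\<^bsub>Z_D\<^esub> kl_elem \<sigma> k"
proof -
  interpret semiring Z_D by (rule semiring_Z_D)
  show ?thesis
  proof (rule function_eqI)
    fix x
    have "(kl_elem \<sigma> 1 \<otimes>\<^bsub>Z_D\<^esub> kl_elem \<sigma> k) (cls x) = kl_fun \<sigma> (int k) x + kl_fun \<sigma> (int k) (\<sigma> - x)"
      using generator_mult[OF assms(1), of "kl_elem \<sigma> k" x] kl_elem_cls[of \<sigma> k] assms
      by (simp add: kl_elem_def)
    then show "(kl_elem \<sigma> 1 \<otimes>\<^bsub>Z_D\<^esub> kl_elem \<sigma> k) (cls x)
        = (kl_elem \<sigma> k \<oplus>\<^bsub>Z_D\<^esub> kl_elem \<sigma> k) (cls x)"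
      using assms kl_fun_add_reflect_same[OF assms(1)] by (simp add: kl_elem_cls int_group_ring_simps)
  qed (auto intro: kl_elem_in_carrier)
qed

text \<open>
  Both sides satisfy the recursion in \<open>j\<close> given by left multiplication with a generator, which keeps
  the last letter of the left factor. The condition compares this last letter with the first
  letter \<open>\<tau>\<close> of the right factor.
\<close>

lemma kl_product:
  assumes "\<bar>\<sigma>\<bar> = 1" "\<bar>\<tau>\<bar> = 1" "j \<le> n" "i \<le> n" "0 < i"
  shows "(kl_elem \<sigma> j \<otimes>\<^bsub>Z_D\<^esub> kl_elem \<tau> i) (cls x) =
    (if \<tau> = (if odd j then \<sigma> else - \<sigma>) then 2 * product_sum \<sigma> j i x
     else product_sum \<sigma> j (i + 1) x + product_sum \<sigma> j (i - 1) x)"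
  using assms(1,3)
proof (induction j arbitrary: \<sigma> x rule: induct_nat_012)
  case 0
  interpret semiring Z_D by (rule semiring_Z_D)
  have "kl_elem \<sigma> 0 = \<zero>\<^bsub>Z_D\<^esub>" by (simp add: kl_elem_def int_group_ring_simps)
  then have "kl_elem \<sigma> 0 \<otimes>\<^bsub>Z_D\<^esub> kl_elem \<tau> i = \<zero>\<^bsub>Z_D\<^esub>" using kl_elem_in_carrier by simp
  then show ?case by (simp add: product_sum_def int_group_ring_simps)
next
  case 1
  have "(kl_elem \<sigma> 1 \<otimes>\<^bsub>Z_D\<^esub> kl_elem \<tau> i) (cls x) = kl_fun \<tau> (int i) x + kl_fun \<tau> (int i) (\<sigma> - x)"
    using generator_mult[OF 1(1), of "kl_elem \<tau> i" x] kl_elem_cls[of \<tau> i] assms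
    by (simp add: kl_elem_def)
  moreover have "\<tau> = \<sigma> \<or> \<tau> = - \<sigma>" using 1(1) assms(2) by linarith
  ultimately show ?case
    using kl_fun_add_reflect_same[OF 1(1), of "int i" x] kl_fun_add_reflect_opposite[OF 1(1), of "int i" x] assms 1
    by (auto simp: product_sum_def step_sum_def of_nat_diff algebra_simps)
next
  case (ge2 j)
  interpret semiring Z_D by (rule semiring_Z_D)
  let ?X = "kl_elem \<tau> i" and ?j = "Suc j"
  note car = kl_elem_in_carrier
  have "kl_elem \<sigma> 1 \<otimes>\<^bsub>Z_D\<^esub> (kl_elem (- \<sigma>) ?j \<otimes>\<^bsub>Z_D\<^esub> ?X)
      = (kl_elem \<sigma> (Suc ?j) \<otimes>\<^bsub>Z_D\<^esub> ?X) \<oplus>\<^bsub>Z_D\<^esub> (kl_elem \<sigma> j \<otimes>\<^bsub>Z_D\<^esub> ?X)"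
    using generator_mult_opposite[of \<sigma> ?j] ge2.prems
    by (simp add: m_assoc[symmetric] car l_distr)
  then have "(kl_elem \<sigma> (Suc ?j) \<otimes>\<^bsub>Z_D\<^esub> ?X) (cls x) + (kl_elem \<sigma> j \<otimes>\<^bsub>Z_D\<^esub> ?X) (cls x)
      = (kl_elem \<sigma> 1 \<otimes>\<^bsub>Z_D\<^esub> (kl_elem (- \<sigma>) ?j \<otimes>\<^bsub>Z_D\<^esub> ?X)) (cls x)"
    by (simp add: int_group_ring_simps)
  also have "\<dots> = (kl_elem (- \<sigma>) ?j \<otimes>\<^bsub>Z_D\<^esub> ?X) (cls x) + (kl_elem (- \<sigma>) ?j \<otimes>\<^bsub>Z_D\<^esub> ?X) (cls (\<sigma> - x))"
    using generator_mult[OF ge2.prems(1)] by (simp add: kl_elem_def)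
  finally show ?case
    using ge2.IH(1)[of \<sigma> x] ge2.IH(2)[of "- \<sigma>"] ge2.prems
      product_sum_add_reflect[of \<sigma> ?j i x] product_sum_add_reflect[of \<sigma> ?j "i + 1" x] product_sum_add_reflect[of \<sigma> ?j "i - 1" x]
    by (auto split: if_splits)
qed

end

section \<open>Structure constants of the Kazhdan-Lusztig basis\<close>

context kl_dihedral
begin

abbreviation D :: "dih set" where "D \<equiv> carrier (dihedral n)"
abbreviation R :: "(dih \<Rightarrow> int) ring" where "R \<equiv> kl_semiring n"
abbreviation e :: dih where "e \<equiv> cls 0"
abbreviation w0 :: dih where "w0 \<equiv> cls (int n)"

definition kl_sum :: "(dih \<Rightarrow> nat) \<Rightarrow> dih \<Rightarrow> int" where
  "kl_sum d = (\<lambda>g. \<Sum>w\<in>D. int (d w) * kl_basis n w g)"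

definition supported :: "(dih \<Rightarrow> nat) \<Rightarrow> bool" where
  "supported d \<longleftrightarrow> (\<forall>w. w \<notin> D \<longrightarrow> d w = 0)"

text \<open>
  Evaluation at an element of maximal length among those with a non-zero coefficient leaves a
  single term.
\<close>

lemma kl_basis_independent:
  assumes "\<And>g. (\<Sum>w\<in>D. c w * kl_basis n w g) = (0 :: int)" "w \<in> D"
  shows "c w = 0"
proof (rule ccontr)
  assume "c w \<noteq> 0"
  define N where "N = {w \<in> D. c w \<noteq> 0}"
  have "finite N" "N \<noteq> {}" using \<open>c w \<noteq> 0\<close> assms(2) by (auto simp: N_def)
  then have "Max (dih_length ` N) \<in> dih_length ` N" by (intro Max_in) auto
  then obtain v where vN: "v \<in> N" "dih_length v = Max (dih_length ` N)" by force
  have v: "v \<in> D" "c v \<noteq> 0" using vN(1) by (simp_all add: N_def)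
  have max: "dih_length w \<le> dih_length v" if "w \<in> D" "c w \<noteq> 0" for w
    unfolding vN(2) using that \<open>finite N\<close> by (intro Max_ge) (simp_all add: N_def)
  have "(\<Sum>w\<in>D. c w * kl_basis n w v) = (\<Sum>w\<in>D. if w = v then c v else 0)"
  proof (rule sum.cong)
    fix w assume w: "w \<in> D"
    show "c w * kl_basis n w v = (if w = v then c v else 0)"
    proof (cases "c w = 0 \<or> w = v")
      case True
      then show ?thesis using v by (auto simp: kl_basis_def bruhat_le_def)
    next
      case False
      with max[OF w] have "\<not> bruhat_le v w" by (auto simp: bruhat_le_def)
      with False show ?thesis by (simp add: kl_basis_def)
    qed
  qed (rule HOL.refl)
  with v assms(1)[of v] show False by simp
qed

lemma kl_sum_inject:
  assumes "supported d" "supported d'" "kl_sum d = kl_sum d'"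
  shows "d = d'"
proof
  fix w
  have "(\<Sum>w\<in>D. (int (d w) - int (d' w)) * kl_basis n w g) = 0" for g
    using fun_cong[OF assms(3), of g] by (simp add: kl_sum_def left_diff_distrib sum_subtractf)
  from kl_basis_independent[of "\<lambda>w. int (d w) - int (d' w)", OF this]
  show "d w = d' w" using assms(1,2) by (cases "w \<in> D") (auto simp: supported_def)
qed

lemma kl_coeff_kl_sum:
  assumes "supported d"
  shows "kl_coeff n (kl_sum d) = d"
  unfolding kl_coeff_def
proof (rule the_equality)
  fix c assume "(\<forall>w. w \<notin> D \<longrightarrow> c w = 0) \<and> kl_sum d = (\<lambda>x. \<Sum>w\<in>D. int (c w) * kl_basis n w x)"
  then show "c = d" using kl_sum_inject[of c d] assms by (simp add: supported_def kl_sum_def)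
qed (use assms in \<open>simp add: supported_def kl_sum_def\<close>)

lemma kl_sum_add: "kl_sum (\<lambda>w. d w + d' w) = kl_sum d \<oplus>\<^bsub>Z_D\<^esub> kl_sum d'"
  by (simp add: kl_sum_def int_group_ring_simps algebra_simps sum.distrib)

lemma kl_sum_zero: "kl_sum (\<lambda>w. 0) = \<zero>\<^bsub>Z_D\<^esub>"
  by (simp add: kl_sum_def int_group_ring_simps)

lemma kl_sum_single: "w \<in> D \<Longrightarrow> kl_sum (\<lambda>u. if u = w then m else 0) g = int m * kl_basis n w g"
proof -
  assume "w \<in> D"
  moreover have "(\<Sum>u\<in>D. int (if u = w then m else 0) * kl_basis n u g)
      = (\<Sum>u\<in>D. if u = w then int m * kl_basis n w g else 0)"
    by (rule sum.cong) auto
  ultimately show ?thesis by (simp add: kl_sum_def)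
qed

lemma kl_sum_basis: "w \<in> D \<Longrightarrow> kl_sum (\<lambda>u. if u = w then 1 else 0) = kl_basis n w"
  using kl_sum_single[of w 1] by auto

lemma kl_sum_in_Z_D: "kl_sum d \<in> carrier Z_D"
  by (simp add: kl_sum_def int_group_ring_simps kl_basis_def)

lemma kl_basis_in_Z_D: "kl_basis n w \<in> carrier Z_D"
  by (simp add: int_group_ring_simps kl_basis_def)

lemma kl_basis_e: "kl_basis n e = \<one>\<^bsub>Z_D\<^esub>"
proof (rule function_eqI)
  interpret semiring Z_D by (rule semiring_Z_D)
  show "\<one>\<^bsub>Z_D\<^esub> \<in> carrier Z_D" by simp
  fix x
  have "dih_length e = 0" using dih_length_cls[of 0] by simp
  then show "kl_basis n e (cls x) = \<one>\<^bsub>Z_D\<^esub> (cls x)"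
    by (auto simp: kl_basis_def bruhat_le_def int_group_ring_simps one_dihedral)
qed (rule kl_basis_in_Z_D)

lemma cone_kl_sum:
  assumes "cone \<sigma> p b f" "\<bar>\<sigma>\<bar> = 1" "sgn_letter a = (if p then \<sigma> else - \<sigma>)"
  shows "\<exists>d. supported d \<and> (\<forall>x. kl_sum d (cls x) = f x) \<and>
    (\<forall>u. 0 < d u \<longrightarrow> u = w0 \<or> u \<in> left_cell n a) \<and> (b \<longrightarrow> (\<exists>u\<in>left_cell n a. 0 < d u))"
  using assms(1)
proof induction
  case zero
  then show ?case
    by (intro exI[of _ "\<lambda>u. 0"]) (simp add: supported_def kl_sum_zero int_group_ring_simps)
next
  case (longest b f)
  then obtain d where d: "supported d" "\<And>x. kl_sum d (cls x) = f x"
    "\<forall>u. 0 < d u \<longrightarrow> u = w0 \<or> u \<in> left_cell n a" "b \<longrightarrow> (\<exists>u\<in>left_cell n a. 0 < d u)" by blast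
  have "kl_basis n w0 (cls x) = 1" for x
    using kl_basis_cls[of 1 n x] n_ge_3 by (simp add: kl_fun_n)
  then have "kl_sum (\<lambda>u. d u + (if u = w0 then 1 else 0)) (cls x) = f x + 1" for x
    unfolding kl_sum_add by (simp add: kl_sum_basis d int_group_ring_simps)
  with d show ?case
    by (intro exI[of _ "\<lambda>u. d u + (if u = w0 then 1 else 0)"]) (auto simp: supported_def)
next
  case (cell b f k)
  then obtain d where d: "supported d" "\<And>x. kl_sum d (cls x) = f x"
    "\<forall>u. 0 < d u \<longrightarrow> u = w0 \<or> u \<in> left_cell n a" by blast
  let ?w = "cls (\<sigma> * int k)"
  have w: "?w \<in> left_cell n a"
    unfolding left_cell_eq using cell assms by (auto split: if_splits)
  have "kl_basis n ?w (cls x) = kl_fun \<sigma> (int k) x" for x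
    using kl_basis_cls assms cell by simp
  then have "kl_sum (\<lambda>u. d u + (if u = ?w then 1 else 0)) (cls x) = f x + kl_fun \<sigma> (int k) x" for x
    unfolding kl_sum_add by (simp add: kl_sum_basis d int_group_ring_simps)
  with d w show ?case
    by (intro exI[of _ "\<lambda>u. d u + (if u = ?w then 1 else 0)"]) (auto simp: supported_def)
qed

lemma left_cell_elem:
  assumes "w \<in> left_cell n a"
  obtains \<sigma> k where "\<bar>\<sigma>\<bar> = 1" "0 < k" "k < n" "w = cls (\<sigma> * int k)"
    "kl_basis n w = kl_elem \<sigma> k" "sgn_letter a = (if odd k then \<sigma> else - \<sigma>)"
  using assms unfolding left_cell_eq by (force simp: kl_elem_def)

lemma D_cases:
  assumes "w \<in> D"
  obtains (e) "w = e" | (w0) "w = w0" | (cell) a where "w \<in> left_cell n a"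
proof -
  obtain x where "w = cls x" using assms by (auto simp: carrier_dihedral)
  then obtain z where z: "- int n < z" "z \<le> int n" "w = cls z"
    using cls_representative[of x] by metis
  show ?thesis
  proof (cases "z = 0 \<or> z = int n")
    case False
    define \<sigma> k where "\<sigma> = sgn z" and "k = nat \<bar>z\<bar>"
    have s: "\<bar>\<sigma>\<bar> = 1" "0 < k" "k < n" "z = \<sigma> * int k"
      using False z by (auto simp: \<sigma>_def k_def abs_sgn_eq sgn_mult_abs)
    obtain a where "sgn_letter a = (if odd k then \<sigma> else - \<sigma>)"
    proof -
      have "(if odd k then \<sigma> else - \<sigma>) = 1 \<or> (if odd k then \<sigma> else - \<sigma>) = - 1"
        using s(1) by (auto simp: abs_if split: if_splits)
      then show ?thesis using that[of gen_s] that[of gen_t] by auto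
    qed
    then have "w \<in> left_cell n a" using s z(3) unfolding left_cell_eq by blast
    then show ?thesis by (rule cell)
  qed (use z e w0 in auto)
qed

text \<open>
  If the two adjacent letters differ, the product is the sum of the progressions for \<open>i + 1\<close> and
  \<open>i - 1\<close>. One of these numbers lies strictly between \<open>0\<close> and \<open>n\<close> since \<open>n \<ge> 3\<close>.
\<close>

lemma cell_product:
  assumes "w \<in> left_cell n b" "v \<in> left_cell n a"
  shows "\<exists>d. supported d \<and> kl_basis n w \<otimes>\<^bsub>Z_D\<^esub> kl_basis n v = kl_sum d \<and>
    (\<forall>u. 0 < d u \<longrightarrow> u = w0 \<or> u \<in> left_cell n a) \<and> (\<exists>u\<in>left_cell n a. 0 < d u)"
proof -
  obtain \<sigma> j where w: "\<bar>\<sigma>\<bar> = 1" "0 < j" "j < n" "kl_basis n w = kl_elem \<sigma> j"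
    using assms(1) by (elim left_cell_elem)
  obtain \<tau> i where v: "\<bar>\<tau>\<bar> = 1" "0 < i" "i < n" "kl_basis n v = kl_elem \<tau> i"
    "sgn_letter a = (if odd i then \<tau> else - \<tau>)"
    using assms(2) by (elim left_cell_elem)
  let ?p = "kl_elem \<sigma> j \<otimes>\<^bsub>Z_D\<^esub> kl_elem \<tau> i"
  have "\<exists>p. cone \<sigma> p True (\<lambda>x. ?p (cls x)) \<and> sgn_letter a = (if p then \<sigma> else - \<sigma>)"
  proof (cases "\<tau> = (if odd j then \<sigma> else - \<sigma>)")
    case True
    have "cone \<sigma> (even (i + j)) True (product_sum \<sigma> j i)"
      using cone_product_sum[of i j \<sigma>] v w by simp
    from cone_add[OF this this] have "cone \<sigma> (even (i + j)) True (\<lambda>x. 2 * product_sum \<sigma> j i x)" by simp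
    moreover have "?p (cls x) = 2 * product_sum \<sigma> j i x" for x
      using kl_product[of \<sigma> \<tau> j i x] True v w by simp
    ultimately show ?thesis using v(5) True by (intro exI[of _ "even (i + j)"]) auto
  next
    case False
    then have \<tau>: "\<tau> = (if odd j then - \<sigma> else \<sigma>)" using v(1) w(1) by (auto simp: abs_if split: if_splits)
    have c: "cone \<sigma> (even (i + 1 + j)) (0 < i + 1 \<and> i + 1 < n \<and> 0 < j \<and> j < n) (product_sum \<sigma> j (i + 1))"
      "cone \<sigma> (even (i - 1 + j)) (0 < i - 1 \<and> i - 1 < n \<and> 0 < j \<and> j < n) (product_sum \<sigma> j (i - 1))"
      using cone_product_sum[of "i + 1" j \<sigma>] cone_product_sum[of "i - 1" j \<sigma>] v w by simp_all
    have parity: "even (i + 1 + j) = odd (i + j)" "even (i - 1 + j) = odd (i + j)" using v by auto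
    have t: "((0 < i + 1 \<and> i + 1 < n \<and> 0 < j \<and> j < n) \<or> (0 < i - 1 \<and> i - 1 < n \<and> 0 < j \<and> j < n)) = True"
      using v w n_ge_3 by auto
    have "cone \<sigma> (odd (i + j)) True (\<lambda>x. product_sum \<sigma> j (i + 1) x + product_sum \<sigma> j (i - 1) x)"
      using cone_add[OF c(1)[unfolded parity] c(2)[unfolded parity]] unfolding t .
    moreover have "?p (cls x) = product_sum \<sigma> j (i + 1) x + product_sum \<sigma> j (i - 1) x" for x
      using kl_product[of \<sigma> \<tau> j i x] False v w by simp
    ultimately show ?thesis using v(5) \<tau> by (intro exI[of _ "odd (i + j)"]) auto
  qed
  then obtain p where p: "cone \<sigma> p True (\<lambda>x. ?p (cls x))" "sgn_letter a = (if p then \<sigma> else - \<sigma>)"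
    by blast
  then obtain d where d: "supported d" "\<And>x. kl_sum d (cls x) = ?p (cls x)"
    "\<forall>u. 0 < d u \<longrightarrow> u = w0 \<or> u \<in> left_cell n a" "\<exists>u\<in>left_cell n a. 0 < d u"
    using cone_kl_sum[OF p(1) w(1) p(2)] by auto
  interpret semiring Z_D by (rule semiring_Z_D)
  have "?p = kl_sum d"
    by (rule function_eqI) (simp_all add: d(2) kl_elem_in_carrier kl_sum_in_Z_D)
  with d w(4) v(4) show ?thesis by (intro exI[of _ d]) simp
qed

lemma kl_basis_w0: "\<bar>\<sigma>\<bar> = 1 \<Longrightarrow> kl_basis n w0 = kl_elem \<sigma> n"
proof (rule function_eqI)
  fix x assume "\<bar>\<sigma>\<bar> = 1"
  then show "kl_basis n w0 (cls x) = kl_elem \<sigma> n (cls x)"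
    using kl_basis_cls[of 1 n x] kl_elem_cls[of \<sigma> n x] n_ge_3 by (simp add: kl_fun_n)
qed (simp_all add: kl_basis_in_Z_D kl_elem_in_carrier)

lemma non_e_elem:
  assumes "w \<in> D" "w \<noteq> e"
  obtains \<sigma> k where "\<bar>\<sigma>\<bar> = 1" "0 < k" "k \<le> n" "kl_basis n w = kl_elem \<sigma> k"
  using assms(1)
proof (cases rule: D_cases)
  case w0
  then show ?thesis using that[of 1 n] kl_basis_w0[of 1] n_ge_3 by simp
next
  case (cell a)
  then show ?thesis by (elim left_cell_elem) (use that in force)
qed (use assms in simp)

text \<open>
  The longest element may be given either first letter, and the choice made here lets adjacent
  letters coincide. The sum over a progression of length \<open>n\<close> is constant.
\<close>

lemma w0_product:
  assumes "w \<in> D" "v \<in> D" "w \<noteq> e" "v \<noteq> e" "w = w0 \<or> v = w0"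
  shows "\<exists>m>0. kl_basis n w \<otimes>\<^bsub>Z_D\<^esub> kl_basis n v = kl_sum (\<lambda>u. if u = w0 then m else 0)"
proof -
  have product_sum_n: "product_sum \<sigma> n i x = int i" if "i \<le> n" for \<sigma> i x
    using product_sum_complement[of i n \<sigma> x] that by (simp add: product_sum_def)
  have product_sum_n': "product_sum \<sigma> j n x = int j" if "j \<le> n" for \<sigma> j x
    using product_sum_swap[OF that] product_sum_n[OF that] by metis
  obtain \<sigma> j \<tau> i where *: "\<bar>\<sigma>\<bar> = 1" "\<bar>\<tau>\<bar> = 1" "0 < j" "j \<le> n" "0 < i" "i \<le> n" "j = n \<or> i = n"
    "kl_basis n w = kl_elem \<sigma> j" "kl_basis n v = kl_elem \<tau> i" "\<tau> = (if odd j then \<sigma> else - \<sigma>)"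
  proof (cases "w = w0")
    case True
    obtain \<tau> i where v: "\<bar>\<tau>\<bar> = 1" "0 < i" "i \<le> n" "kl_basis n v = kl_elem \<tau> i"
      using assms by (elim non_e_elem)
    \<comment> \<open>The first letter for which the alternating word of length \<open>n\<close> ends in the letter \<open>\<tau>\<close>.\<close>
    define \<sigma> where "\<sigma> = (if odd n then \<tau> else - \<tau>)"
    have "\<bar>\<sigma>\<bar> = 1" using v by (simp add: \<sigma>_def)
    then have "kl_basis n w = kl_elem \<sigma> n" using True kl_basis_w0 by simp
    with \<open>\<bar>\<sigma>\<bar> = 1\<close> v n_ge_3 show ?thesis by (intro that[of \<sigma> \<tau> n i]) (simp_all add: \<sigma>_def)
  next
    case False
    obtain \<sigma> j where w: "\<bar>\<sigma>\<bar> = 1" "0 < j" "j \<le> n" "kl_basis n w = kl_elem \<sigma> j"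
      using assms by (elim non_e_elem)
    define \<tau> where "\<tau> = (if odd j then \<sigma> else - \<sigma>)"
    have "\<bar>\<tau>\<bar> = 1" using w by (simp add: \<tau>_def)
    then have "kl_basis n v = kl_elem \<tau> n" using False assms(5) kl_basis_w0 by simp
    with \<open>\<bar>\<tau>\<bar> = 1\<close> w n_ge_3 show ?thesis by (intro that[of \<sigma> \<tau> j n]) (simp_all add: \<tau>_def)
  qed
  interpret semiring Z_D by (rule semiring_Z_D)
  define m where "m = (if j = n then 2 * i else 2 * j)"
  have "kl_elem \<sigma> j \<otimes>\<^bsub>Z_D\<^esub> kl_elem \<tau> i = kl_sum (\<lambda>u. if u = w0 then m else 0)"
  proof (rule function_eqI)
    fix x
    have "(kl_elem \<sigma> j \<otimes>\<^bsub>Z_D\<^esub> kl_elem \<tau> i) (cls x) = 2 * product_sum \<sigma> j i x"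
      using kl_product[OF *(1,2,4,6,5), of x] unfolding if_P[OF *(10)] .
    also have "\<dots> = int m"
    proof (cases "j = n")
      case True
      then show ?thesis using product_sum_n[OF *(6)] by (simp add: m_def)
    next
      case False
      then show ?thesis using product_sum_n'[OF *(4)] *(7) by (simp add: m_def)
    qed
    also have "\<dots> = kl_sum (\<lambda>u. if u = w0 then m else 0) (cls x)"
      using kl_basis_cls[of 1 n x] n_ge_3 by (simp add: kl_sum_single kl_fun_n)
    finally show "(kl_elem \<sigma> j \<otimes>\<^bsub>Z_D\<^esub> kl_elem \<tau> i) (cls x) = kl_sum (\<lambda>u. if u = w0 then m else 0) (cls x)" .
  qed (simp_all add: kl_elem_in_carrier kl_sum_in_Z_D)
  moreover have "0 < m" using *(3,5) by (simp add: m_def)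
  ultimately show ?thesis using *(8,9) by metis
qed

definition product_support :: "dih \<Rightarrow> dih \<Rightarrow> dih set" where
  "product_support w v = {u. 0 < kl_coeff n (kl_basis n w \<otimes>\<^bsub>Z_D\<^esub> kl_basis n v) u}"

lemma supported_single: "w \<in> D \<Longrightarrow> supported (\<lambda>u. if u = w then m else 0)"
  by (auto simp: supported_def)

lemma product_support_kl_sum:
  "supported d \<Longrightarrow> kl_basis n w \<otimes>\<^bsub>Z_D\<^esub> kl_basis n v = kl_sum d \<Longrightarrow> product_support w v = {u. 0 < d u}"
  by (simp add: product_support_def kl_coeff_kl_sum)

lemma e_product:
  assumes "w \<in> D"
  shows "kl_basis n e \<otimes>\<^bsub>Z_D\<^esub> kl_basis n w = kl_sum (\<lambda>u. if u = w then 1 else 0)"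
    and "kl_basis n w \<otimes>\<^bsub>Z_D\<^esub> kl_basis n e = kl_sum (\<lambda>u. if u = w then 1 else 0)"
proof -
  interpret semiring Z_D by (rule semiring_Z_D)
  show "kl_basis n e \<otimes>\<^bsub>Z_D\<^esub> kl_basis n w = kl_sum (\<lambda>u. if u = w then 1 else 0)"
    "kl_basis n w \<otimes>\<^bsub>Z_D\<^esub> kl_basis n e = kl_sum (\<lambda>u. if u = w then 1 else 0)"
    using assms kl_basis_in_Z_D by (simp_all add: kl_basis_e kl_sum_basis)
qed

lemma product_support_e:
  assumes "w \<in> D"
  shows "product_support e w = {w}" "product_support w e = {w}"
  using product_support_kl_sum[OF supported_single e_product(1)]
    product_support_kl_sum[OF supported_single e_product(2)] assms by auto

lemma product_support_w0:
  assumes "w \<in> D" "v \<in> D" "w \<noteq> e" "v \<noteq> e" "w = w0 \<or> v = w0"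
  shows "product_support w v = {w0}"
proof -
  obtain m where "0 < m" "kl_basis n w \<otimes>\<^bsub>Z_D\<^esub> kl_basis n v = kl_sum (\<lambda>u. if u = w0 then m else 0)"
    using w0_product[OF assms] by blast
  then show ?thesis using product_support_kl_sum[OF supported_single, of w0 w v m] by auto
qed

lemma product_support_cell:
  assumes "w \<in> left_cell n b" "v \<in> left_cell n a"
  shows "product_support w v \<subseteq> insert w0 (left_cell n a)" "product_support w v \<inter> left_cell n a \<noteq> {}"
proof -
  obtain d where d: "supported d" "kl_basis n w \<otimes>\<^bsub>Z_D\<^esub> kl_basis n v = kl_sum d"
    "\<forall>u. 0 < d u \<longrightarrow> u = w0 \<or> u \<in> left_cell n a" "\<exists>u\<in>left_cell n a. 0 < d u"
    using cell_product[OF assms] by blast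
  have "product_support w v = {u. 0 < d u}" by (rule product_support_kl_sum[OF d(1,2)])
  with d(3,4) show "product_support w v \<subseteq> insert w0 (left_cell n a)"
    "product_support w v \<inter> left_cell n a \<noteq> {}" by auto
qed

lemma product_expansion:
  assumes "w \<in> D" "v \<in> D"
  obtains d where "supported d" "kl_basis n w \<otimes>\<^bsub>Z_D\<^esub> kl_basis n v = kl_sum d"
proof -
  have "\<exists>d. supported d \<and> kl_basis n w \<otimes>\<^bsub>Z_D\<^esub> kl_basis n v = kl_sum d"
  proof (cases "w = e \<or> v = e")
    case True
    then show ?thesis
      using e_product supported_single assms by (elim disjE) (simp_all, blast+)
  next
    case e: False
    show ?thesis
    proof (cases "w = w0 \<or> v = w0")
      case True
      then show ?thesis
        using w0_product[OF assms] e supported_single[OF cls_in_D] by (simp, blast)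
    next
      case False
      obtain b where "w \<in> left_cell n b" using assms(1) by (rule D_cases) (use e False in auto)
      moreover obtain a where "v \<in> left_cell n a"
        using assms(2) by (rule D_cases) (use e False in auto)
      ultimately show ?thesis using cell_product by blast
    qed
  qed
  with that show thesis by blast
qed

end

section \<open>The semiring as the span of its basis\<close>

context kl_dihedral
begin

lemma mult_add_left: "((\<lambda>g. p g + q g) \<otimes>\<^bsub>Z_D\<^esub> b) g = (p \<otimes>\<^bsub>Z_D\<^esub> b) g + (q \<otimes>\<^bsub>Z_D\<^esub> b) g"
  unfolding int_group_ring_mult[OF finite_D] sum.distrib[symmetric]
  by (intro sum.cong HOL.refl) (simp add: distrib_right)

lemma mult_add_right: "(b \<otimes>\<^bsub>Z_D\<^esub> (\<lambda>g. p g + q g)) g = (b \<otimes>\<^bsub>Z_D\<^esub> p) g + (b \<otimes>\<^bsub>Z_D\<^esub> q) g"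
  unfolding int_group_ring_mult[OF finite_D] sum.distrib[symmetric]
  by (intro sum.cong HOL.refl) (simp add: distrib_left)

lemma mult_scale_left: "((\<lambda>g. k * p g) \<otimes>\<^bsub>Z_D\<^esub> b) g = k * (p \<otimes>\<^bsub>Z_D\<^esub> b) g"
  unfolding int_group_ring_mult[OF finite_D] sum_distrib_left
  by (intro sum.cong HOL.refl) simp

lemma mult_scale_right: "(b \<otimes>\<^bsub>Z_D\<^esub> (\<lambda>g. k * p g)) g = k * (b \<otimes>\<^bsub>Z_D\<^esub> p) g"
  unfolding int_group_ring_mult[OF finite_D] sum_distrib_left
  by (intro sum.cong HOL.refl) simp

lemma mult_zero: "((\<lambda>g. 0) \<otimes>\<^bsub>Z_D\<^esub> b) g = 0" "(b \<otimes>\<^bsub>Z_D\<^esub> (\<lambda>g. 0)) g = 0"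
  unfolding int_group_ring_mult[OF finite_D] by (intro sum.neutral ballI, simp)+

lemma mult_sum_left:
  "finite F \<Longrightarrow> ((\<lambda>g. \<Sum>w\<in>F. c w * p w g) \<otimes>\<^bsub>Z_D\<^esub> b) g = (\<Sum>w\<in>F. c w * (p w \<otimes>\<^bsub>Z_D\<^esub> b) g)"
  by (induction F rule: finite_induct) (simp_all add: mult_zero mult_add_left mult_scale_left)

lemma mult_sum_right:
  "finite F \<Longrightarrow> (b \<otimes>\<^bsub>Z_D\<^esub> (\<lambda>g. \<Sum>w\<in>F. c w * p w g)) g = (\<Sum>w\<in>F. c w * (b \<otimes>\<^bsub>Z_D\<^esub> p w) g)"
  by (induction F rule: finite_induct) (simp_all add: mult_zero mult_add_right mult_scale_right)

abbreviation structure_coeff :: "dih \<Rightarrow> dih \<Rightarrow> dih \<Rightarrow> nat" where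
  "structure_coeff w v \<equiv> kl_coeff n (kl_basis n w \<otimes>\<^bsub>Z_D\<^esub> kl_basis n v)"

lemma product_structure_coeff:
  assumes "w \<in> D" "v \<in> D"
  shows "supported (structure_coeff w v)"
    and "kl_basis n w \<otimes>\<^bsub>Z_D\<^esub> kl_basis n v = kl_sum (structure_coeff w v)"
proof -
  obtain d where d: "supported d" "kl_basis n w \<otimes>\<^bsub>Z_D\<^esub> kl_basis n v = kl_sum d"
    using product_expansion[OF assms] .
  show "supported (structure_coeff w v)"
    "kl_basis n w \<otimes>\<^bsub>Z_D\<^esub> kl_basis n v = kl_sum (structure_coeff w v)"
    using d(1) unfolding d(2) kl_coeff_kl_sum[OF d(1)] by simp_all
qed

definition product_coeff :: "(dih \<Rightarrow> nat) \<Rightarrow> (dih \<Rightarrow> nat) \<Rightarrow> dih \<Rightarrow> nat" where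
  "product_coeff d d' u = (\<Sum>w\<in>D. \<Sum>v\<in>D. d w * d' v * structure_coeff w v u)"

lemma kl_sum_mult: "kl_sum d \<otimes>\<^bsub>Z_D\<^esub> kl_sum d' = kl_sum (product_coeff d d')"
proof
  fix g
  have "(kl_sum d \<otimes>\<^bsub>Z_D\<^esub> kl_sum d') g
      = (\<Sum>w\<in>D. \<Sum>v\<in>D. int (d w) * int (d' v) * (kl_basis n w \<otimes>\<^bsub>Z_D\<^esub> kl_basis n v) g)"
    unfolding kl_sum_def mult_sum_left[OF finite_D] mult_sum_right[OF finite_D]
    by (simp add: sum_distrib_left mult.assoc)
  also have "\<dots> = (\<Sum>w\<in>D. \<Sum>v\<in>D. \<Sum>u\<in>D.
      int (d w) * int (d' v) * int (structure_coeff w v u) * kl_basis n u g)"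
  proof (intro sum.cong HOL.refl)
    fix w v assume "w \<in> D" "v \<in> D"
    then have "(kl_basis n w \<otimes>\<^bsub>Z_D\<^esub> kl_basis n v) g
        = (\<Sum>u\<in>D. int (structure_coeff w v u) * kl_basis n u g)"
      by (subst product_structure_coeff(2)) (simp_all add: kl_sum_def)
    then show "int (d w) * int (d' v) * (kl_basis n w \<otimes>\<^bsub>Z_D\<^esub> kl_basis n v) g
        = (\<Sum>u\<in>D. int (d w) * int (d' v) * int (structure_coeff w v u) * kl_basis n u g)"
      by (simp add: sum_distrib_left mult.assoc)
  qed
  also have "\<dots> = (\<Sum>w\<in>D. \<Sum>u\<in>D. \<Sum>v\<in>D.
      int (d w) * int (d' v) * int (structure_coeff w v u) * kl_basis n u g)"
    by (rule sum.cong[OF HOL.refl], rule sum.swap)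
  also have "\<dots> = (\<Sum>u\<in>D. \<Sum>w\<in>D. \<Sum>v\<in>D.
      int (d w) * int (d' v) * int (structure_coeff w v u) * kl_basis n u g)"
    by (rule sum.swap)
  also have "\<dots> = kl_sum (product_coeff d d') g"
    unfolding kl_sum_def product_coeff_def of_nat_sum sum_distrib_right
    by (intro sum.cong HOL.refl) simp
  finally show "(kl_sum d \<otimes>\<^bsub>Z_D\<^esub> kl_sum d') g = kl_sum (product_coeff d d') g" .
qed

lemma supported_product_coeff: "supported (product_coeff d d')"
  using product_structure_coeff(1) by (auto simp: supported_def product_coeff_def)

lemma product_coeff_pos_iff:
  "0 < product_coeff d d' u \<longleftrightarrow> (\<exists>w\<in>D. \<exists>v\<in>D. 0 < d w \<and> 0 < d' v \<and> u \<in> product_support w v)"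
proof -
  have *: "product_coeff d d' u = 0 \<longleftrightarrow>
      (\<forall>w\<in>D. \<forall>v\<in>D. d w * d' v * structure_coeff w v u = 0)"
    unfolding product_coeff_def by (simp only: sum_eq_0_iff finite_D)
  have "0 < product_coeff d d' u \<longleftrightarrow> \<not> product_coeff d d' u = 0" by simp
  also have "\<dots> \<longleftrightarrow> (\<exists>w\<in>D. \<exists>v\<in>D. \<not> d w * d' v * structure_coeff w v u = 0)"
    unfolding * by simp
  also have "\<dots> \<longleftrightarrow> (\<exists>w\<in>D. \<exists>v\<in>D. 0 < d w \<and> 0 < d' v \<and> u \<in> product_support w v)"
    by (simp add: product_support_def)
  finally show ?thesis .
qed

lemma kl_semiring_simps:
  "a \<otimes>\<^bsub>R\<^esub> b = a \<otimes>\<^bsub>Z_D\<^esub> b" "a \<oplus>\<^bsub>R\<^esub> b = a \<oplus>\<^bsub>Z_D\<^esub> b" "\<one>\<^bsub>R\<^esub> = \<one>\<^bsub>Z_D\<^esub>" "\<zero>\<^bsub>R\<^esub> = \<zero>\<^bsub>Z_D\<^esub>"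
  by (simp_all add: kl_semiring_def)

lemma carrier_R: "carrier R = {kl_sum d | d. supported d}"
proof -
  let ?G = "generated_subsemiring Z_D (kl_basis n ` D)"
  have "\<exists>d. supported d \<and> a = kl_sum d" if "a \<in> ?G" for a
    using that
  proof induction
    case zero
    then show ?case by (intro exI[of _ "\<lambda>w. 0"]) (simp add: kl_sum_zero supported_def)
  next
    case one
    then show ?case
      by (intro exI[of _ "\<lambda>u. if u = e then 1 else 0"])
        (simp add: kl_sum_basis kl_basis_e supported_single)
  next
    case (incl a)
    then obtain w where "w \<in> D" "a = kl_basis n w" by blast
    then show ?case
      by (intro exI[of _ "\<lambda>u. if u = w then 1 else 0"]) (simp add: kl_sum_basis supported_single)
  next
    case (add a b)
    then obtain d d' where "supported d" "a = kl_sum d" "supported d'" "b = kl_sum d'" by blast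
    then show ?case
      by (intro exI[of _ "\<lambda>w. d w + d' w"]) (simp add: kl_sum_add supported_def)
  next
    case (mult a b)
    then obtain d d' where "a = kl_sum d" "b = kl_sum d'" by blast
    then show ?case
      by (intro exI[of _ "product_coeff d d'"]) (simp add: kl_sum_mult supported_product_coeff)
  qed
  moreover have "kl_sum d \<in> ?G" for d
  proof -
    have multiple: "(\<lambda>g. int k * kl_basis n w g) \<in> ?G" if "w \<in> D" for k w
    proof (induction k)
      case 0
      then show ?case
        using generated_subsemiring.zero[of Z_D "kl_basis n ` D"] by (simp add: int_group_ring_simps)
    next
      case (Suc k)
      have "kl_basis n w \<in> ?G" using that by (intro generated_subsemiring.incl) simp
      from generated_subsemiring.add[OF this Suc] show ?case
        by (simp add: int_group_ring_simps algebra_simps)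
    qed
    have "(\<lambda>g. \<Sum>w\<in>F. int (d w) * kl_basis n w g) \<in> ?G" if "finite F" "F \<subseteq> D" for F
      using that
    proof (induction F rule: finite_induct)
      case empty
      then show ?case
        using generated_subsemiring.zero[of Z_D "kl_basis n ` D"] by (simp add: int_group_ring_simps)
    next
      case (insert w F)
      then have "(\<lambda>g. int (d w) * kl_basis n w g) \<in> ?G" "(\<lambda>g. \<Sum>w\<in>F. int (d w) * kl_basis n w g) \<in> ?G"
        using multiple by auto
      from generated_subsemiring.add[OF this] show ?case
        using insert by (simp add: int_group_ring_simps)
    qed
    then show ?thesis unfolding kl_sum_def by simp
  qed
  ultimately show ?thesis by (auto simp: kl_semiring_def)
qed

lemma semiring_R: "semiring R"
  unfolding kl_semiring_def
  by (rule semiring_generated_subsemiring[OF semiring_Z_D]) (auto simp: kl_basis_in_Z_D)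

lemma kl_sum_in_R: "supported d \<Longrightarrow> kl_sum d \<in> carrier R"
  by (auto simp: carrier_R)

lemma kl_basis_in_R: "w \<in> D \<Longrightarrow> kl_basis n w \<in> carrier R"
  using kl_sum_in_R[OF supported_single[of w 1]] by (simp add: kl_sum_basis)

lemma supported_kl_coeff: "a \<in> carrier R \<Longrightarrow> supported (kl_coeff n a)"
  by (auto simp: carrier_R kl_coeff_kl_sum)

lemma kl_sum_kl_coeff: "a \<in> carrier R \<Longrightarrow> kl_sum (kl_coeff n a) = a"
  by (auto simp: carrier_R kl_coeff_kl_sum)

definition support :: "(dih \<Rightarrow> int) \<Rightarrow> dih set" where
  "support a = {w \<in> D. 0 < kl_coeff n a w}"

lemma support_kl_sum: "supported d \<Longrightarrow> support (kl_sum d) = {w. 0 < d w}"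
  by (auto simp: support_def kl_coeff_kl_sum supported_def)

lemma support_zero: "support \<zero>\<^bsub>R\<^esub> = {}"
  using support_kl_sum[of "\<lambda>w. 0"] by (simp add: kl_sum_zero kl_semiring_simps supported_def)

lemma support_basis: "w \<in> D \<Longrightarrow> support (kl_basis n w) = {w}"
  using support_kl_sum[OF supported_single[of w 1]] by (auto simp: kl_sum_basis)

lemma support_one: "support \<one>\<^bsub>R\<^esub> = {e}"
  using support_basis[of e] by (simp add: kl_basis_e kl_semiring_simps)

lemma support_add:
  assumes "a \<in> carrier R" "b \<in> carrier R"
  shows "support (a \<oplus>\<^bsub>R\<^esub> b) = support a \<union> support b"
proof -
  obtain d d' where d: "supported d" "a = kl_sum d" "supported d'" "b = kl_sum d'"
    using assms by (auto simp: carrier_R)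
  then have "supported (\<lambda>w. d w + d' w)" by (simp add: supported_def)
  from support_kl_sum[OF this] show ?thesis
    unfolding kl_semiring_simps kl_sum_add d(2,4) support_kl_sum[OF d(1)] support_kl_sum[OF d(3)]
    by auto
qed

lemma support_mult:
  assumes "a \<in> carrier R" "b \<in> carrier R"
  shows "support (a \<otimes>\<^bsub>R\<^esub> b) = (\<Union>w\<in>support a. \<Union>v\<in>support b. product_support w v)"
proof -
  obtain d d' where d: "supported d" "a = kl_sum d" "supported d'" "b = kl_sum d'"
    using assms by (auto simp: carrier_R)
  have in_D: "w \<in> D" if "0 < d w" for w using d(1) that by (auto simp: supported_def)
  have in_D': "w \<in> D" if "0 < d' w" for w using d(3) that by (auto simp: supported_def)
  show ?thesis
    unfolding kl_semiring_simps d(2,4) kl_sum_mult support_kl_sum[OF supported_product_coeff]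
      support_kl_sum[OF d(1)] support_kl_sum[OF d(3)] product_coeff_pos_iff
    using in_D in_D' by blast
qed

lemma finite_support: "finite (support a)"
  by (simp add: support_def)

lemma support_subset: "support a \<subseteq> D"
  by (auto simp: support_def)

end

section \<open>Semimodules on join-semilattices\<close>

text \<open>
  Semimodules whose addition is the join of a lattice. Multiples of an element are then equal to the
  element, so the action of a ring element is the join over its support, and associativity of the
  action only involves supports of products.
\<close>

locale kl_lattice_module = kl_dihedral n for n +
  fixes M :: "(dih \<Rightarrow> int, 'm :: complete_lattice) module"
    and act :: "dih \<Rightarrow> 'm \<Rightarrow> 'm"
  assumes zero_eq: "\<zero>\<^bsub>M\<^esub> = bot"
    and add_eq: "m \<oplus>\<^bsub>M\<^esub> k = sup m k"
    and smult_eq: "m \<in> carrier M \<Longrightarrow> a \<odot>\<^bsub>M\<^esub> m = (SUP w\<in>support a. act w m)"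
    and bot_closed: "bot \<in> carrier M"
    and sup_closed: "m \<in> carrier M \<Longrightarrow> k \<in> carrier M \<Longrightarrow> sup m k \<in> carrier M"
    and act_closed: "w \<in> D \<Longrightarrow> m \<in> carrier M \<Longrightarrow> act w m \<in> carrier M"
    and act_sup: "w \<in> D \<Longrightarrow> act w (sup m k) = sup (act w m) (act w k)"
    and act_bot: "w \<in> D \<Longrightarrow> act w bot = bot"
    and act_e: "act e m = m"
    and act_act: "w \<in> D \<Longrightarrow> v \<in> D \<Longrightarrow> act w (act v m) = (SUP u\<in>product_support w v. act u m)"
begin

lemma act_SUP: "finite F \<Longrightarrow> w \<in> D \<Longrightarrow> act w (SUP v\<in>F. g v) = (SUP v\<in>F. act w (g v))"
  by (induction F rule: finite_induct) (simp_all add: act_bot act_sup)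

lemma SUP_closed: "finite F \<Longrightarrow> F \<subseteq> D \<Longrightarrow> m \<in> carrier M \<Longrightarrow> (SUP w\<in>F. act w m) \<in> carrier M"
  by (induction F rule: finite_induct) (simp_all add: bot_closed sup_closed act_closed)

lemma semimodule_M: "semimodule R M"
proof (intro semimodule.intro semimodule_axioms.intro semiring_R abelian_monoidI)
  fix a b m k
  assume a: "a \<in> carrier R" and m: "m \<in> carrier M"
  show am: "a \<odot>\<^bsub>M\<^esub> m \<in> carrier M"
    using SUP_closed[OF finite_support support_subset m] by (simp add: smult_eq m)
  show "k \<in> carrier M \<Longrightarrow> a \<odot>\<^bsub>M\<^esub> (m \<oplus>\<^bsub>M\<^esub> k) = a \<odot>\<^bsub>M\<^esub> m \<oplus>\<^bsub>M\<^esub> a \<odot>\<^bsub>M\<^esub> k"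
  proof -
    assume k: "k \<in> carrier M"
    have "(SUP w\<in>support a. act w (sup m k)) = (SUP w\<in>support a. sup (act w m) (act w k))"
      using support_subset[of a] by (intro SUP_cong HOL.refl act_sup) blast
    also have "\<dots> = sup (SUP w\<in>support a. act w m) (SUP w\<in>support a. act w k)"
      by (rule complete_lattice_class.SUP_sup_distrib[symmetric])
    finally show ?thesis using m k by (simp add: smult_eq add_eq sup_closed)
  qed
  assume b: "b \<in> carrier R"
  show "(a \<oplus>\<^bsub>R\<^esub> b) \<odot>\<^bsub>M\<^esub> m = a \<odot>\<^bsub>M\<^esub> m \<oplus>\<^bsub>M\<^esub> b \<odot>\<^bsub>M\<^esub> m"
    using a b m by (simp add: smult_eq support_add add_eq SUP_union)
  have "b \<odot>\<^bsub>M\<^esub> m \<in> carrier M"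
    using SUP_closed[OF finite_support support_subset m] by (simp add: smult_eq m)
  then have "a \<odot>\<^bsub>M\<^esub> (b \<odot>\<^bsub>M\<^esub> m) = (SUP w\<in>support a. act w (SUP v\<in>support b. act v m))"
    using m by (simp add: smult_eq)
  also have "\<dots> = (SUP w\<in>support a. SUP v\<in>support b. SUP u\<in>product_support w v. act u m)"
    using support_subset[of a] support_subset[of b]
    by (intro SUP_cong HOL.refl) (simp add: act_SUP finite_support subset_iff act_act cong: SUP_cong_simp)
  also have "\<dots> = (a \<otimes>\<^bsub>R\<^esub> b) \<odot>\<^bsub>M\<^esub> m"
    using a b m by (simp add: smult_eq support_mult SUP_UNION)
  finally show "(a \<otimes>\<^bsub>R\<^esub> b) \<odot>\<^bsub>M\<^esub> m = a \<odot>\<^bsub>M\<^esub> (b \<odot>\<^bsub>M\<^esub> m)" by (rule HOL.sym)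
next
  fix a
  have "(SUP w\<in>support a. act w bot) = (SUP w\<in>support a. bot)"
    using support_subset[of a] by (intro SUP_cong HOL.refl) (auto simp: act_bot)
  then show "a \<odot>\<^bsub>M\<^esub> \<zero>\<^bsub>M\<^esub> = \<zero>\<^bsub>M\<^esub>" by (simp add: zero_eq smult_eq bot_closed)
qed (simp_all add: zero_eq add_eq smult_eq bot_closed sup_closed sup_assoc sup_commute sup_left_commute
    support_zero support_one act_e)

end

lemma (in kl_dihedral) smult_kl_semimodule:
  fixes act :: "dih \<Rightarrow> 'm :: complete_lattice \<Rightarrow> 'm"
  assumes "bot \<in> B" "\<And>m k. m \<in> B \<Longrightarrow> k \<in> B \<Longrightarrow> sup m k \<in> B" "\<And>w. w \<in> D \<Longrightarrow> act w m \<in> B"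
  shows "module.smult (kl_semimodule n B sup bot act) a m = (SUP w\<in>support a. act w m)"
proof -
  let ?A = "\<lparr>carrier = B, monoid.mult = undefined, monoid.one = undefined, ring.zero = bot, ring.add = sup\<rparr>"
  interpret A: abelian_monoid ?A
    by (rule abelian_monoidI) (auto simp: assms sup_assoc sup_commute sup_left_commute)
  have pow: "[k] \<cdot>\<^bsub>?A\<^esub> m = (if 0 < k then m else bot)" if "m \<in> B" for m :: 'm and k :: nat
  proof (induction k)
    case (Suc k)
    have "[Suc k] \<cdot>\<^bsub>?A\<^esub> m = sup ([k] \<cdot>\<^bsub>?A\<^esub> m) m" using A.add.nat_pow_Suc[of k m] by simp
    with Suc show ?case by simp
  qed (use A.add.nat_pow_0[of m] in simp)
  have "(\<Oplus>\<^bsub>?A\<^esub>w\<in>F. [kl_coeff n a w] \<cdot>\<^bsub>?A\<^esub> act w m) = (SUP w\<in>{w \<in> F. 0 < kl_coeff n a w}. act w m)"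
    if "finite F" "F \<subseteq> D" for F
    using that
  proof (induction F rule: finite_induct)
    case (insert w F)
    have "(\<Oplus>\<^bsub>?A\<^esub>w\<in>insert w F. [kl_coeff n a w] \<cdot>\<^bsub>?A\<^esub> act w m)
        = ([kl_coeff n a w] \<cdot>\<^bsub>?A\<^esub> act w m) \<oplus>\<^bsub>?A\<^esub> (\<Oplus>\<^bsub>?A\<^esub>w\<in>F. [kl_coeff n a w] \<cdot>\<^bsub>?A\<^esub> act w m)"
      using insert assms by (intro A.finsum_insert) (auto simp: pow)
    also have "\<dots> = sup (if 0 < kl_coeff n a w then act w m else bot)
        (SUP w\<in>{w \<in> F. 0 < kl_coeff n a w}. act w m)"
      using insert assms by (simp add: pow)
    also have "\<dots> = (SUP w\<in>{v \<in> insert w F. 0 < kl_coeff n a v}. act w m)"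
    proof (cases "0 < kl_coeff n a w")
      case True
      then have "{v \<in> insert w F. 0 < kl_coeff n a v} = insert w {v \<in> F. 0 < kl_coeff n a v}" by auto
      with True show ?thesis by simp
    next
      case False
      then have "{v \<in> insert w F. 0 < kl_coeff n a v} = {v \<in> F. 0 < kl_coeff n a v}" by auto
      with False show ?thesis by simp
    qed
    finally show ?case .
  qed simp
  from this[OF finite_D subset_refl] show ?thesis
    by (simp add: kl_semimodule_def Let_def support_def)
qed

section \<open>The six elementary semimodules\<close>

context kl_dihedral
begin

lemma sgn_letter_inject: "sgn_letter a = sgn_letter b \<Longrightarrow> a = b"
  by (cases a; cases b) simp_all

lemma w0_ne_e: "w0 \<noteq> e"
proof
  assume "w0 = e"
  then have "int n = 0" using n_ge_3 by (intro cls_eqD) auto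
  with n_ge_3 show False by simp
qed

lemma left_cell_ne:
  assumes "w \<in> left_cell n a"
  shows "w \<noteq> e" "w \<noteq> w0" "w \<in> D"
  using assms by (auto simp: left_cell_def one_dihedral dih_w0_eq)

lemma left_cell_unique:
  assumes "w \<in> left_cell n a" "w \<in> left_cell n b"
  shows "a = b"
proof -
  obtain \<sigma> k where 1: "\<bar>\<sigma>\<bar> = 1" "0 < k" "k < n" "w = cls (\<sigma> * int k)"
    "sgn_letter a = (if odd k then \<sigma> else - \<sigma>)"
    using assms(1) by (elim left_cell_elem)
  obtain \<tau> l where 2: "\<bar>\<tau>\<bar> = 1" "0 < l" "l < n" "w = cls (\<tau> * int l)"
    "sgn_letter b = (if odd l then \<tau> else - \<tau>)"
    using assms(2) by (elim left_cell_elem)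
  have abs: "\<bar>\<sigma> * int k\<bar> = int k" "\<bar>\<tau> * int l\<bar> = int l" using 1 2 by (simp_all add: abs_mult)
  have eq: "\<sigma> * int k = \<tau> * int l"
    using 1 2 abs by (intro cls_eqD) auto
  with abs have "k = l" by simp
  with eq 1(2) have "\<sigma> = \<tau>" by simp
  with \<open>k = l\<close> 1(5) 2(5) show ?thesis by (intro sgn_letter_inject) simp
qed

lemma product_support_cases:
  assumes "w \<in> D" "v \<in> D" "w \<noteq> e" "v \<noteq> e"
  shows "product_support w v \<noteq> {}" "e \<notin> product_support w v"
proof -
  have "product_support w v \<noteq> {} \<and> e \<notin> product_support w v"
  proof (cases "w = w0 \<or> v = w0")
    case True
    then show ?thesis using product_support_w0[OF assms] w0_ne_e by simp
  next
    case False
    obtain b where "w \<in> left_cell n b" using assms(1) by (rule D_cases) (use assms False in auto)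
    moreover obtain a where "v \<in> left_cell n a"
      using assms(2) by (rule D_cases) (use assms False in auto)
    ultimately show ?thesis
      using product_support_cell[of w b v a] left_cell_ne(1)[of e a] w0_ne_e by blast
  qed
  then show "product_support w v \<noteq> {}" "e \<notin> product_support w v" by simp_all
qed

abbreviation act_e :: "dih \<Rightarrow> bool \<Rightarrow> bool" where
  "act_e w m \<equiv> if w = \<one>\<^bsub>dihedral n\<^esub> then m else False"

abbreviation act_w0 :: "dih \<Rightarrow> bool \<Rightarrow> bool" where
  "act_w0 w m \<equiv> m"

lemma kl_semimodule_bool_simps:
  fixes act :: "dih \<Rightarrow> bool \<Rightarrow> bool"
  defines "M \<equiv> kl_semimodule n UNIV (\<or>) False act"
  shows "carrier M = UNIV" "\<zero>\<^bsub>M\<^esub> = bot" "m \<oplus>\<^bsub>M\<^esub> k = sup m k"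
    "a \<odot>\<^bsub>M\<^esub> m = (SUP w\<in>support a. act w m)"
proof -
  show "a \<odot>\<^bsub>M\<^esub> m = (SUP w\<in>support a. act w m)"
    using smult_kl_semimodule[of UNIV act m a] unfolding M_def sup_bool_def bot_bool_def by blast
qed (simp_all add: M_def kl_semimodule_def Let_def)

lemma C_w0_lattice_module: "kl_lattice_module n (C_w0 n) act_w0"
proof (unfold_locales, unfold C_w0_def kl_semimodule_bool_simps)
  fix w v :: dih and m :: bool
  assume wv: "w \<in> D" "v \<in> D"
  have "product_support w v \<noteq> {}"
  proof (cases "w = e \<or> v = e")
    case True
    then show ?thesis using product_support_e(1)[OF wv(2)] product_support_e(2)[OF wv(1)] by auto
  next
    case False
    then show ?thesis using product_support_cases(1)[OF wv] by simp
  qed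
  then show "m = (SUP u\<in>product_support w v. m)"
    by (rule SUP_const[symmetric])
qed simp_all

lemma C_e_lattice_module: "kl_lattice_module n (C_e n) act_e"
proof (unfold_locales, unfold C_e_def kl_semimodule_bool_simps)
  fix w v :: dih and m :: bool
  assume wv: "w \<in> D" "v \<in> D"
  show "act_e w (act_e v m) = (SUP u\<in>product_support w v. act_e u m)"
  proof (cases "w = e \<or> v = e")
    case True
    then show ?thesis
    proof
      assume "w = e"
      then show ?thesis using product_support_e(1)[OF wv(2)] by (simp add: one_dihedral)
    next
      assume "v = e"
      then show ?thesis using product_support_e(2)[OF wv(1)] by (simp add: one_dihedral)
    qed
  next
    case False
    then have "e \<notin> product_support w v" using product_support_cases(2)[OF wv] by simp
    then have "(SUP u\<in>product_support w v. act_e u m) = (SUP u\<in>product_support w v. bot)"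
      by (intro SUP_cong HOL.refl) (auto simp: one_dihedral)
    with False show ?thesis by (simp add: one_dihedral)
  qed
next
  fix w :: dih and m k :: bool
  show "act_e w (sup m k) = sup (act_e w m) (act_e w k)" by (cases "w = \<one>\<^bsub>dihedral n\<^esub>") simp_all
qed (simp_all add: one_dihedral)

primrec point :: "letter \<Rightarrow> pt" where
  "point gen_s = pt_x"
| "point gen_t = pt_y"

lemma UNIV_pt: "UNIV = {pt_x, pt_y}"
  using pt.exhaust by auto

lemma K_action_e: "K_action n e m = m"
  by (simp add: K_action_def one_dihedral)

lemma K_action_w0: "K_action n w0 m = {}"
  using w0_ne_e by (simp add: K_action_def one_dihedral dih_w0_eq)

lemma K_action_cell:
  assumes "w \<in> left_cell n a"
  shows "K_action n w m = (if point a \<in> m then UNIV else {})"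
proof (cases a)
  case gen_s
  then show ?thesis
    using assms left_cell_ne[OF assms] by (simp add: K_action_def one_dihedral dih_w0_eq UNIV_pt)
next
  case gen_t
  then have "w \<notin> left_cell n gen_s" using assms left_cell_unique[of w gen_s gen_t] by auto
  with gen_t show ?thesis
    using assms left_cell_ne[OF assms] by (simp add: K_action_def one_dihedral dih_w0_eq UNIV_pt)
qed

lemma K_simps:
  "carrier ((K n)\<lparr>carrier := C\<rparr>) = C" "\<zero>\<^bsub>(K n)\<lparr>carrier := C\<rparr>\<^esub> = bot"
  "m \<oplus>\<^bsub>(K n)\<lparr>carrier := C\<rparr>\<^esub> k = sup m k"
  "a \<odot>\<^bsub>(K n)\<lparr>carrier := C\<rparr>\<^esub> m = (SUP w\<in>support a. K_action n w m)"
proof -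
  have "K n = kl_semimodule n UNIV sup bot (K_action n)"
    by (simp add: K_def UNIV_pt[symmetric] sup_set_def[symmetric] bot_set_def[symmetric])
  then show "a \<odot>\<^bsub>(K n)\<lparr>carrier := C\<rparr>\<^esub> m = (SUP w\<in>support a. K_action n w m)"
    using smult_kl_semimodule[of UNIV "K_action n" m a] by simp
qed (simp_all add: K_def kl_semimodule_def Let_def)

text \<open>
  Every set of subsets of a two-element set that contains the top and the bottom is closed under
  unions, and the basis elements other than \<open>e\<close> only take the values top and bottom. So \<open>K\<close>, \<open>K1\<close>, \<open>K2\<close> and
  \<open>K3\<close> are treated at once.
\<close>

lemma K_lattice_module:
  assumes "{{}, UNIV} \<subseteq> C"
  shows "kl_lattice_module n ((K n)\<lparr>carrier := C\<rparr>) (K_action n)"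
proof (unfold_locales, unfold K_simps)
  show "bot \<in> C" using assms by auto
next
  fix m k :: "pt set"
  assume "m \<in> C" "k \<in> C"
  moreover have "m \<subseteq> k \<or> k \<subseteq> m \<or> m \<union> k = UNIV"
  proof -
    have "m \<in> Pow {pt_x, pt_y}" "k \<in> Pow {pt_x, pt_y}" using UNIV_pt by auto
    then show ?thesis unfolding UNIV_pt by (auto simp: Pow_insert)
  qed
  ultimately show "sup m k \<in> C" using assms by (auto simp: Un_absorb1 Un_absorb2)
next
  fix w m assume "w \<in> D" "m \<in> C"
  then show "K_action n w m \<in> C"
    using assms by (elim D_cases) (auto simp: K_action_e K_action_w0 K_action_cell)
next
  fix w m k assume "w \<in> D"
  then show "K_action n w (sup m k) = sup (K_action n w m) (K_action n w k)"
    by (elim D_cases) (auto simp: K_action_e K_action_w0 K_action_cell)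
next
  fix w assume "w \<in> D"
  then show "K_action n w bot = bot"
    by (elim D_cases) (auto simp: K_action_e K_action_w0 K_action_cell)
next
  fix w v :: dih and m :: "pt set"
  assume wv: "w \<in> D" "v \<in> D"
  show "K_action n w (K_action n v m) = (SUP u\<in>product_support w v. K_action n u m)"
  proof (cases "w = e \<or> v = e")
    case True
    then show ?thesis using wv by (auto simp: product_support_e K_action_e)
  next
    case e: False
    have empty: "K_action n w {} = {}"
      using wv(1) by (elim D_cases) (auto simp: K_action_e K_action_w0 K_action_cell)
    show ?thesis
    proof (cases "w = w0 \<or> v = w0")
      case True
      then have "product_support w v = {w0}" using product_support_w0 wv e by blast
      with True empty show ?thesis by (auto simp: K_action_w0)
    next
      case False
      obtain b where w: "w \<in> left_cell n b" using wv(1) by (rule D_cases) (use e False in auto)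
      obtain a where v: "v \<in> left_cell n a" using wv(2) by (rule D_cases) (use e False in auto)
      show ?thesis
      proof (cases "point a \<in> m")
        case True
        obtain u where u: "u \<in> product_support w v" "u \<in> left_cell n a"
          using product_support_cell(2)[OF w v] by blast
        then have "K_action n u m = UNIV" using True by (simp add: K_action_cell)
        then have "(SUP u\<in>product_support w v. K_action n u m) = UNIV" using u(1) by blast
        with True w v show ?thesis by (simp add: K_action_cell)
      next
        case False
        have "K_action n u m = {}" if "u \<in> product_support w v" for u
          using product_support_cell(1)[OF w v] that False by (auto simp: K_action_w0 K_action_cell)
        then have "(SUP u\<in>product_support w v. K_action n u m) = {}" by simp
        with False empty v show ?thesis by (simp add: K_action_cell)
      qed
    qed
  qed
qed (simp_all add: K_action_e)

end

lemma (in kl_lattice_module) proper_M: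
  assumes "t \<in> carrier M" "t \<noteq> bot"
  shows "proper_semimodule R M"
proof -
  have "\<not> abelian_group M"
  proof
    assume "abelian_group M"
    from abelian_groupE(6)[OF this assms(1)] obtain y where "sup y t = bot"
      by (auto simp: zero_eq add_eq)
    with assms(2) show False by (metis sup_eq_bot_iff)
  qed
  with semimodule_M show ?thesis by (simp add: proper_semimodule_def)
qed

text \<open>
  A congruence with a pair of distinct elements contains \<open>(\<top>, \<bottom>)\<close>, and adding \<open>x\<close> to this pair
  shows that \<open>x\<close> is congruent to the top.
\<close>

lemma (in kl_lattice_module) elementary_if_separated:
  assumes ne: "carrier M \<noteq> {bot}"
    and separate: "\<And>m k. m \<in> carrier M \<Longrightarrow> k \<in> carrier M \<Longrightarrow> m \<noteq> k
      \<Longrightarrow> \<exists>a\<in>carrier R. {a \<odot>\<^bsub>M\<^esub> m, a \<odot>\<^bsub>M\<^esub> k} = {top_class.top, bot}"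
  shows "elementary_semimodule R M"
  unfolding elementary_semimodule_def
proof (intro conjI allI impI)
  show "semimodule R M" by (rule semimodule_M)
  show "carrier M \<noteq> {\<zero>\<^bsub>M\<^esub>}" using ne by (simp add: zero_eq)
  fix E assume E: "semimodule_congruence R M E"
  then have equiv: "equiv (carrier M) E" by (simp add: semimodule_congruence_def)
  show "E = Id_on (carrier M) \<or> E = carrier M \<times> carrier M"
  proof (cases "\<exists>m k. (m, k) \<in> E \<and> m \<noteq> k")
    case False
    then have "E = Id_on (carrier M)"
      using equiv_class_eq_iff[OF equiv] by (auto simp: Id_on_def)
    then show ?thesis ..
  next
    case True
    then obtain m k where mk: "(m, k) \<in> E" "m \<noteq> k" by blast
    then have "m \<in> carrier M" "k \<in> carrier M" using equiv_class_eq_iff[OF equiv] by auto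
    then obtain a where a: "a \<in> carrier R" "{a \<odot>\<^bsub>M\<^esub> m, a \<odot>\<^bsub>M\<^esub> k} = {top_class.top, bot}"
      using separate mk(2) by blast
    have am: "(a \<odot>\<^bsub>M\<^esub> m, a \<odot>\<^bsub>M\<^esub> k) \<in> E"
      using E mk(1) a(1) by (simp add: semimodule_congruence_def)
    have sym: "(y, x) \<in> E" if "(x, y) \<in> E" for x y using equiv that by (auto simp: equiv_def sym_def)
    have "(top_class.top, bot) \<in> E" using am sym[OF am] a(2) by (auto simp: doubleton_eq_iff)
    then have "(sup top_class.top x, sup bot x) \<in> E" if "x \<in> carrier M" for x
      using E that unfolding semimodule_congruence_def add_eq by blast
    then have top: "(top_class.top, x) \<in> E" if "x \<in> carrier M" for x using that by simp
    have "(x, y) \<in> E" if "x \<in> carrier M" "y \<in> carrier M" for x y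
      using top[OF that(1)] top[OF that(2)] equiv
      by (meson equivE symE transE)
    moreover have "E \<subseteq> carrier M \<times> carrier M" using equiv_class_eq_iff[OF equiv] by auto
    ultimately show ?thesis by auto
  qed
qed

context kl_dihedral
begin

lemma one_in_R: "\<one>\<^bsub>R\<^esub> \<in> carrier R"
  using kl_basis_in_R[of e] by (simp add: kl_basis_e kl_semiring_simps)

lemma bool_elementary_proper:
  assumes "kl_lattice_module n M act" "carrier M = (UNIV :: bool set)"
  shows "elementary_semimodule R M \<and> proper_semimodule R M"
proof -
  interpret kl_lattice_module n M act by (rule assms(1))
  have "\<one>\<^bsub>R\<^esub> \<odot>\<^bsub>M\<^esub> m = m" for m
    by (simp add: smult_eq assms(2) support_one act_e)
  then have "\<exists>a\<in>carrier R. {a \<odot>\<^bsub>M\<^esub> m, a \<odot>\<^bsub>M\<^esub> k} = {top_class.top, bot}" if "m \<noteq> k" for m k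
    using that by (intro bexI[OF _ one_in_R]) auto
  then have "elementary_semimodule R M"
    by (intro elementary_if_separated) (auto simp: assms(2))
  moreover have "proper_semimodule R M"
    by (rule proper_M[of True]) (simp_all add: assms(2))
  ultimately show ?thesis ..
qed

abbreviation \<theta> :: "letter \<Rightarrow> dih \<Rightarrow> int" where
  "\<theta> a \<equiv> kl_elem (sgn_letter a) 1"

lemma abs_sgn_letter [simp]: "\<bar>sgn_letter a\<bar> = 1"
  by (cases a) simp_all

lemma generator_in_left_cell: "cls (sgn_letter a) \<in> left_cell n a"
  unfolding left_cell_eq using n_ge_3
  by (intro CollectI exI[of _ "sgn_letter a"] exI[of _ 1]) simp

lemma theta_eq: "\<theta> a = kl_basis n (cls (sgn_letter a))"
  by (simp add: kl_elem_def)

lemma theta_in_R: "\<theta> a \<in> carrier R"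
  unfolding theta_eq by (rule kl_basis_in_R) simp

lemma K_elementary_proper:
  assumes "{{}, UNIV} \<subseteq> C"
  shows "elementary_semimodule R ((K n)\<lparr>carrier := C\<rparr>) \<and> proper_semimodule R ((K n)\<lparr>carrier := C\<rparr>)"
proof -
  let ?M = "(K n)\<lparr>carrier := C\<rparr>"
  interpret kl_lattice_module n ?M "K_action n" by (rule K_lattice_module[OF assms])
  have \<theta>: "\<theta> a \<odot>\<^bsub>?M\<^esub> m = (if point a \<in> m then UNIV else {})" for a m
    unfolding K_simps theta_eq using generator_in_left_cell[of a]
    by (simp add: support_basis K_action_cell)
  have "\<exists>a\<in>carrier R. {a \<odot>\<^bsub>?M\<^esub> m, a \<odot>\<^bsub>?M\<^esub> k} = {top_class.top, bot}" if ne: "m \<noteq> k" for m k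
  proof -
    obtain p where p: "p \<in> m \<longleftrightarrow> p \<notin> k" using ne by blast
    obtain a where a: "p = point a"
      using point.simps by (cases p) metis+
    have "{\<theta> a \<odot>\<^bsub>?M\<^esub> m, \<theta> a \<odot>\<^bsub>?M\<^esub> k} = {UNIV, {}}"
      using p unfolding a \<theta> by (cases "point a \<in> m") (simp_all add: insert_commute)
    then show ?thesis using theta_in_R[of a] by blast
  qed
  then have "elementary_semimodule R ?M"
    using assms by (intro elementary_if_separated) auto
  moreover have "proper_semimodule R ?M"
    by (rule proper_M[of UNIV]) (use assms in auto)
  ultimately show ?thesis ..
qed

end

section \<open>Elementary proper semimodules are idempotent\<close>

context semimodule
begin

text \<open>
  The Archimedean preorder for the algebraic order on \<open>M\<close>.
\<close>

definition dominates :: "'m \<Rightarrow> 'm \<Rightarrow> bool" where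
  "dominates m k \<longleftrightarrow> (\<exists>(N :: nat) d. d \<in> carrier M \<and> add_pow M N m = k \<oplus>\<^bsub>M\<^esub> d)"

lemma dominatesI: "d \<in> carrier M \<Longrightarrow> add_pow M (N :: nat) m = k \<oplus>\<^bsub>M\<^esub> d \<Longrightarrow> dominates m k"
  unfolding dominates_def by blast

lemma add_pow_2: "m \<in> carrier M \<Longrightarrow> add_pow M (2 :: nat) m = m \<oplus>\<^bsub>M\<^esub> m"
  by (simp add: numeral_2_eq_2 M.add.nat_pow_Suc M.add.nat_pow_0)

lemma add_pow_1: "m \<in> carrier M \<Longrightarrow> add_pow M (1 :: nat) m = m"
  by (simp add: M.add.nat_pow_Suc M.add.nat_pow_0)

lemma dominates_refl: "m \<in> carrier M \<Longrightarrow> dominates m m"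
  by (rule dominatesI[of "\<zero>\<^bsub>M\<^esub>" 1]) (simp_all only: add_pow_1 M.r_zero M.zero_closed)

lemma dominates_trans:
  assumes m: "m \<in> carrier M" and k: "k \<in> carrier M" and l: "l \<in> carrier M"
    and "dominates m k" "dominates k l"
  shows "dominates m l"
proof -
  obtain N :: nat and d where N: "d \<in> carrier M" "add_pow M N m = k \<oplus>\<^bsub>M\<^esub> d"
    using assms(4) unfolding dominates_def by blast
  obtain N' :: nat and d' where N': "d' \<in> carrier M" "add_pow M N' k = l \<oplus>\<^bsub>M\<^esub> d'"
    using assms(5) unfolding dominates_def by blast
  let ?d = "d' \<oplus>\<^bsub>M\<^esub> add_pow M N' d"
  have "add_pow M (N * N') m = add_pow M N' (k \<oplus>\<^bsub>M\<^esub> d)"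
    unfolding N(2)[symmetric] using m by (rule M.add.nat_pow_pow[symmetric])
  also have "\<dots> = l \<oplus>\<^bsub>M\<^esub> d' \<oplus>\<^bsub>M\<^esub> add_pow M N' d"
    unfolding N'(2)[symmetric] using k N(1) by (rule M.add.nat_pow_distrib)
  also have "\<dots> = l \<oplus>\<^bsub>M\<^esub> ?d"
    using l N'(1) M.add.nat_pow_closed[OF N(1)] by (rule M.a_assoc)
  finally show ?thesis
    using M.a_closed[OF N'(1) M.add.nat_pow_closed[OF N(1)]] by (intro dominatesI)
qed

lemma dominates_add:
  assumes m: "m \<in> carrier M" and k: "k \<in> carrier M" and l: "l \<in> carrier M"
    and "dominates m k"
  shows "dominates (m \<oplus>\<^bsub>M\<^esub> l) (k \<oplus>\<^bsub>M\<^esub> l)"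
proof -
  obtain N :: nat and d where N: "d \<in> carrier M" "add_pow M N m = k \<oplus>\<^bsub>M\<^esub> d"
    using assms(4) unfolding dominates_def by blast
  let ?l = "add_pow M N l"
  have l': "?l \<in> carrier M" using l by (rule M.add.nat_pow_closed)
  have "add_pow M (Suc N) (m \<oplus>\<^bsub>M\<^esub> l) = (add_pow M N m \<oplus>\<^bsub>M\<^esub> ?l) \<oplus>\<^bsub>M\<^esub> (m \<oplus>\<^bsub>M\<^esub> l)"
    unfolding M.add.nat_pow_Suc[of N "m \<oplus>\<^bsub>M\<^esub> l"] M.add.nat_pow_distrib[OF m l, of N] ..
  also have "\<dots> = (k \<oplus>\<^bsub>M\<^esub> l) \<oplus>\<^bsub>M\<^esub> (d \<oplus>\<^bsub>M\<^esub> (?l \<oplus>\<^bsub>M\<^esub> m))"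
    unfolding N(2) using m k l l' N(1) by (simp add: M.add.m_ac)
  finally show ?thesis
    using m l' N(1) by (intro dominatesI[of "d \<oplus>\<^bsub>M\<^esub> (?l \<oplus>\<^bsub>M\<^esub> m)" "Suc N"]) (simp_all only: M.a_closed)
qed

lemma smult_add_pow:
  assumes "r \<in> carrier R" "m \<in> carrier M"
  shows "r \<odot>\<^bsub>M\<^esub> add_pow M (N :: nat) m = add_pow M N (r \<odot>\<^bsub>M\<^esub> m)"
proof (induction N)
  case (Suc N)
  have "r \<odot>\<^bsub>M\<^esub> (add_pow M N m \<oplus>\<^bsub>M\<^esub> m) = r \<odot>\<^bsub>M\<^esub> add_pow M N m \<oplus>\<^bsub>M\<^esub> r \<odot>\<^bsub>M\<^esub> m"
    using assms M.add.nat_pow_closed by (intro smult_add_right)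
  then show ?case by (simp only: M.add.nat_pow_Suc Suc)
qed (simp only: M.add.nat_pow_0 smult_zero_right[OF assms(1)])

lemma dominates_smult:
  assumes r: "r \<in> carrier R" and m: "m \<in> carrier M" and k: "k \<in> carrier M" and "dominates m k"
  shows "dominates (r \<odot>\<^bsub>M\<^esub> m) (r \<odot>\<^bsub>M\<^esub> k)"
proof -
  obtain N :: nat and d where N: "d \<in> carrier M" "add_pow M N m = k \<oplus>\<^bsub>M\<^esub> d"
    using assms(4) unfolding dominates_def by blast
  show ?thesis
    using smult_closed[OF r N(1)] smult_add_pow[OF r m, of N] smult_add_right[OF r k N(1)] N(2)
    by (intro dominatesI[of "r \<odot>\<^bsub>M\<^esub> d" N]) simp_all
qed

text \<open>
  Mutual domination is a congruence. Any element dominated by \<open>0\<close> is invertible, so the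
  congruence is not full for a proper semimodule; it relates \<open>m\<close> to \<open>m + m\<close>.
\<close>

theorem elementary_proper_idempotent:
  assumes elementary: "elementary_semimodule R M" and "\<not> abelian_group M" and m: "m \<in> carrier M"
  shows "m \<oplus>\<^bsub>M\<^esub> m = m"
proof -
  define E where "E = {(m, k). m \<in> carrier M \<and> k \<in> carrier M \<and> dominates m k \<and> dominates k m}"
  have "semimodule_congruence R M E"
    unfolding semimodule_congruence_def
  proof (intro conjI allI impI ballI)
    show "equiv (carrier M) E"
    proof (rule equivI)
      show "refl_on (carrier M) E" by (rule refl_onI) (auto simp: E_def dominates_refl)
      show "sym_on UNIV E" by (auto simp: E_def sym_on_def)
      show "trans_on UNIV E" unfolding E_def by (rule transI) (auto intro: dominates_trans)
      show "E \<subseteq> carrier M \<times> carrier M" by (auto simp: E_def)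
    qed
    fix m k l assume "(m, k) \<in> E" "l \<in> carrier M"
    then show "(m \<oplus>\<^bsub>M\<^esub> l, k \<oplus>\<^bsub>M\<^esub> l) \<in> E" by (simp add: E_def dominates_add)
  next
    fix m k r assume "(m, k) \<in> E" "r \<in> carrier R"
    then show "(r \<odot>\<^bsub>M\<^esub> m, r \<odot>\<^bsub>M\<^esub> k) \<in> E" by (simp add: E_def dominates_smult smult_closed)
  qed
  with elementary have E: "E = Id_on (carrier M) \<or> E = carrier M \<times> carrier M"
    by (simp add: elementary_semimodule_def)
  have "E \<noteq> carrier M \<times> carrier M"
  proof
    assume full: "E = carrier M \<times> carrier M"
    have "\<exists>y\<in>carrier M. y \<oplus>\<^bsub>M\<^esub> x = \<zero>\<^bsub>M\<^esub>" if x: "x \<in> carrier M" for x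
    proof -
      have "(\<zero>\<^bsub>M\<^esub>, x) \<in> E" using full x by simp
      then obtain N :: nat and d where d: "d \<in> carrier M" "add_pow M N \<zero>\<^bsub>M\<^esub> = x \<oplus>\<^bsub>M\<^esub> d"
        unfolding E_def dominates_def by blast
      have "d \<oplus>\<^bsub>M\<^esub> x = \<zero>\<^bsub>M\<^esub>"
        using d(2) M.a_comm[OF d(1) x] by (simp add: M.add.nat_pow_one)
      with d(1) show ?thesis by blast
    qed
    then have "abelian_group M" by (intro abelian_groupI) (auto simp: M.add.m_ac)
    with assms(2) show False by simp
  qed
  with E have Id: "E = Id_on (carrier M)" by simp
  have "dominates m (m \<oplus>\<^bsub>M\<^esub> m)"
    using m by (intro dominatesI[of "\<zero>\<^bsub>M\<^esub>" 2]) (simp_all add: add_pow_2)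
  moreover have "dominates (m \<oplus>\<^bsub>M\<^esub> m) m"
    using m add_pow_1[of "m \<oplus>\<^bsub>M\<^esub> m"] by (intro dominatesI[of m 1]) simp_all
  ultimately have "(m, m \<oplus>\<^bsub>M\<^esub> m) \<in> E" using m by (simp add: E_def)
  then show ?thesis unfolding Id by auto
qed

end

section \<open>Classification\<close>

locale elementary_kl_semimodule = kl_dihedral n + semimodule "kl_semiring n" M
  for n and M :: "(dih \<Rightarrow> int, 'm) module" +
  assumes elementary: "elementary_semimodule (kl_semiring n) M"
    and proper: "proper_semimodule (kl_semiring n) M"
begin

lemma idempotent: "m \<in> carrier M \<Longrightarrow> m \<oplus>\<^bsub>M\<^esub> m = m"
  using elementary_proper_idempotent[OF elementary] proper by (simp add: proper_semimodule_def)

lemma add_eq_zero_iff: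
  assumes "m \<in> carrier M" "k \<in> carrier M"
  shows "m \<oplus>\<^bsub>M\<^esub> k = \<zero>\<^bsub>M\<^esub> \<longleftrightarrow> m = \<zero>\<^bsub>M\<^esub> \<and> k = \<zero>\<^bsub>M\<^esub>"
proof
  have *: "m = \<zero>\<^bsub>M\<^esub>" if "m \<in> carrier M" "k \<in> carrier M" "m \<oplus>\<^bsub>M\<^esub> k = \<zero>\<^bsub>M\<^esub>" for m k
  proof -
    have "m = m \<oplus>\<^bsub>M\<^esub> (m \<oplus>\<^bsub>M\<^esub> k)" using that by simp
    also have "\<dots> = (m \<oplus>\<^bsub>M\<^esub> m) \<oplus>\<^bsub>M\<^esub> k" using that by (simp add: M.a_assoc)
    also have "\<dots> = \<zero>\<^bsub>M\<^esub>" using that by (simp add: idempotent)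
    finally show ?thesis .
  qed
  assume "m \<oplus>\<^bsub>M\<^esub> k = \<zero>\<^bsub>M\<^esub>"
  then show "m = \<zero>\<^bsub>M\<^esub> \<and> k = \<zero>\<^bsub>M\<^esub>"
    using *[of m k] *[of k m] assms M.a_comm by simp
qed simp

lemma smult_multiple:
  assumes "w \<in> D" "m \<in> carrier M"
  shows "kl_sum (\<lambda>u. if u = w then N else 0) \<odot>\<^bsub>M\<^esub> m
    = (if N = 0 then \<zero>\<^bsub>M\<^esub> else kl_basis n w \<odot>\<^bsub>M\<^esub> m)"
proof (induction N)
  case 0
  have "kl_sum (\<lambda>u. if u = w then 0 else 0) = \<zero>\<^bsub>R\<^esub>"
    by (simp add: kl_sum_zero kl_semiring_simps)
  then show ?case using assms smult_zero_left by simp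
next
  case (Suc N)
  have "(\<lambda>u. if u = w then Suc N else 0) = (\<lambda>u. (if u = w then N else 0) + (if u = w then 1 else 0))"
    by auto
  then have "kl_sum (\<lambda>u. if u = w then Suc N else 0)
      = kl_sum (\<lambda>u. if u = w then N else 0) \<oplus>\<^bsub>R\<^esub> kl_basis n w"
    using assms by (simp only: kl_sum_add kl_sum_basis kl_semiring_simps)
  then have "kl_sum (\<lambda>u. if u = w then Suc N else 0) \<odot>\<^bsub>M\<^esub> m
      = kl_sum (\<lambda>u. if u = w then N else 0) \<odot>\<^bsub>M\<^esub> m \<oplus>\<^bsub>M\<^esub> kl_basis n w \<odot>\<^bsub>M\<^esub> m"
    using assms kl_sum_in_R[OF supported_single[of w N]] kl_basis_in_R by (simp add: smult_add_left)
  with Suc assms show ?case by (simp add: smult_closed kl_basis_in_R idempotent)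
qed

lemma hom_smult:
  fixes f :: "'m \<Rightarrow> 'l :: complete_lattice"
  assumes zero: "f \<zero>\<^bsub>M\<^esub> = bot"
    and add: "\<And>m k. m \<in> carrier M \<Longrightarrow> k \<in> carrier M \<Longrightarrow> f (m \<oplus>\<^bsub>M\<^esub> k) = sup (f m) (f k)"
    and act: "\<And>w m. w \<in> D \<Longrightarrow> m \<in> carrier M \<Longrightarrow> f (kl_basis n w \<odot>\<^bsub>M\<^esub> m) = act w (f m)"
    and r: "r \<in> carrier R" and m: "m \<in> carrier M"
  shows "f (r \<odot>\<^bsub>M\<^esub> m) = (SUP w\<in>support r. act w (f m))"
proof -
  let ?c = "kl_coeff n r"
  let ?r = "\<lambda>F. kl_sum (\<lambda>u. if u \<in> F then ?c u else 0)"
  have "f (?r F \<odot>\<^bsub>M\<^esub> m) = (SUP w\<in>{w \<in> F. 0 < ?c w}. act w (f m))" if "finite F" "F \<subseteq> D" for F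
    using that
  proof (induction F rule: finite_induct)
    case empty
    have "?r {} = \<zero>\<^bsub>R\<^esub>" by (simp add: kl_sum_zero kl_semiring_simps)
    then show ?case using smult_zero_left[OF m] zero by simp
  next
    case (insert w F)
    let ?s = "kl_sum (\<lambda>u. if u = w then ?c w else 0)"
    have "(\<lambda>u. if u \<in> insert w F then ?c u else 0)
        = (\<lambda>u. (if u = w then ?c w else 0) + (if u \<in> F then ?c u else 0))"
      using insert by auto
    then have split: "?r (insert w F) = ?s \<oplus>\<^bsub>R\<^esub> ?r F"
      by (simp only: kl_sum_add kl_semiring_simps)
    have car: "?s \<in> carrier R" "?r F \<in> carrier R"
      using insert kl_sum_in_R supported_single by (auto simp: supported_def intro!: kl_sum_in_R)
    have "f (?s \<odot>\<^bsub>M\<^esub> m) = (if 0 < ?c w then act w (f m) else bot)"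
      using insert m by (simp add: smult_multiple zero act)
    then have "f (?r (insert w F) \<odot>\<^bsub>M\<^esub> m) = sup (if 0 < ?c w then act w (f m) else bot)
        (SUP w\<in>{w \<in> F. 0 < ?c w}. act w (f m))"
      unfolding split smult_add_left[OF car m] using car m insert by (simp add: add smult_closed)
    also have "\<dots> = (SUP w\<in>{v \<in> insert w F. 0 < ?c v}. act w (f m))"
    proof (cases "0 < ?c w")
      case True
      then have "{v \<in> insert w F. 0 < ?c v} = insert w {v \<in> F. 0 < ?c v}" by auto
      with True show ?thesis by simp
    next
      case False
      then have "{v \<in> insert w F. 0 < ?c v} = {v \<in> F. 0 < ?c v}" by auto
      with False show ?thesis by simp
    qed
    finally show ?case .
  qed
  from this[OF finite_D subset_refl]
  have "f (?r D \<odot>\<^bsub>M\<^esub> m) = (SUP w\<in>support r. act w (f m))" by (simp add: support_def)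
  moreover have "(\<lambda>u. if u \<in> D then ?c u else 0) = ?c"
    using supported_kl_coeff[OF r] by (auto simp: supported_def)
  ultimately show ?thesis by (simp add: kl_sum_kl_coeff[OF r])
qed

text \<open>
  The kernel congruence of a homomorphism to a lattice is equality or full; in the latter case
  the homomorphism is constant.
\<close>

lemma nonzero_hom_isomorphic:
  fixes f :: "'m \<Rightarrow> 'l :: complete_lattice"
  assumes zero: "f \<zero>\<^bsub>M\<^esub> = bot"
    and add: "\<And>m k. m \<in> carrier M \<Longrightarrow> k \<in> carrier M \<Longrightarrow> f (m \<oplus>\<^bsub>M\<^esub> k) = sup (f m) (f k)"
    and act: "\<And>w m. w \<in> D \<Longrightarrow> m \<in> carrier M \<Longrightarrow> f (kl_basis n w \<odot>\<^bsub>M\<^esub> m) = act w (f m)"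
    and N: "kl_lattice_module n N act" "carrier N = f ` carrier M"
    and nonzero: "\<exists>m\<in>carrier M. f m \<noteq> bot"
  shows "semimodule_isomorphic R M N"
proof -
  interpret N: kl_lattice_module n N act by (rule N(1))
  have smult: "f (r \<odot>\<^bsub>M\<^esub> m) = (SUP w\<in>support r. act w (f m))"
    if "r \<in> carrier R" "m \<in> carrier M" for r m
    using zero add act that by (rule hom_smult)
  define E where "E = {(m, k). m \<in> carrier M \<and> k \<in> carrier M \<and> f m = f k}"
  have "semimodule_congruence R M E"
    unfolding semimodule_congruence_def
  proof (intro conjI allI impI ballI)
    show "equiv (carrier M) E"
    proof (rule equivI)
      show "refl_on (carrier M) E" by (rule refl_onI) (auto simp: E_def)
      show "sym_on UNIV E" by (auto simp: E_def sym_on_def)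
      show "trans_on UNIV E" unfolding E_def by (rule transI) auto
      show "E \<subseteq> carrier M \<times> carrier M" by (auto simp: E_def)
    qed
    fix m k l assume "(m, k) \<in> E" "l \<in> carrier M"
    then show "(m \<oplus>\<^bsub>M\<^esub> l, k \<oplus>\<^bsub>M\<^esub> l) \<in> E" by (simp add: E_def add)
  next
    fix m k r assume "(m, k) \<in> E" "r \<in> carrier R"
    then show "(r \<odot>\<^bsub>M\<^esub> m, r \<odot>\<^bsub>M\<^esub> k) \<in> E" by (simp add: E_def smult smult_closed)
  qed
  with elementary have "E = Id_on (carrier M) \<or> E = carrier M \<times> carrier M"
    by (simp add: elementary_semimodule_def)
  moreover have "E \<noteq> carrier M \<times> carrier M"
  proof
    assume full: "E = carrier M \<times> carrier M"
    obtain m where m: "m \<in> carrier M" "f m \<noteq> bot" using nonzero by blast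
    then have "(m, \<zero>\<^bsub>M\<^esub>) \<in> E" using full by simp
    with m(2) zero show False by (simp add: E_def)
  qed
  ultimately have Id: "E = Id_on (carrier M)" by simp
  have "inj_on f (carrier M)"
  proof (rule inj_onI)
    fix m k assume "m \<in> carrier M" "k \<in> carrier M" "f m = f k"
    then have "(m, k) \<in> E" by (simp add: E_def)
    then show "m = k" unfolding Id by auto
  qed
  then have "bij_betw f (carrier M) (carrier N)" unfolding N(2) by (simp add: bij_betw_def)
  moreover have "f (r \<odot>\<^bsub>M\<^esub> m) = r \<odot>\<^bsub>N\<^esub> f m" if "r \<in> carrier R" "m \<in> carrier M" for r m
    using that N.smult_eq[of "f m" r] smult[OF that] by (simp add: N(2))
  ultimately show ?thesis
    unfolding semimodule_isomorphic_def using zero add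
    by (intro exI[of _ f]) (simp add: N.zero_eq N.add_eq)
qed

end

context kl_dihedral
begin

text \<open>
  This makes the condition \<open>w\<^sub>0 m \<noteq> 0\<close> invariant under all basis elements once addition is
  idempotent.
\<close>

lemma w0_absorbs:
  assumes "w \<in> D"
  obtains N where "0 < N" "kl_basis n w0 \<otimes>\<^bsub>R\<^esub> kl_basis n w = kl_sum (\<lambda>u. if u = w0 then N else 0)"
proof (cases "w = e")
  case True
  then show ?thesis using that[of 1] e_product(2)[of w0] by (simp add: kl_semiring_simps)
next
  case False
  then show ?thesis
    using that w0_product[of w0 w] assms w0_ne_e by (auto simp: kl_semiring_simps)
qed

lemma kl_elem_in_R: "kl_elem \<sigma> k \<in> carrier R"
  using kl_basis_in_R kl_sum_in_R[of "\<lambda>w. 0"]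
  by (simp add: kl_elem_def kl_sum_def supported_def)

lemma kl_elem_0: "kl_elem \<sigma> 0 = \<zero>\<^bsub>R\<^esub>"
  by (simp add: kl_elem_def kl_semiring_simps int_group_ring_simps)

end

context elementary_kl_semimodule
begin

lemma basis_smult_closed: "w \<in> D \<Longrightarrow> m \<in> carrier M \<Longrightarrow> kl_basis n w \<odot>\<^bsub>M\<^esub> m \<in> carrier M"
  by (simp add: smult_closed kl_basis_in_R)

lemma w0_smult_basis:
  assumes "w \<in> D" "m \<in> carrier M"
  shows "kl_basis n w0 \<odot>\<^bsub>M\<^esub> (kl_basis n w \<odot>\<^bsub>M\<^esub> m) = kl_basis n w0 \<odot>\<^bsub>M\<^esub> m"
proof -
  obtain N where N: "0 < N" "kl_basis n w0 \<otimes>\<^bsub>R\<^esub> kl_basis n w = kl_sum (\<lambda>u. if u = w0 then N else 0)"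
    using w0_absorbs[OF assms(1)] .
  have "kl_basis n w0 \<odot>\<^bsub>M\<^esub> (kl_basis n w \<odot>\<^bsub>M\<^esub> m)
      = (kl_basis n w0 \<otimes>\<^bsub>R\<^esub> kl_basis n w) \<odot>\<^bsub>M\<^esub> m"
    using assms by (intro smult_assoc[symmetric]) (simp_all add: kl_basis_in_R)
  also have "\<dots> = kl_basis n w0 \<odot>\<^bsub>M\<^esub> m" using N assms by (simp add: smult_multiple)
  finally show ?thesis .
qed

lemma w0_nonzero_isomorphic:
  assumes "\<exists>m\<in>carrier M. kl_basis n w0 \<odot>\<^bsub>M\<^esub> m \<noteq> \<zero>\<^bsub>M\<^esub>"
  shows "semimodule_isomorphic R M (C_w0 n)"
proof (rule nonzero_hom_isomorphic[where act = act_w0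
      and f = "\<lambda>m. kl_basis n w0 \<odot>\<^bsub>M\<^esub> m \<noteq> \<zero>\<^bsub>M\<^esub>"])
  let ?f = "\<lambda>m. kl_basis n w0 \<odot>\<^bsub>M\<^esub> m \<noteq> \<zero>\<^bsub>M\<^esub>"
  show zero: "?f \<zero>\<^bsub>M\<^esub> = bot" by (simp add: smult_zero_right kl_basis_in_R)
  show "?f (m \<oplus>\<^bsub>M\<^esub> k) = sup (?f m) (?f k)" if "m \<in> carrier M" "k \<in> carrier M" for m k
    using that by (simp add: smult_add_right kl_basis_in_R add_eq_zero_iff basis_smult_closed)
  show "?f (kl_basis n w \<odot>\<^bsub>M\<^esub> m) = ?f m" if "w \<in> D" "m \<in> carrier M" for w m
    using that by (simp add: w0_smult_basis)
  show "kl_lattice_module n (C_w0 n) act_w0" by (rule C_w0_lattice_module)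
  have "True \<in> ?f ` carrier M" using assms by force
  moreover have "False \<in> ?f ` carrier M" using zero by (intro image_eqI[of _ _ "\<zero>\<^bsub>M\<^esub>"]) simp_all
  ultimately show "carrier (C_w0 n) = ?f ` carrier M"
    unfolding C_w0_def kl_semimodule_bool_simps by (auto simp: UNIV_bool)
  show "\<exists>m\<in>carrier M. ?f m \<noteq> bot" using assms by simp
qed

text \<open>
  Number the elements of the left cell by their length and let \<open>h k\<close> be the image of \<open>m\<close> under the
  \<open>k\<close>-th one. A generator sends \<open>h k\<close> to itself or to \<open>h (k + 1) + h (k - 1)\<close>, and a sum vanishes only
  if both summands do. So if one \<open>h k\<close> with \<open>0 < k < n\<close> vanishes, then so do its neighbours and
  finally all of them; the conventions \<open>h 0 = h n = 0\<close> are consistent with this. As \<open>n \<ge> 3\<close>, at least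
  one neighbour of \<open>k\<close> lies again strictly between \<open>0\<close> and \<open>n\<close>.
\<close>

lemma theta_cell_smult_eq_zero_iff:
  assumes w0: "kl_basis n w0 \<odot>\<^bsub>M\<^esub> m = \<zero>\<^bsub>M\<^esub>" and m: "m \<in> carrier M" and w: "w \<in> left_cell n a"
  shows "\<theta> b \<odot>\<^bsub>M\<^esub> (kl_basis n w \<odot>\<^bsub>M\<^esub> m) = \<zero>\<^bsub>M\<^esub> \<longleftrightarrow> \<theta> a \<odot>\<^bsub>M\<^esub> m = \<zero>\<^bsub>M\<^esub>"
    and "kl_basis n w \<odot>\<^bsub>M\<^esub> m = \<zero>\<^bsub>M\<^esub> \<longleftrightarrow> \<theta> a \<odot>\<^bsub>M\<^esub> m = \<zero>\<^bsub>M\<^esub>"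
proof -
  define \<rho> where "\<rho> k = (if odd k then sgn_letter a else - sgn_letter a)" for k :: nat
  define h where "h k = kl_elem (\<rho> k) k \<odot>\<^bsub>M\<^esub> m" for k
  have \<rho>: "\<bar>\<rho> k\<bar> = 1" for k by (simp add: \<rho>_def)
  have closed: "h k \<in> carrier M" for k by (simp add: h_def smult_closed kl_elem_in_R m)
  have h0: "h 0 = \<zero>\<^bsub>M\<^esub>" by (simp add: h_def kl_elem_0 smult_zero_left m)
  have same: "kl_elem (\<rho> k) 1 \<odot>\<^bsub>M\<^esub> h k = h k" if "k \<le> n" for k
  proof -
    have "kl_elem (\<rho> k) 1 \<odot>\<^bsub>M\<^esub> h k = (kl_elem (\<rho> k) 1 \<otimes>\<^bsub>R\<^esub> kl_elem (\<rho> k) k) \<odot>\<^bsub>M\<^esub> m"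
      by (simp add: h_def smult_assoc kl_elem_in_R m)
    also have "\<dots> = (kl_elem (\<rho> k) k \<oplus>\<^bsub>R\<^esub> kl_elem (\<rho> k) k) \<odot>\<^bsub>M\<^esub> m"
      by (simp only: kl_semiring_simps generator_mult_same[OF \<rho> that])
    also have "\<dots> = h k \<oplus>\<^bsub>M\<^esub> h k" by (simp add: h_def smult_add_left kl_elem_in_R m)
    also have "\<dots> = h k" by (rule idempotent[OF closed])
    finally show ?thesis .
  qed
  have opposite: "kl_elem (- \<rho> k) 1 \<odot>\<^bsub>M\<^esub> h k = h (k + 1) \<oplus>\<^bsub>M\<^esub> h (k - 1)" if "0 < k" "k < n" for k
  proof -
    have \<rho>': "\<rho> (k + 1) = - \<rho> k" "\<rho> (k - 1) = - \<rho> k" using that by (simp_all add: \<rho>_def)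
    have "\<bar>- \<rho> k\<bar> = 1" using \<rho>[of k] by simp
    from generator_mult_opposite[OF this that]
    have *: "kl_elem (- \<rho> k) 1 \<otimes>\<^bsub>R\<^esub> kl_elem (\<rho> k) k
        = kl_elem (- \<rho> k) (k + 1) \<oplus>\<^bsub>R\<^esub> kl_elem (- \<rho> k) (k - 1)"
      by (simp only: kl_semiring_simps minus_minus)
    have "kl_elem (- \<rho> k) 1 \<odot>\<^bsub>M\<^esub> h k = (kl_elem (- \<rho> k) 1 \<otimes>\<^bsub>R\<^esub> kl_elem (\<rho> k) k) \<odot>\<^bsub>M\<^esub> m"
      by (simp only: h_def smult_assoc kl_elem_in_R m)
    also have "\<dots> = h (k + 1) \<oplus>\<^bsub>M\<^esub> h (k - 1)"
      unfolding * h_def \<rho>' by (rule smult_add_left[OF kl_elem_in_R kl_elem_in_R m])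
    finally show ?thesis .
  qed
  have neighbours: "h (k + 1) = \<zero>\<^bsub>M\<^esub> \<and> h (k - 1) = \<zero>\<^bsub>M\<^esub>" if "0 < k" "k < n" "h k = \<zero>\<^bsub>M\<^esub>" for k
  proof -
    have "h (k + 1) \<oplus>\<^bsub>M\<^esub> h (k - 1) = \<zero>\<^bsub>M\<^esub>"
      unfolding opposite[OF that(1,2), symmetric] that(3) by (rule smult_zero_right[OF kl_elem_in_R])
    then show ?thesis by (simp add: add_eq_zero_iff closed)
  qed
  have up: "h (Suc k) = \<zero>\<^bsub>M\<^esub>" if "h 1 = \<zero>\<^bsub>M\<^esub>" "Suc k \<le> n" for k
    using that(2)
  proof (induction k)
    case (Suc k)
    then show ?case using neighbours[of "Suc k"] by simp
  qed (use that(1) in simp)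
  have down: "h 1 = \<zero>\<^bsub>M\<^esub>" if "h (Suc k) = \<zero>\<^bsub>M\<^esub>" "Suc k < n" for k
    using that
  proof (induction k)
    case (Suc k)
    then show ?case using neighbours[of "Suc (Suc k)"] by simp
  qed simp
  have iff: "h k = \<zero>\<^bsub>M\<^esub> \<longleftrightarrow> h 1 = \<zero>\<^bsub>M\<^esub>" if "0 < k" "k < n" for k
    using up[of "k - 1"] down[of "k - 1"] that by auto
  obtain \<sigma> k where k: "0 < k" "k < n" "kl_basis n w = kl_elem \<sigma> k" "sgn_letter a = (if odd k then \<sigma> else - \<sigma>)"
    using w by (elim left_cell_elem)
  have "\<sigma> = \<rho> k" using k(4) by (simp add: \<rho>_def)
  then have hk: "kl_basis n w \<odot>\<^bsub>M\<^esub> m = h k" using k(3) by (simp add: h_def)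
  have h1: "h 1 = \<theta> a \<odot>\<^bsub>M\<^esub> m" by (simp add: h_def \<rho>_def)
  show "kl_basis n w \<odot>\<^bsub>M\<^esub> m = \<zero>\<^bsub>M\<^esub> \<longleftrightarrow> \<theta> a \<odot>\<^bsub>M\<^esub> m = \<zero>\<^bsub>M\<^esub>"
    using iff[OF k(1,2)] unfolding hk h1 .
  have "\<theta> b \<odot>\<^bsub>M\<^esub> h k = \<zero>\<^bsub>M\<^esub> \<longleftrightarrow> h 1 = \<zero>\<^bsub>M\<^esub>"
  proof (cases "sgn_letter b = \<rho> k")
    case True
    then show ?thesis using same[of k] iff[OF k(1,2)] k(2) by simp
  next
    case False
    then have "sgn_letter b = - \<rho> k"
      using \<rho>[of k] abs_sgn_letter[of b] by linarith
    then have "\<theta> b \<odot>\<^bsub>M\<^esub> h k = \<zero>\<^bsub>M\<^esub> \<longleftrightarrow> h (k + 1) = \<zero>\<^bsub>M\<^esub> \<and> h (k - 1) = \<zero>\<^bsub>M\<^esub>"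
      using opposite[OF k(1,2)] by (simp add: add_eq_zero_iff closed)
    also have "\<dots> \<longleftrightarrow> h 1 = \<zero>\<^bsub>M\<^esub>"
    proof
      assume z: "h (k + 1) = \<zero>\<^bsub>M\<^esub> \<and> h (k - 1) = \<zero>\<^bsub>M\<^esub>"
      show "h 1 = \<zero>\<^bsub>M\<^esub>"
      proof (cases "k = 1")
        case True
        then show ?thesis using z iff[of "Suc (Suc 0)"] n_ge_3 by simp
      next
        case False
        then show ?thesis using z iff[of "k - 1"] k by simp
      qed
    next
      assume h1: "h 1 = \<zero>\<^bsub>M\<^esub>"
      have "h (k - 1) = \<zero>\<^bsub>M\<^esub>"
        using h0 up[OF h1, of "k - 2"] k by (cases "k = 1") (simp_all add: numeral_2_eq_2 Suc_diff_Suc)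
      moreover have "h (k + 1) = \<zero>\<^bsub>M\<^esub>" using up[OF h1, of k] k by simp
      ultimately show "h (k + 1) = \<zero>\<^bsub>M\<^esub> \<and> h (k - 1) = \<zero>\<^bsub>M\<^esub>" by simp
    qed
    finally show ?thesis .
  qed
  then show "\<theta> b \<odot>\<^bsub>M\<^esub> (kl_basis n w \<odot>\<^bsub>M\<^esub> m) = \<zero>\<^bsub>M\<^esub> \<longleftrightarrow> \<theta> a \<odot>\<^bsub>M\<^esub> m = \<zero>\<^bsub>M\<^esub>"
    unfolding hk h1 .
qed

definition K_map :: "'m \<Rightarrow> pt set" where
  "K_map m = {p. \<exists>a. p = point a \<and> \<theta> a \<odot>\<^bsub>M\<^esub> m \<noteq> \<zero>\<^bsub>M\<^esub>}"

lemma point_inject: "point a = point b \<longleftrightarrow> a = b"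
  by (cases a; cases b) simp_all

lemma point_in_K_map: "point a \<in> K_map m \<longleftrightarrow> \<theta> a \<odot>\<^bsub>M\<^esub> m \<noteq> \<zero>\<^bsub>M\<^esub>"
  by (auto simp: K_map_def point_inject)

lemma pt_set_eqI:
  assumes *: "\<And>a. point a \<in> A \<longleftrightarrow> point a \<in> B"
  shows "A = B"
proof (rule Set.set_eqI)
  fix p
  show "p \<in> A \<longleftrightarrow> p \<in> B" using *[of gen_s] *[of gen_t] by (cases p) simp_all
qed

lemma K_map_basis:
  assumes w0: "\<And>m. m \<in> carrier M \<Longrightarrow> kl_basis n w0 \<odot>\<^bsub>M\<^esub> m = \<zero>\<^bsub>M\<^esub>"
    and w: "w \<in> D" and m: "m \<in> carrier M"
  shows "K_map (kl_basis n w \<odot>\<^bsub>M\<^esub> m) = K_action n w (K_map m)"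
  using w
proof (cases rule: D_cases)
  case e
  then show ?thesis using smult_one[OF m] by (simp add: K_action_e kl_basis_e kl_semiring_simps)
next
  case w0
  then show ?thesis
    using assms(1)[OF m] smult_zero_right[OF kl_elem_in_R] by (simp add: K_action_w0 K_map_def)
next
  case (cell a)
  show ?thesis
    by (rule pt_set_eqI)
      (simp add: K_action_cell[OF cell] point_in_K_map theta_cell_smult_eq_zero_iff(1)[OF w0[OF m] m cell]
        del: One_nat_def)
qed

text \<open>
  The image of the map to \<open>K\<close> contains the top, since a generator sends any element that it does
  not annihilate to one that neither generator annihilates.
\<close>

lemma theta_nonzero_isomorphic:
  assumes w0: "\<And>m. m \<in> carrier M \<Longrightarrow> kl_basis n w0 \<odot>\<^bsub>M\<^esub> m = \<zero>\<^bsub>M\<^esub>"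
    and nonzero: "\<exists>m\<in>carrier M. \<exists>a. \<theta> a \<odot>\<^bsub>M\<^esub> m \<noteq> \<zero>\<^bsub>M\<^esub>"
  shows "\<exists>C. {{}, UNIV} \<subseteq> C \<and> semimodule_isomorphic R M ((K n)\<lparr>carrier := C\<rparr>)"
proof (intro exI conjI)
  have zero: "K_map \<zero>\<^bsub>M\<^esub> = bot"
    by (simp add: K_map_def smult_zero_right[OF kl_elem_in_R])
  obtain m a where m: "m \<in> carrier M" "\<theta> a \<odot>\<^bsub>M\<^esub> m \<noteq> \<zero>\<^bsub>M\<^esub>" using nonzero by blast
  have "K_map (\<theta> a \<odot>\<^bsub>M\<^esub> m) = UNIV"
    unfolding theta_eq using m K_map_basis[OF w0 cls_in_D m(1)] K_action_cell[OF generator_in_left_cell]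
    by (simp add: point_in_K_map)
  moreover have "\<theta> a \<odot>\<^bsub>M\<^esub> m \<in> carrier M" by (rule smult_closed[OF kl_elem_in_R m(1)])
  ultimately have "UNIV \<in> K_map ` carrier M" by (metis image_eqI)
  moreover have "{} \<in> K_map ` carrier M" using zero by (intro image_eqI[of _ _ "\<zero>\<^bsub>M\<^esub>"]) simp_all
  ultimately show C: "{{}, UNIV} \<subseteq> K_map ` carrier M" by simp
  show "semimodule_isomorphic R M ((K n)\<lparr>carrier := K_map ` carrier M\<rparr>)"
  proof (rule nonzero_hom_isomorphic[where act = "K_action n"])
    show "K_map (m \<oplus>\<^bsub>M\<^esub> k) = sup (K_map m) (K_map k)" if "m \<in> carrier M" "k \<in> carrier M" for m k
      using that
      by (intro pt_set_eqI)
        (simp add: point_in_K_map smult_add_right kl_elem_in_R add_eq_zero_iff smult_closed)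
    show "K_map (kl_basis n w \<odot>\<^bsub>M\<^esub> m) = K_action n w (K_map m)" if "w \<in> D" "m \<in> carrier M" for w m
      by (rule K_map_basis[OF w0 that])
    show "kl_lattice_module n ((K n)\<lparr>carrier := K_map ` carrier M\<rparr>) (K_action n)"
      by (rule K_lattice_module[OF C])
    show "\<exists>m\<in>carrier M. K_map m \<noteq> bot"
      using m by (intro bexI[of _ m]) (auto simp: K_map_def)
  qed (simp_all add: zero)
qed

lemma theta_zero_isomorphic:
  assumes w0: "\<And>m. m \<in> carrier M \<Longrightarrow> kl_basis n w0 \<odot>\<^bsub>M\<^esub> m = \<zero>\<^bsub>M\<^esub>"
    and \<theta>: "\<And>m a. m \<in> carrier M \<Longrightarrow> \<theta> a \<odot>\<^bsub>M\<^esub> m = \<zero>\<^bsub>M\<^esub>"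
  shows "semimodule_isomorphic R M (C_e n)"
proof (rule nonzero_hom_isomorphic[where act = act_e and f = "\<lambda>m. m \<noteq> \<zero>\<^bsub>M\<^esub>"])
  let ?f = "\<lambda>m. m \<noteq> \<zero>\<^bsub>M\<^esub>"
  have "carrier M \<noteq> {\<zero>\<^bsub>M\<^esub>}" using elementary by (simp add: elementary_semimodule_def)
  then obtain m where m: "m \<in> carrier M" "m \<noteq> \<zero>\<^bsub>M\<^esub>" using M.zero_closed by blast
  then show "\<exists>m\<in>carrier M. ?f m \<noteq> bot" by (intro bexI[of _ m]) simp_all
  show "?f \<zero>\<^bsub>M\<^esub> = bot" by simp
  show "?f (m \<oplus>\<^bsub>M\<^esub> k) = sup (?f m) (?f k)" if "m \<in> carrier M" "k \<in> carrier M" for m k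
    using that by (simp add: add_eq_zero_iff)
  show "?f (kl_basis n w \<odot>\<^bsub>M\<^esub> m) = act_e w (?f m)" if w: "w \<in> D" and m: "m \<in> carrier M" for w m
    using w
  proof (cases rule: D_cases)
    case e
    then show ?thesis using smult_one[OF m] by (simp add: one_dihedral kl_basis_e kl_semiring_simps)
  next
    case w0
    then show ?thesis using assms(1)[OF m] w0_ne_e by (simp add: one_dihedral)
  next
    case (cell a)
    then show ?thesis
      using theta_cell_smult_eq_zero_iff(2)[OF w0[OF m] m cell] \<theta>[OF m] left_cell_ne(1)[OF cell]
      by (simp add: one_dihedral)
  qed
  show "kl_lattice_module n (C_e n) act_e" by (rule C_e_lattice_module)
  have "True \<in> ?f ` carrier M" using m by force
  moreover have "False \<in> ?f ` carrier M" by (intro image_eqI[of _ _ "\<zero>\<^bsub>M\<^esub>"]) simp_all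
  ultimately show "carrier (C_e n) = ?f ` carrier M"
    unfolding C_e_def kl_semimodule_bool_simps by (auto simp: UNIV_bool)
qed

lemma classification:
  "semimodule_isomorphic R M (C_e n) \<or> semimodule_isomorphic R M (C_w0 n) \<or>
   (\<exists>C. {{}, UNIV} \<subseteq> C \<and> semimodule_isomorphic R M ((K n)\<lparr>carrier := C\<rparr>))"
  using w0_nonzero_isomorphic theta_nonzero_isomorphic theta_zero_isomorphic by blast

end

lemma (in kl_dihedral) K_carrier_cases:
  assumes "{{}, UNIV} \<subseteq> C"
  shows "(K n)\<lparr>carrier := C\<rparr> \<in> {K n, K1 n, K2 n, K3 n}"
proof -
  have K: "(K n)\<lparr>carrier := {{}, {pt_x}, {pt_y}, UNIV}\<rparr> = K n"
    by (simp add: K_def kl_semimodule_def Let_def UNIV_pt Pow_insert insert_commute)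
  have sub: "C \<subseteq> {{}, {pt_x}, {pt_y}, UNIV}"
  proof
    fix A :: "pt set"
    have "A \<in> Pow {pt_x, pt_y}" using UNIV_pt by auto
    then show "A \<in> {{}, {pt_x}, {pt_y}, UNIV}" unfolding UNIV_pt by (auto simp: Pow_insert)
  qed
  consider "{pt_x} \<in> C" "{pt_y} \<in> C" | "{pt_x} \<in> C" "{pt_y} \<notin> C" |
    "{pt_x} \<notin> C" "{pt_y} \<in> C" | "{pt_x} \<notin> C" "{pt_y} \<notin> C" by blast
  then show ?thesis
  proof cases
    case 1
    with sub assms have "C = {{}, {pt_x}, {pt_y}, UNIV}" by blast
    with K show ?thesis by simp
  next
    case 2
    with sub assms have "C = {{}, {pt_x}, UNIV}" by blast
    then show ?thesis by (simp add: K1_def UNIV_pt)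
  next
    case 3
    with sub assms have "C = {{}, {pt_y}, UNIV}" by blast
    then show ?thesis by (simp add: K2_def UNIV_pt)
  next
    case 4
    with sub assms have "C = {{}, UNIV}" by blast
    then show ?thesis by (simp add: K3_def UNIV_pt)
  qed
qed

lemma (in kl_dihedral) K_family:
  "\<exists>C. {{}, UNIV} \<subseteq> C \<and> K n = (K n)\<lparr>carrier := C\<rparr>"
  "\<exists>C. {{}, UNIV} \<subseteq> C \<and> K1 n = (K n)\<lparr>carrier := C\<rparr>"
  "\<exists>C. {{}, UNIV} \<subseteq> C \<and> K2 n = (K n)\<lparr>carrier := C\<rparr>"
  "\<exists>C. {{}, UNIV} \<subseteq> C \<and> K3 n = (K n)\<lparr>carrier := C\<rparr>"
proof -
  show "\<exists>C. {{}, UNIV} \<subseteq> C \<and> K n = (K n)\<lparr>carrier := C\<rparr>"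
    by (intro exI[of _ "carrier (K n)"])
      (simp add: K_def kl_semimodule_def Let_def UNIV_pt)
qed (unfold K1_def K2_def K3_def UNIV_pt, blast+)

theorem theorem10p3:
  fixes n :: nat
  assumes "n \<ge> 3"
  shows
    "(elementary_semimodule (kl_semiring n) (C_e n) \<and> proper_semimodule (kl_semiring n) (C_e n)) \<and>
     (elementary_semimodule (kl_semiring n) (C_w0 n) \<and> proper_semimodule (kl_semiring n) (C_w0 n)) \<and>
     (elementary_semimodule (kl_semiring n) (K n) \<and> proper_semimodule (kl_semiring n) (K n)) \<and>
     (elementary_semimodule (kl_semiring n) (K1 n) \<and> proper_semimodule (kl_semiring n) (K1 n)) \<and>
     (elementary_semimodule (kl_semiring n) (K2 n) \<and> proper_semimodule (kl_semiring n) (K2 n)) \<and>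
     (elementary_semimodule (kl_semiring n) (K3 n) \<and> proper_semimodule (kl_semiring n) (K3 n)) \<and>
     (\<forall>M :: (dih \<Rightarrow> int, 'm) module.
        elementary_semimodule (kl_semiring n) M \<and> proper_semimodule (kl_semiring n) M \<longrightarrow>
          semimodule_isomorphic (kl_semiring n) M (C_e n) \<or>
          semimodule_isomorphic (kl_semiring n) M (C_w0 n) \<or>
          semimodule_isomorphic (kl_semiring n) M (K n) \<or>
          semimodule_isomorphic (kl_semiring n) M (K1 n) \<or>
          semimodule_isomorphic (kl_semiring n) M (K2 n) \<or>
          semimodule_isomorphic (kl_semiring n) M (K3 n))"
proof -
  interpret kl_dihedral n by unfold_locales (rule assms)
  have K: "elementary_semimodule R N \<and> proper_semimodule R N"
    if "\<exists>C. {{}, UNIV} \<subseteq> C \<and> N = (K n)\<lparr>carrier := C\<rparr>" for N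
    using that K_elementary_proper by blast
  have "elementary_semimodule R (C_e n) \<and> proper_semimodule R (C_e n)"
    by (rule bool_elementary_proper[OF C_e_lattice_module]) (simp add: C_e_def kl_semimodule_bool_simps)
  moreover have "elementary_semimodule R (C_w0 n) \<and> proper_semimodule R (C_w0 n)"
    by (rule bool_elementary_proper[OF C_w0_lattice_module]) (simp add: C_w0_def kl_semimodule_bool_simps)
  moreover have "semimodule_isomorphic R M (C_e n) \<or> semimodule_isomorphic R M (C_w0 n) \<or>
      semimodule_isomorphic R M (K n) \<or> semimodule_isomorphic R M (K1 n) \<or>
      semimodule_isomorphic R M (K2 n) \<or> semimodule_isomorphic R M (K3 n)"
    if "elementary_semimodule R M \<and> proper_semimodule R M" for M :: "(dih \<Rightarrow> int, 'm) module"
  proof -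
    interpret elementary_kl_semimodule n M
      using that
      by (intro elementary_kl_semimodule.intro kl_dihedral_axioms elementary_kl_semimodule_axioms.intro)
        (auto simp: elementary_semimodule_def)
    from classification consider "semimodule_isomorphic R M (C_e n)" | "semimodule_isomorphic R M (C_w0 n)" |
      C where "{{}, UNIV} \<subseteq> C" "semimodule_isomorphic R M ((K n)\<lparr>carrier := C\<rparr>)" by blast
    then show ?thesis
    proof cases
      case 3
      obtain N where "N = (K n)\<lparr>carrier := C\<rparr>" by blast
      with 3 K_carrier_cases[OF 3(1)] have "semimodule_isomorphic R M N" "N \<in> {K n, K1 n, K2 n, K3 n}"
        by simp_all
      then show ?thesis by blast
    qed blast+
  qed
  ultimately show ?thesis
    using K[OF K_family(1)] K[OF K_family(2)] K[OF K_family(3)] K[OF K_family(4)] by blast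
qed

end
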